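(* Let $\mathcal D=\mathcal D_1\times\cdots\times\mathcal D_d$ be the product domain of the context and let $\mathcal I\subset\mathbb N_0^d$ be nonempty and finite. Consider the bounded differential operator $$\mathcal A:U\to L^2(\mathcal D),\qquad \mathcal Av=\sum_{\nu\in\mathcal I}a_\nu(z)\,\partial_z^\nu v,\qquad \partial_z^\nu=\partial_{z_1}^{\nu_1}\cdots\partial_{z_d}^{\nu_d},$$ with coefficients satisfying $$a_\nu(z)=\sum_{j=1}^{R_\nu}\prod_{m=1}^da_{\nu,j,m}(z_m),\qquad a_{\nu,j,m}\in C(\overline{\mathcal D_m}),\quad R_\nu\in\mathbb N.$$ Set $q_s:=\max_{\nu\in\mathcal I}\nu_s$ and let $H_s$ be Hilbert spaces such that the Hilbert tensor product $H:=H_1\otimes\cdots\otimes H_d$ is continuously and densely embedded in $U$ and $\partial_{z_s}^\ell:H_s\to L^2(\mathcal D_s)$ is bounded for $\ell=0,\dots,q_s$ (with $\partial_{z_s}^0=I$). Then the separable-operator property and the local differential-channel property (both defined in the context) hold. More precisely: (i) For every $\nu\in\mathcal I$, $j=1,\dots,R_\nu$ and $s=1,\dots,d$, $\mathcal A_s^{(\nu,j)}h:=a_{\nu,j,s}\,\partial_{z_s}^{\nu_s}h$, $h\in H_s$, defines a bounded linear map $\mathcal A_s^{(\nu,j)}:H_s\to L^2(\mathcal D_s)$. (ii) $\displaystyle \mathcal A|_H=\sum_{\nu\in\mathcal I}\sum_{j=1}^{R_\nu}\mathcal A_1^{(\nu,j)}\otimes\cdots\otimes\mathcal A_d^{(\nu,j)}$,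 so that one may take $R_{\mathcal A}=\sum_{\nu\in\mathcal I}R_\nu$ (this representation need not be minimal). (iii) With the identification $\beta\equiv(\nu,j)$, the local differential-channel representation holds with $$\Lambda_s:=\{\nu_s:\nu\in\mathcal I\},\qquad \mathcal D_s^\ell:=\partial_{z_s}^\ell,\qquad b_{s,\ell}^{(\nu,j)}:=a_{\nu,j,s}\,\delta_{\ell\nu_s},\qquad L_s:=|\Lambda_s|\le q_s+1 .$$
   Context: Domain: $d=d_x+d_\xi$; $\Omega=\mathcal D_1\times\cdots\times\mathcal D_{d_x}$, $\Xi=\mathcal D_{d_x+1}\times\cdots\times\mathcal D_d$, $\mathcal D=\Omega\times\Xi$, where $\mathcal D_m=(z_m^-,z_m^+)\subset\mathbb R$ are bounded open intervals. $V$ is a Hilbert space of functions on $\Omega$ with bounded trace $V\to L^2(\partial\Omega)$ and $U=L^2(\Xi;V)$ is the Bochner space, whose elements are regarded as functions on $\mathcal D$. $L^2(\mathcal D)$ is identified with the Hilbert tensor product $\bigotimes_mL^2(\mathcal D_m)$; the elementary tensor $v_1\otimes\cdots\otimes v_d$ is the function $\prod_mv_m(z_m)$. Separable-operator property for $\mathcal A$: there are Hilbert spaces $H_m\hookrightarrow L^2(\mathcal D_m)$ such that (1) the Hilbert tensor product $H=H_1\otimes\cdots\otimes H_d$ satisfies $\|v_1\otimes\cdots\otimes v_d\|_H=\prod_m\|v_m\|_{H_m}$; (2) $H$ is continuously and densely embedded in $U$; (3) $\mathcal A|_H=\sum_{\beta=1}^{R_{\mathcal A}}\mathcal A_1^{(\beta)}\otimes\cdots\otimes\mathcal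 A_d^{(\beta)}$ with $R_{\mathcal A}\in\mathbb N$ and bounded linear $\mathcal A_m^{(\beta)}:H_m\to L^2(\mathcal D_m)$. Local differential-channel property: for every $s$, $\mathcal A_s^{(\beta)}v=\sum_{\ell\in\Lambda_s}b_{s,\ell}^{(\beta)}\,\mathcal D_s^\ell v$ for all $v\in H_s$ and all $\beta$, where $\Lambda_s$ is a finite index set with $L_s=|\Lambda_s|$, $\mathcal D_s^\ell:H_s\to L^2(\mathcal D_s)$ are bounded linear differential operators, and $b_{s,\ell}^{(\beta)}\in C(\overline{\mathcal D_s})$. *)

theory Defs
  imports "HOL-Analysis.Analysis"
begin

section \<open>Hilbert spaces of functions\<close>

text \<open>
  All function spaces are real. As in the usual treatment of $L^2$, their elements are
  represented by measurable functions, and equality means equality almost everywhere with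
  respect to the measure \<open>base\<close>. A carrier-based description is needed because a family
  $H_1, \dots, H_d$ of different spaces cannot be indexed by types.
\<close>

record 'a fspace =
  base :: "'a measure"
  elems :: "('a \<Rightarrow> real) set"
  ip :: "('a \<Rightarrow> real) \<Rightarrow> ('a \<Rightarrow> real) \<Rightarrow> real"

definition nrm :: "'a fspace \<Rightarrow> ('a \<Rightarrow> real) \<Rightarrow> real" where
  "nrm X f = sqrt (ip X f f)"

definition hilbert_space :: "'a fspace \<Rightarrow> bool" where
  "hilbert_space X \<longleftrightarrow>
     elems X \<subseteq> borel_measurable (base X) \<and>
     (\<lambda>x. 0) \<in> elems X \<and>
     (\<forall>f\<in>elems X. \<forall>g\<in>elems X. \<forall>c. (\<lambda>x. c * f x + g x) \<in> elems X) \<and>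
     (\<forall>f\<in>elems X. \<forall>g\<in>borel_measurable (base X).
        (AE x in base X. g x = f x) \<longrightarrow> g \<in> elems X) \<and>
     (\<forall>f\<in>elems X. \<forall>g\<in>elems X. ip X f g = ip X g f) \<and>
     (\<forall>f\<in>elems X. \<forall>g\<in>elems X. \<forall>h\<in>elems X. \<forall>c.
        ip X (\<lambda>x. c * f x + g x) h = c * ip X f h + ip X g h) \<and>
     (\<forall>f\<in>elems X. 0 \<le> ip X f f) \<and>
     (\<forall>f\<in>elems X. ip X f f = 0 \<longleftrightarrow> (AE x in base X. f x = 0)) \<and>
     (\<forall>F. (\<forall>n::nat. F n \<in> elems X) \<and>
          (\<forall>e>0. \<exists>N. \<forall>m\<ge>N. \<forall>n\<ge>N. nrm X (\<lambda>x. F m x - F n x) < e) \<longrightarrow>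
          (\<exists>f\<in>elems X. (\<lambda>n. nrm X (\<lambda>x. F n x - f x)) \<longlonglongrightarrow> 0))"

definition L2 :: "'a measure \<Rightarrow> 'a fspace" where
  "L2 M = \<lparr>base = M,
           elems = {f \<in> borel_measurable M. integrable M (\<lambda>x. (f x)\<^sup>2)},
           ip = (\<lambda>f g. \<integral>x. f x * g x \<partial>M)\<rparr>"

definition cont_embedded :: "'a fspace \<Rightarrow> 'a fspace \<Rightarrow> bool" where
  "cont_embedded X Y \<longleftrightarrow>
     base X = base Y \<and> elems X \<subseteq> elems Y \<and> (\<exists>C. \<forall>f\<in>elems X. nrm Y f \<le> C * nrm X f)"

definition densely_embedded :: "'a fspace \<Rightarrow> 'a fspace \<Rightarrow> bool" where
  "densely_embedded X Y \<longleftrightarrow>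
     base X = base Y \<and> elems X \<subseteq> elems Y \<and>
     (\<forall>u\<in>elems Y. \<forall>e>0. \<exists>f\<in>elems X. nrm Y (\<lambda>x. u x - f x) < e)"

text \<open>
  Operators act on representatives; linearity holds almost everywhere. Together with
  boundedness this makes the operator well defined on classes.
\<close>

definition bounded_op ::
    "'a fspace \<Rightarrow> 'b fspace \<Rightarrow> (('a \<Rightarrow> real) \<Rightarrow> ('b \<Rightarrow> real)) \<Rightarrow> bool" where
  "bounded_op X Y T \<longleftrightarrow>
     (\<forall>f\<in>elems X. T f \<in> elems Y) \<and>
     (\<forall>f\<in>elems X. \<forall>g\<in>elems X. \<forall>c.
        AE y in base Y. T (\<lambda>x. c * f x + g x) y = c * T f y + T g y) \<and>
     (\<exists>C. \<forall>f\<in>elems X. nrm Y (T f) \<le> C * nrm X f)"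


section \<open>Product domains\<close>

text \<open>
  Points of a product of intervals over an index set \<open>J\<close> are extensional functions on \<open>J\<close>.
  With $d = d_x + d_\xi$, the domains $\Omega$, $\Xi$ and $\mathcal D$ correspond to
  \<open>J = {1..dx}\<close>, \<open>J = {dx+1..dx+dxi}\<close> and \<open>J = {1..dx+dxi}\<close>.
\<close>

definition ivl :: "real \<Rightarrow> real \<Rightarrow> real measure" where
  "ivl a b = restrict_space lborel {a<..<b}"

definition box_measure :: "nat set \<Rightarrow> (nat \<Rightarrow> real) \<Rightarrow> (nat \<Rightarrow> real) \<Rightarrow> (nat \<Rightarrow> real) measure" where
  "box_measure J lo hi = (\<Pi>\<^sub>M m\<in>J. ivl (lo m) (hi m))"

text \<open>
  Surface measure on the boundary of the box over \<open>J\<close>: the sum of the Lebesgue measures of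
  its faces. It lives on the closed box and is concentrated on the boundary. (The set function
  below is countably additive, so \<open>measure_of\<close> does not fall back to the zero measure.)
\<close>

definition boundary_measure :: "nat set \<Rightarrow> (nat \<Rightarrow> real) \<Rightarrow> (nat \<Rightarrow> real) \<Rightarrow> (nat \<Rightarrow> real) measure" where
  "boundary_measure J lo hi =
     (let N = (\<Pi>\<^sub>M m\<in>J. restrict_space borel {lo m..hi m}) in
      measure_of (space N) (sets N)
        (\<lambda>E. \<Sum>i\<in>J. \<Sum>c\<in>{lo i, hi i}.
           emeasure (box_measure (J - {i}) lo hi)
             {y \<in> space (box_measure (J - {i}) lo hi). y(i := c) \<in> E}))"

text \<open>
  The trace is required to agree with pointwise restriction for those \<open>v\<close> having a
  representative \<open>w\<close> that is continuous on the closed box.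
\<close>

definition bounded_trace ::
    "nat set \<Rightarrow> (nat \<Rightarrow> real) \<Rightarrow> (nat \<Rightarrow> real) \<Rightarrow> (nat \<Rightarrow> real) fspace \<Rightarrow>
     (((nat \<Rightarrow> real) \<Rightarrow> real) \<Rightarrow> ((nat \<Rightarrow> real) \<Rightarrow> real)) \<Rightarrow> bool" where
  "bounded_trace J lo hi V tr \<longleftrightarrow>
     bounded_op V (L2 (boundary_measure J lo hi)) tr \<and>
     (\<forall>v\<in>elems V. \<forall>w. continuous_on (\<Pi>\<^sub>E m\<in>J. {lo m..hi m}) w \<and>
        (AE x in base V. w x = v x) \<longrightarrow>
        (AE x in boundary_measure J lo hi. tr v x = w x))"

text \<open>
  The Bochner space $L^2(\Xi; V)$ as a space of functions on $\Omega \times \Xi$: jointly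
  measurable \<open>u\<close> such that \<open>\<xi> \<mapsto> u(\<cdot>, \<xi>)\<close> is a strongly measurable, square integrable
  \<open>V\<close>-valued map. The sections lie in \<open>V\<close> only for almost every \<open>\<xi>\<close>, and \<open>ip V\<close> is
  unspecified elsewhere; integrating over the completed measure makes the values on that
  null set irrelevant.
\<close>

definition bochner_L2 ::
    "nat set \<Rightarrow> nat set \<Rightarrow> (nat \<Rightarrow> real) \<Rightarrow> (nat \<Rightarrow> real) \<Rightarrow> (nat \<Rightarrow> real) fspace \<Rightarrow>
     (nat \<Rightarrow> real) fspace" where
  "bochner_L2 J K lo hi V =
     (let \<Xi> = box_measure K lo hi;
          sec = (\<lambda>u \<xi> x. u (merge J K (x, \<xi>))) in
      \<lparr>base = box_measure (J \<union> K) lo hi,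
       elems = {u \<in> borel_measurable (box_measure (J \<union> K) lo hi).
          (AE \<xi> in \<Xi>. sec u \<xi> \<in> elems V) \<and>
          (\<exists>S. (\<forall>n::nat. simple_function \<Xi> (S n) \<and> (\<forall>\<xi>\<in>space \<Xi>. S n \<xi> \<in> elems V)) \<and>
               (AE \<xi> in \<Xi>. (\<lambda>n. nrm V (\<lambda>x. S n \<xi> x - sec u \<xi> x)) \<longlonglongrightarrow> 0)) \<and>
          integrable (completion \<Xi>) (\<lambda>\<xi>. ip V (sec u \<xi>) (sec u \<xi>))},
       ip = (\<lambda>u w. \<integral>\<xi>. ip V (sec u \<xi>) (sec w \<xi>) \<partial>completion \<Xi>)\<rparr>)"


section \<open>Weak derivatives\<close>

definition test_fun1 :: "real \<Rightarrow> real \<Rightarrow> (real \<Rightarrow> real) \<Rightarrow> bool" where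
  "test_fun1 a b \<phi> \<longleftrightarrow>
     (\<forall>n t. (deriv ^^ n) \<phi> differentiable (at t)) \<and>
     (\<exists>K. compact K \<and> K \<subseteq> {a<..<b} \<and> (\<forall>t. t \<notin> K \<longrightarrow> \<phi> t = 0))"

definition has_weak_deriv1 ::
    "real \<Rightarrow> real \<Rightarrow> nat \<Rightarrow> (real \<Rightarrow> real) \<Rightarrow> (real \<Rightarrow> real) \<Rightarrow> bool" where
  "has_weak_deriv1 a b l f g \<longleftrightarrow>
     f \<in> borel_measurable (ivl a b) \<and> g \<in> borel_measurable (ivl a b) \<and>
     (\<forall>K. compact K \<and> K \<subseteq> {a<..<b} \<longrightarrow>
        set_integrable (ivl a b) K f \<and> set_integrable (ivl a b) K g) \<and>
     (\<forall>\<phi>. test_fun1 a b \<phi> \<longrightarrow>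
        (\<integral>t. f t * (deriv ^^ l) \<phi> t \<partial>ivl a b) = (- 1) ^ l * (\<integral>t. g t * \<phi> t \<partial>ivl a b))"

definition wderiv1 :: "real \<Rightarrow> real \<Rightarrow> nat \<Rightarrow> (real \<Rightarrow> real) \<Rightarrow> (real \<Rightarrow> real)" where
  "wderiv1 a b l f = (if l = 0 then f else (SOME g. has_weak_deriv1 a b l f g))"

definition partial :: "nat \<Rightarrow> ((nat \<Rightarrow> real) \<Rightarrow> real) \<Rightarrow> ((nat \<Rightarrow> real) \<Rightarrow> real)" where
  "partial m \<phi> = (\<lambda>z. deriv (\<lambda>t. \<phi> (z(m := t))) (z m))"

definition mpartial :: "nat \<Rightarrow> (nat \<Rightarrow> nat) \<Rightarrow> ((nat \<Rightarrow> real) \<Rightarrow> real) \<Rightarrow> ((nat \<Rightarrow> real) \<Rightarrow> real)" where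
  "mpartial d \<nu> \<phi> = foldr (\<lambda>m. partial m ^^ \<nu> m) [1..<Suc d] \<phi>"

text \<open>
  Smooth compactly supported functions on the box over \<open>{1..d}\<close>: every iterated partial
  derivative exists and is continuous on $\mathbb R^d$, i.e. on the extensional functions on
  \<open>{1..d}\<close> with the topology of pointwise convergence.
\<close>

definition test_fun :: "nat \<Rightarrow> (nat \<Rightarrow> real) \<Rightarrow> (nat \<Rightarrow> real) \<Rightarrow> ((nat \<Rightarrow> real) \<Rightarrow> real) \<Rightarrow> bool" where
  "test_fun d lo hi \<phi> \<longleftrightarrow>
     (\<forall>ms. set ms \<subseteq> {1..d} \<longrightarrow>
        continuous_on (\<Pi>\<^sub>E m\<in>{1..d}. UNIV) (foldr partial ms \<phi>) \<and>
        (\<forall>m\<in>{1..d}. \<forall>z\<in>(\<Pi>\<^sub>E m\<in>{1..d}. UNIV).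
           (\<lambda>t. foldr partial ms \<phi> (z(m := t))) differentiable (at (z m)))) \<and>
     (\<exists>K. compact K \<and> K \<subseteq> (\<Pi>\<^sub>E m\<in>{1..d}. {lo m<..<hi m}) \<and>
        (\<forall>z\<in>(\<Pi>\<^sub>E m\<in>{1..d}. UNIV). z \<notin> K \<longrightarrow> \<phi> z = 0))"

definition has_weak_deriv ::
    "nat \<Rightarrow> (nat \<Rightarrow> real) \<Rightarrow> (nat \<Rightarrow> real) \<Rightarrow> (nat \<Rightarrow> nat) \<Rightarrow>
     ((nat \<Rightarrow> real) \<Rightarrow> real) \<Rightarrow> ((nat \<Rightarrow> real) \<Rightarrow> real) \<Rightarrow> bool" where
  "has_weak_deriv d lo hi \<nu> f g \<longleftrightarrow>
     (let M = box_measure {1..d} lo hi in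
      f \<in> borel_measurable M \<and> g \<in> borel_measurable M \<and>
      (\<forall>K. compact K \<and> K \<subseteq> (\<Pi>\<^sub>E m\<in>{1..d}. {lo m<..<hi m}) \<longrightarrow>
         set_integrable M K f \<and> set_integrable M K g) \<and>
      (\<forall>\<phi>. test_fun d lo hi \<phi> \<longrightarrow>
         (\<integral>z. f z * mpartial d \<nu> \<phi> z \<partial>M) =
         (- 1) ^ (\<Sum>m\<in>{1..d}. \<nu> m) * (\<integral>z. g z * \<phi> z \<partial>M)))"

definition wderiv ::
    "nat \<Rightarrow> (nat \<Rightarrow> real) \<Rightarrow> (nat \<Rightarrow> real) \<Rightarrow> (nat \<Rightarrow> nat) \<Rightarrow>
     ((nat \<Rightarrow> real) \<Rightarrow> real) \<Rightarrow> ((nat \<Rightarrow> real) \<Rightarrow> real)" where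
  "wderiv d lo hi \<nu> f = (SOME g. has_weak_deriv d lo hi \<nu> f g)"

text \<open>\<open>\<partial>\<^sup>l : X \<rightarrow> L\<^sup>2\<close> is a well-defined bounded operator on the space \<open>X\<close>.\<close>

definition wderiv1_bounded :: "real \<Rightarrow> real \<Rightarrow> nat \<Rightarrow> real fspace \<Rightarrow> bool" where
  "wderiv1_bounded a b l X \<longleftrightarrow>
     (\<forall>h\<in>elems X. \<exists>g. has_weak_deriv1 a b l h g) \<and>
     bounded_op X (L2 (ivl a b)) (wderiv1 a b l)"

text \<open>
  A bounded operator \<open>A : U \<rightarrow> L\<^sup>2(\<D>)\<close> given by \<open>A v = \<Sum>\<^bsub>\<nu>\<in>I\<^esub> a\<^sub>\<nu> \<partial>\<^sup>\<nu> v\<close> on all of \<open>U\<close>.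
\<close>

definition bounded_diff_op ::
    "nat \<Rightarrow> (nat \<Rightarrow> real) \<Rightarrow> (nat \<Rightarrow> real) \<Rightarrow> (nat \<Rightarrow> real) fspace \<Rightarrow> (nat \<Rightarrow> nat) set \<Rightarrow>
     ((nat \<Rightarrow> nat) \<Rightarrow> (nat \<Rightarrow> real) \<Rightarrow> real) \<Rightarrow>
     (((nat \<Rightarrow> real) \<Rightarrow> real) \<Rightarrow> ((nat \<Rightarrow> real) \<Rightarrow> real)) \<Rightarrow> bool" where
  "bounded_diff_op d lo hi U I a A \<longleftrightarrow>
     bounded_op U (L2 (box_measure {1..d} lo hi)) A \<and>
     (\<forall>v\<in>elems U.
        (\<forall>\<nu>\<in>I. \<exists>g. has_weak_deriv d lo hi \<nu> v g) \<and>
        (AE z in box_measure {1..d} lo hi. A v z = (\<Sum>\<nu>\<in>I. a \<nu> z * wderiv d lo hi \<nu> v z)))"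


section \<open>Tensor products\<close>

definition etensor :: "nat \<Rightarrow> (nat \<Rightarrow> real \<Rightarrow> real) \<Rightarrow> (nat \<Rightarrow> real) \<Rightarrow> real" where
  "etensor d v = (\<lambda>z. \<Prod>m\<in>{1..d}. v m (z m))"

text \<open>
  \<open>H\<close> is the Hilbert tensor product of \<open>Hs 1, \<dots>, Hs d\<close>, realized as a space of functions on
  the product domain: a Hilbert space in which the elementary tensors have the product inner
  products and a dense span.
\<close>

definition hilbert_tensor :: "nat \<Rightarrow> (nat \<Rightarrow> real fspace) \<Rightarrow> (nat \<Rightarrow> real) fspace \<Rightarrow> bool" where
  "hilbert_tensor d Hs H \<longleftrightarrow>
     hilbert_space H \<and> base H = (\<Pi>\<^sub>M m\<in>{1..d}. base (Hs m)) \<and>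
     (\<forall>v. (\<forall>m\<in>{1..d}. v m \<in> elems (Hs m)) \<longrightarrow> etensor d v \<in> elems H) \<and>
     (\<forall>v w. (\<forall>m\<in>{1..d}. v m \<in> elems (Hs m) \<and> w m \<in> elems (Hs m)) \<longrightarrow>
        ip H (etensor d v) (etensor d w) = (\<Prod>m\<in>{1..d}. ip (Hs m) (v m) (w m))) \<and>
     (\<forall>h\<in>elems H. \<forall>e>0. \<exists>n c v.
        (\<forall>k<n. \<forall>m\<in>{1..d}. v k m \<in> elems (Hs m)) \<and>
        nrm H (\<lambda>z. h z - (\<Sum>k<(n::nat). c k * etensor d (v k) z)) < e)"

text \<open>
  \<open>T : H \<rightarrow> L\<^sup>2(\<D>)\<close> is the tensor product of the operators \<open>S m : Hs m \<rightarrow> L\<^sup>2(\<D>\<^sub>m)\<close>, i.e. the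
  unique bounded operator with the prescribed values on elementary tensors.
\<close>

definition is_tensor_op ::
    "nat \<Rightarrow> (nat \<Rightarrow> real) \<Rightarrow> (nat \<Rightarrow> real) \<Rightarrow> (nat \<Rightarrow> real fspace) \<Rightarrow> (nat \<Rightarrow> real) fspace \<Rightarrow>
     (nat \<Rightarrow> (real \<Rightarrow> real) \<Rightarrow> (real \<Rightarrow> real)) \<Rightarrow>
     (((nat \<Rightarrow> real) \<Rightarrow> real) \<Rightarrow> ((nat \<Rightarrow> real) \<Rightarrow> real)) \<Rightarrow> bool" where
  "is_tensor_op d lo hi Hs H S T \<longleftrightarrow>
     bounded_op H (L2 (box_measure {1..d} lo hi)) T \<and>
     (\<forall>v. (\<forall>m\<in>{1..d}. v m \<in> elems (Hs m)) \<longrightarrow>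
        (AE z in box_measure {1..d} lo hi. T (etensor d v) z = etensor d (\<lambda>m. S m (v m)) z))"


section \<open>Separable operators and local differential channels\<close>

text \<open>
  The data whose existence the two properties assert (the spaces, the number of terms \<open>RA\<close>,
  the factors \<open>As \<beta> m\<close>; the channel indices \<open>\<Lambda>\<close>, channels \<open>D\<close> and coefficients \<open>b\<close>) are
  arguments of the predicates.
\<close>

definition separable_operator_property ::
    "nat \<Rightarrow> (nat \<Rightarrow> real) \<Rightarrow> (nat \<Rightarrow> real) \<Rightarrow> (nat \<Rightarrow> real) fspace \<Rightarrow>
     (((nat \<Rightarrow> real) \<Rightarrow> real) \<Rightarrow> ((nat \<Rightarrow> real) \<Rightarrow> real)) \<Rightarrow>
     (nat \<Rightarrow> real fspace) \<Rightarrow> (nat \<Rightarrow> real) fspace \<Rightarrow> nat \<Rightarrow>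
     (nat \<Rightarrow> nat \<Rightarrow> (real \<Rightarrow> real) \<Rightarrow> (real \<Rightarrow> real)) \<Rightarrow> bool" where
  "separable_operator_property d lo hi U A Hs H RA As \<longleftrightarrow>
     (\<forall>m\<in>{1..d}. hilbert_space (Hs m) \<and> cont_embedded (Hs m) (L2 (ivl (lo m) (hi m)))) \<and>
     hilbert_tensor d Hs H \<and>
     (\<forall>v. (\<forall>m\<in>{1..d}. v m \<in> elems (Hs m)) \<longrightarrow>
        nrm H (etensor d v) = (\<Prod>m\<in>{1..d}. nrm (Hs m) (v m))) \<and>
     cont_embedded H U \<and> densely_embedded H U \<and>
     1 \<le> RA \<and>
     (\<forall>\<beta>\<in>{1..RA}. \<forall>m\<in>{1..d}. bounded_op (Hs m) (L2 (ivl (lo m) (hi m))) (As \<beta> m)) \<and>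
     (\<exists>T. (\<forall>\<beta>\<in>{1..RA}. is_tensor_op d lo hi Hs H (As \<beta>) (T \<beta>)) \<and>
          (\<forall>h\<in>elems H. AE z in box_measure {1..d} lo hi. A h z = (\<Sum>\<beta>=1..RA. T \<beta> h z)))"

definition differential_op1 ::
    "real \<Rightarrow> real \<Rightarrow> real fspace \<Rightarrow> ((real \<Rightarrow> real) \<Rightarrow> (real \<Rightarrow> real)) \<Rightarrow> bool" where
  "differential_op1 a b X D \<longleftrightarrow>
     (\<exists>K c. finite K \<and> (\<forall>k\<in>K. continuous_on {a..b} (c k)) \<and>
        (\<forall>h\<in>elems X. (\<forall>k\<in>K. \<exists>g. has_weak_deriv1 a b k h g) \<and>
           (AE t in ivl a b. D h t = (\<Sum>k\<in>K. c k t * wderiv1 a b k h t))))"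

definition local_channel_property ::
    "nat \<Rightarrow> (nat \<Rightarrow> real) \<Rightarrow> (nat \<Rightarrow> real) \<Rightarrow> (nat \<Rightarrow> real fspace) \<Rightarrow> nat \<Rightarrow>
     (nat \<Rightarrow> nat \<Rightarrow> (real \<Rightarrow> real) \<Rightarrow> (real \<Rightarrow> real)) \<Rightarrow>
     (nat \<Rightarrow> nat set) \<Rightarrow> (nat \<Rightarrow> nat \<Rightarrow> (real \<Rightarrow> real) \<Rightarrow> (real \<Rightarrow> real)) \<Rightarrow>
     (nat \<Rightarrow> nat \<Rightarrow> nat \<Rightarrow> real \<Rightarrow> real) \<Rightarrow> bool" where
  "local_channel_property d lo hi Hs RA As \<Lambda> D b \<longleftrightarrow>
     (\<forall>s\<in>{1..d}.
        finite (\<Lambda> s) \<and>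
        (\<forall>l\<in>\<Lambda> s. bounded_op (Hs s) (L2 (ivl (lo s) (hi s))) (D s l) \<and>
                  differential_op1 (lo s) (hi s) (Hs s) (D s l)) \<and>
        (\<forall>\<beta>\<in>{1..RA}.
           (\<forall>l\<in>\<Lambda> s. continuous_on {lo s..hi s} (b s l \<beta>)) \<and>
           (\<forall>v\<in>elems (Hs s). AE t in ivl (lo s) (hi s).
              As \<beta> s v t = (\<Sum>l\<in>\<Lambda> s. b s l \<beta> t * D s l v t))))"


section \<open>The data of the proposition\<close>

definition max_order :: "(nat \<Rightarrow> nat) set \<Rightarrow> nat \<Rightarrow> nat" where
  "max_order I s = Max ((\<lambda>\<nu>. \<nu> s) ` I)"

definition orders :: "(nat \<Rightarrow> nat) set \<Rightarrow> nat \<Rightarrow> nat set" where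
  "orders I s = {\<nu> s |\<nu>. \<nu> \<in> I}"

definition factor_op ::
    "(nat \<Rightarrow> real) \<Rightarrow> (nat \<Rightarrow> real) \<Rightarrow> ((nat \<Rightarrow> nat) \<Rightarrow> nat \<Rightarrow> nat \<Rightarrow> real \<Rightarrow> real) \<Rightarrow>
     (nat \<Rightarrow> nat) \<times> nat \<Rightarrow> nat \<Rightarrow> (real \<Rightarrow> real) \<Rightarrow> (real \<Rightarrow> real)" where
  "factor_op lo hi \<alpha> = (\<lambda>(\<nu>, j) s h t. \<alpha> \<nu> j s t * wderiv1 (lo s) (hi s) (\<nu> s) h t)"

definition channel_coeff ::
    "((nat \<Rightarrow> nat) \<Rightarrow> nat \<Rightarrow> nat \<Rightarrow> real \<Rightarrow> real) \<Rightarrow> nat \<Rightarrow> nat \<Rightarrow> (nat \<Rightarrow> nat) \<times> nat \<Rightarrow> real \<Rightarrow> real" where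
  "channel_coeff \<alpha> s l = (\<lambda>(\<nu>, j) t. \<alpha> \<nu> j s t * (if l = \<nu> s then 1 else 0))"

end

theory Submission
  imports Defs
begin

text \<open>
  The tensor product of bounded operators exists because the inequality
  $0 \le G' \le C^2 G$ between the Gram matrices of $(v_k)$ and $(S v_k)$ in each factor is
  preserved by entrywise products (Schur product theorem); this bounds $\bigotimes_m S_m$ on the
  span of the elementary tensors, from where it extends by density.
  Both \<open>A\<close> and the sum of the tensor operators are bounded on \<open>H\<close>, so it suffices to
  compare them on an elementary tensor. There, integrating by parts in one variable at a time
  against a (non-product) test function shows that the tensor of the one-dimensional weak
  derivatives is a weak derivative, and weak derivatives are unique because products of
  one-dimensional bump functions detect all boxes.
\<close>

section \<open>Hilbert spaces and bounded operators\<close>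

text \<open>An element of the span of the elementary tensors has many representations as a sum, and
  the summands are not orthogonal. Neither single-valuedness of the tensor operator nor a uniform
  bound can therefore be read off term by term. One estimate, involving only the norm of the whole
  sum, gives both: the difference of two representations of the same function is a sum of norm zero,
  and so is its image.

  All identities live on representatives. Linearity of an operator holds only almost everywhere, the
  inner product is not postulated to respect null sets, and a weak derivative is an arbitrary choice
  among its versions. This is why so much is phrased through norms of differences.

  The two uses of test functions are asymmetric. To show that something is a weak derivative, every
  test function must be handled; this works because freezing all coordinates but one leaves a
  one-dimensional test function. To show uniqueness, a convenient subfamily is enough. There the
  obstacle is that weak derivatives are only locally integrable, so the argument runs on boxes kept
  away from the boundary, which then exhaust the domain.\<close>

context
  fixes X :: "'a fspace"
  assumes X: "hilbert_space X"
begin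

text \<open>Selecting the nine clauses by position lets each later fact use exactly one of them,
  instead of searching through the whole quantified definition.\<close>

lemmas hilbert_axioms =
  X[unfolded hilbert_space_def, THEN conjunct1]
  X[unfolded hilbert_space_def, THEN conjunct2, THEN conjunct1]
  X[unfolded hilbert_space_def, THEN conjunct2, THEN conjunct2, THEN conjunct1]
  X[unfolded hilbert_space_def, THEN conjunct2, THEN conjunct2, THEN conjunct2, THEN conjunct1]
  X[unfolded hilbert_space_def, THEN conjunct2, THEN conjunct2, THEN conjunct2, THEN conjunct2, THEN conjunct1]
  X[unfolded hilbert_space_def, THEN conjunct2, THEN conjunct2, THEN conjunct2, THEN conjunct2, THEN conjunct2, THEN conjunct1]
  X[unfolded hilbert_space_def, THEN conjunct2, THEN conjunct2, THEN conjunct2, THEN conjunct2, THEN conjunct2, THEN conjunct2, THEN conjunct1]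
  X[unfolded hilbert_space_def, THEN conjunct2, THEN conjunct2, THEN conjunct2, THEN conjunct2, THEN conjunct2, THEN conjunct2, THEN conjunct2, THEN conjunct1]
  X[unfolded hilbert_space_def, THEN conjunct2, THEN conjunct2, THEN conjunct2, THEN conjunct2, THEN conjunct2, THEN conjunct2, THEN conjunct2, THEN conjunct2]

lemma hilbert_zero: "(\<lambda>x. 0) \<in> elems X"
  using hilbert_axioms(2) by blast

lemma hilbert_lincomb: "f \<in> elems X \<Longrightarrow> g \<in> elems X \<Longrightarrow> (\<lambda>x. c * f x + g x) \<in> elems X"
  using hilbert_axioms(3) by blast

lemma hilbert_ip_commute: "f \<in> elems X \<Longrightarrow> g \<in> elems X \<Longrightarrow> ip X f g = ip X g f"
  using hilbert_axioms(5) by blast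

lemma hilbert_ip_lincomb_left:
  "f \<in> elems X \<Longrightarrow> g \<in> elems X \<Longrightarrow> h \<in> elems X \<Longrightarrow>
    ip X (\<lambda>x. c * f x + g x) h = c * ip X f h + ip X g h"
  using hilbert_axioms(6) by blast

lemma hilbert_ip_nonneg: "f \<in> elems X \<Longrightarrow> 0 \<le> ip X f f"
  using hilbert_axioms(7) by blast

lemma hilbert_ip_eq_0_iff: "f \<in> elems X \<Longrightarrow> ip X f f = 0 \<longleftrightarrow> (AE x in base X. f x = 0)"
  using hilbert_axioms(8) by blast

lemma hilbert_complete:
  assumes "\<And>n::nat. F n \<in> elems X"
    and "\<And>e. 0 < e \<Longrightarrow> \<exists>N. \<forall>m\<ge>N. \<forall>n\<ge>N. nrm X (\<lambda>x. F m x - F n x) < e"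
  obtains f where "f \<in> elems X" "(\<lambda>n. nrm X (\<lambda>x. F n x - f x)) \<longlonglongrightarrow> 0"
  using assms hilbert_axioms(9) by blast

lemma hilbert_scale: "f \<in> elems X \<Longrightarrow> (\<lambda>x. c * f x) \<in> elems X"
  using hilbert_lincomb[of f "\<lambda>x. 0" c] hilbert_zero by simp

lemma hilbert_add: "f \<in> elems X \<Longrightarrow> g \<in> elems X \<Longrightarrow> (\<lambda>x. f x + g x) \<in> elems X"
  using hilbert_lincomb[of f g 1] by simp

lemma hilbert_diff: "f \<in> elems X \<Longrightarrow> g \<in> elems X \<Longrightarrow> (\<lambda>x. f x - g x) \<in> elems X"
  using hilbert_lincomb[of g f "-1"] by simp

lemma hilbert_sum:
  "finite F \<Longrightarrow> (\<And>i. i \<in> F \<Longrightarrow> f i \<in> elems X) \<Longrightarrow> (\<lambda>x. \<Sum>i\<in>F. c i * f i x) \<in> elems X"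
  by (induction rule: finite_induct) (auto intro: hilbert_zero hilbert_lincomb)

lemma hilbert_ip_lincomb_right:
  "f \<in> elems X \<Longrightarrow> g \<in> elems X \<Longrightarrow> h \<in> elems X \<Longrightarrow>
    ip X h (\<lambda>x. c * f x + g x) = c * ip X h f + ip X h g"
  using hilbert_ip_commute[of h "\<lambda>x. c * f x + g x"] hilbert_ip_commute[of h f] hilbert_ip_commute[of h g]
    hilbert_ip_lincomb_left[of f g h c] hilbert_lincomb[of f g c] by simp

lemma hilbert_ip_zero_left: "f \<in> elems X \<Longrightarrow> ip X (\<lambda>x. 0) f = 0"
  using hilbert_ip_lincomb_left[OF hilbert_zero hilbert_zero, of f 1] by simp

lemma hilbert_ip_sum_left:
  assumes "finite F" "\<And>i. i \<in> F \<Longrightarrow> f i \<in> elems X" "g \<in> elems X"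
  shows "ip X (\<lambda>x. \<Sum>i\<in>F. c i * f i x) g = (\<Sum>i\<in>F. c i * ip X (f i) g)"
  using assms
  by (induction rule: finite_induct) (auto simp: hilbert_ip_zero_left hilbert_ip_lincomb_left hilbert_sum)

lemma hilbert_ip_sum:
  assumes "finite F" "\<And>i. i \<in> F \<Longrightarrow> f i \<in> elems X"
  shows "ip X (\<lambda>x. \<Sum>i\<in>F. c i * f i x) (\<lambda>x. \<Sum>i\<in>F. c i * f i x)
    = (\<Sum>i\<in>F. \<Sum>j\<in>F. c i * c j * ip X (f i) (f j))"
proof -
  have "ip X (f i) (\<lambda>x. \<Sum>j\<in>F. c j * f j x) = (\<Sum>j\<in>F. c j * ip X (f i) (f j))" if "i \<in> F" for i
  proof -
    have "ip X (f i) (\<lambda>x. \<Sum>j\<in>F. c j * f j x) = ip X (\<lambda>x. \<Sum>j\<in>F. c j * f j x) (f i)"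
      using that assms hilbert_sum[OF assms(1), of f c] by (intro hilbert_ip_commute) auto
    also have "\<dots> = (\<Sum>j\<in>F. c j * ip X (f j) (f i))"
      using that assms by (intro hilbert_ip_sum_left) auto
    also have "\<dots> = (\<Sum>j\<in>F. c j * ip X (f i) (f j))"
      using that assms by (intro sum.cong refl) (metis hilbert_ip_commute)
    finally show ?thesis .
  qed
  then show ?thesis
    using assms hilbert_sum[OF assms(1), of f c]
    by (subst hilbert_ip_sum_left) (auto simp: sum_distrib_left mult_ac intro!: sum.cong)
qed

lemma hilbert_nrm_nonneg: "f \<in> elems X \<Longrightarrow> 0 \<le> nrm X f"
  by (simp add: nrm_def hilbert_ip_nonneg)

lemma hilbert_nrm_power2: "f \<in> elems X \<Longrightarrow> (nrm X f)\<^sup>2 = ip X f f"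
  by (simp add: nrm_def hilbert_ip_nonneg)

lemma hilbert_nrm_eq_0_iff: "f \<in> elems X \<Longrightarrow> nrm X f = 0 \<longleftrightarrow> (AE x in base X. f x = 0)"
  by (simp add: nrm_def hilbert_ip_eq_0_iff)

lemma hilbert_Cauchy_Schwarz:
  assumes f: "f \<in> elems X" and g: "g \<in> elems X"
  shows "\<bar>ip X f g\<bar> \<le> nrm X f * nrm X g"
proof -
  have q: "0 \<le> t\<^sup>2 * ip X f f + 2 * t * ip X f g + ip X g g" for t
  proof -
    have "0 \<le> ip X (\<lambda>x. t * f x + g x) (\<lambda>x. t * f x + g x)"
      by (intro hilbert_ip_nonneg hilbert_lincomb f g)
    also have "\<dots> = t * (t * ip X f f + ip X f g) + (t * ip X f g + ip X g g)"
      using f g hilbert_ip_commute[OF f g]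
      by (simp add: hilbert_ip_lincomb_left hilbert_ip_lincomb_right hilbert_lincomb)
    also have "\<dots> = t\<^sup>2 * ip X f f + 2 * t * ip X f g + ip X g g"
      by (simp add: power2_eq_square algebra_simps)
    finally show ?thesis .
  qed
  have "(ip X f g)\<^sup>2 \<le> ip X f f * ip X g g"
  proof (cases "ip X f f = 0")
    case True
    have "ip X f g = 0"
    proof (rule ccontr)
      assume n: "ip X f g \<noteq> 0"
      \<comment> \<open>Since \<open>ip X f f = 0\<close>, the quadratic \<open>q\<close> is affine
        in \<open>t\<close>; at this \<open>t\<close> its value is -1.\<close>
      show False
        using q[of "- (ip X g g + 1) / (2 * ip X f g)"] n True by (simp add: field_simps)
    qed
    then show ?thesis using True by simp
  next
    case False
    then have p: "ip X f f > 0" using hilbert_ip_nonneg[OF f] by simp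
    \<comment> \<open>The value of \<open>t\<close> is the minimizer of the quadratic.\<close>
    show ?thesis
      using q[of "- ip X f g / ip X f f"] p by (simp add: field_simps power2_eq_square)
  qed
  then have "sqrt ((ip X f g)\<^sup>2) \<le> sqrt (ip X f f * ip X g g)" by (rule real_sqrt_le_mono)
  then show ?thesis by (simp add: nrm_def real_sqrt_mult)
qed

lemma hilbert_nrm_scale:
  assumes "f \<in> elems X"
  shows "nrm X (\<lambda>x. c * f x) = \<bar>c\<bar> * nrm X f"
proof -
  have "ip X (\<lambda>x. c * f x) (\<lambda>x. c * f x) = c\<^sup>2 * ip X f f"
    using hilbert_ip_sum[of "{()}" "\<lambda>_. f" "\<lambda>_. c"] assms by (simp add: power2_eq_square)
  then show ?thesis by (simp add: nrm_def real_sqrt_mult)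
qed

lemma hilbert_nrm_triangle:
  assumes f: "f \<in> elems X" and g: "g \<in> elems X"
  shows "nrm X (\<lambda>x. f x + g x) \<le> nrm X f + nrm X g"
proof -
  have "ip X (\<lambda>x. f x + g x) (\<lambda>x. f x + g x) = ip X f f + 2 * ip X f g + ip X g g"
    using hilbert_ip_lincomb_left[OF f g hilbert_add[OF f g], of 1]
      hilbert_ip_lincomb_right[OF f g f, of 1] hilbert_ip_lincomb_right[OF f g g, of 1]
      hilbert_ip_commute[OF f g] by simp
  then have "(nrm X (\<lambda>x. f x + g x))\<^sup>2 \<le> (nrm X f + nrm X g)\<^sup>2"
    using hilbert_Cauchy_Schwarz[OF f g] f g
    by (simp add: hilbert_nrm_power2 hilbert_add power2_sum)
  then show ?thesis
    using hilbert_nrm_nonneg f g by (meson add_nonneg_nonneg power2_le_imp_le)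
qed

lemma hilbert_nrm_lincomb:
  assumes "f \<in> elems X" "g \<in> elems X"
  shows "nrm X (\<lambda>x. c * f x + g x) \<le> \<bar>c\<bar> * nrm X f + nrm X g"
  using hilbert_nrm_triangle[OF hilbert_scale[OF assms(1), of c] assms(2)]
  by (simp add: hilbert_nrm_scale assms)

lemma hilbert_nrm_minus_commute:
  assumes "f \<in> elems X" "g \<in> elems X"
  shows "nrm X (\<lambda>x. f x - g x) = nrm X (\<lambda>x. g x - f x)"
  using hilbert_nrm_scale[OF hilbert_diff[OF assms], of "-1"] by simp

lemma hilbert_nrm_triangle_diff:
  assumes "f \<in> elems X" "g \<in> elems X" "h \<in> elems X"
  shows "nrm X (\<lambda>x. f x - h x) \<le> nrm X (\<lambda>x. f x - g x) + nrm X (\<lambda>x. g x - h x)"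
  using hilbert_nrm_triangle[OF hilbert_diff[OF assms(1,2)] hilbert_diff[OF assms(2,3)]] by simp

lemma hilbert_nrm_le_diff:
  assumes "f \<in> elems X" "g \<in> elems X"
  shows "nrm X f \<le> nrm X (\<lambda>x. f x - g x) + nrm X g"
  using hilbert_nrm_triangle[OF hilbert_diff[OF assms] assms(2)] by simp

text \<open>The axioms say nothing about \<open>ip\<close> on functions that agree almost
  everywhere. Definiteness applied to the difference gives norm zero, and the triangle inequality
  transfers this to the two norms.\<close>

lemma hilbert_nrm_AE:
  assumes f: "f \<in> elems X" and g: "g \<in> elems X" and eq: "AE x in base X. f x = g x"
  shows "nrm X f = nrm X g"
proof -
  have "nrm X (\<lambda>x. f x - g x) = 0"
    using eq hilbert_nrm_eq_0_iff[OF hilbert_diff[OF f g]] by simp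
  then show ?thesis
    using hilbert_nrm_le_diff[OF f g] hilbert_nrm_le_diff[OF g f] hilbert_nrm_minus_commute[OF f g]
    by simp
qed

lemma hilbert_nrm_tendsto:
  assumes "\<And>n. F n \<in> elems X" "f \<in> elems X" "(\<lambda>n. nrm X (\<lambda>x. f x - F n x)) \<longlonglongrightarrow> 0"
  shows "(\<lambda>n. nrm X (F n)) \<longlonglongrightarrow> nrm X f"
proof -
  have "\<bar>nrm X (F n) - nrm X f\<bar> \<le> nrm X (\<lambda>x. f x - F n x)" for n
    using hilbert_nrm_le_diff[OF assms(1)[of n] assms(2)] hilbert_nrm_le_diff[OF assms(2) assms(1)[of n]]
      hilbert_nrm_minus_commute[OF assms(1)[of n] assms(2)] by linarith
  then have "(\<lambda>n. nrm X (F n) - nrm X f) \<longlonglongrightarrow> 0"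
    by (intro Lim_null_comparison[OF always_eventually assms(3)]) simp
  then show ?thesis by (simp add: LIM_zero_iff)
qed

end

section \<open>Bounded operators and their extension by density\<close>

lemma bounded_op_elems: "bounded_op X Y T \<Longrightarrow> f \<in> elems X \<Longrightarrow> T f \<in> elems Y"
  by (simp add: bounded_op_def)

lemma bounded_op_lincomb:
  "bounded_op X Y T \<Longrightarrow> f \<in> elems X \<Longrightarrow> g \<in> elems X \<Longrightarrow>
    AE y in base Y. T (\<lambda>x. c * f x + g x) y = c * T f y + T g y"
  by (simp add: bounded_op_def)

text \<open>The constant in \<open>bounded_op\<close> carries no sign; passing to its absolute value
  requires a nonnegative norm. That is a separate assumption, rather than
  \<open>hilbert_space X\<close>, so that the rule also applies to the Bochner space.\<close>

lemma bounded_opE: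
  assumes "bounded_op X Y T" "\<And>f. f \<in> elems X \<Longrightarrow> 0 \<le> nrm X f"
  obtains C where "0 \<le> C" "\<And>f. f \<in> elems X \<Longrightarrow> nrm Y (T f) \<le> C * nrm X f"
proof -
  obtain C where C: "\<And>f. f \<in> elems X \<Longrightarrow> nrm Y (T f) \<le> C * nrm X f"
    using assms(1) unfolding bounded_op_def by blast
  have "nrm Y (T f) \<le> \<bar>C\<bar> * nrm X f" if "f \<in> elems X" for f
    using C[OF that] assms(2)[OF that] mult_right_mono[of C "\<bar>C\<bar>" "nrm X f"] by linarith
  then show thesis using that[of "\<bar>C\<bar>"] by simp
qed

lemma bounded_op_sum:
  assumes X: "hilbert_space X" and T: "bounded_op X Y T"
    and "finite F" "\<And>i. i \<in> F \<Longrightarrow> f i \<in> elems X"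
  shows "AE y in base Y. T (\<lambda>x. \<Sum>i\<in>F. c i * f i x) y = (\<Sum>i\<in>F. c i * T (f i) y)"
  using assms(3,4)
proof (induction rule: finite_induct)
  case empty
  \<comment> \<open>Linearity at 0 = 1 * 0 + 0 gives T 0 = T 0 + T 0 almost everywhere.\<close>
  show ?case
    using bounded_op_lincomb[OF T hilbert_zero[OF X] hilbert_zero[OF X], of 1] by simp
next
  case (insert i F)
  have "AE y in base Y. T (\<lambda>x. \<Sum>i\<in>F. c i * f i x) y = (\<Sum>i\<in>F. c i * T (f i) y)"
    using insert by simp
  moreover have "AE y in base Y. T (\<lambda>x. c i * f i x + (\<Sum>i\<in>F. c i * f i x)) y
      = c i * T (f i) y + T (\<lambda>x. \<Sum>i\<in>F. c i * f i x) y"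
    using insert by (intro bounded_op_lincomb[OF T] hilbert_sum[OF X]) auto
  ultimately have "AE y in base Y. T (\<lambda>x. c i * f i x + (\<Sum>i\<in>F. c i * f i x)) y
      = c i * T (f i) y + (\<Sum>i\<in>F. c i * T (f i) y)"
    by eventually_elim simp
  then show ?case using insert by simp
qed

lemma bounded_op_add:
  assumes Y: "hilbert_space Y" and S: "bounded_op X Y S" and T: "bounded_op X Y T"
  shows "bounded_op X Y (\<lambda>f y. S f y + T f y)"
proof -
  obtain B C where B: "\<And>f. f \<in> elems X \<Longrightarrow> nrm Y (S f) \<le> B * nrm X f"
    and C: "\<And>f. f \<in> elems X \<Longrightarrow> nrm Y (T f) \<le> C * nrm X f"
    using S T unfolding bounded_op_def by blast
  have "nrm Y (\<lambda>y. S f y + T f y) \<le> (B + C) * nrm X f" if "f \<in> elems X" for f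
    using B[OF that] C[OF that]
      hilbert_nrm_triangle[OF Y bounded_op_elems[OF S that] bounded_op_elems[OF T that]]
    by (simp add: algebra_simps)
  moreover have "AE y in base Y. S (\<lambda>x. c * f x + g x) y + T (\<lambda>x. c * f x + g x) y
      = c * (S f y + T f y) + (S g y + T g y)" if "f \<in> elems X" "g \<in> elems X" for c f g
    using bounded_op_lincomb[OF S that, of c] bounded_op_lincomb[OF T that, of c]
    by eventually_elim (simp add: algebra_simps)
  ultimately show ?thesis
    using bounded_op_elems[OF S] bounded_op_elems[OF T] hilbert_add[OF Y]
    unfolding bounded_op_def by blast
qed

lemma bounded_op_zero:
  assumes "hilbert_space Y"
  shows "bounded_op X Y (\<lambda>f y. 0)"
proof -
  have "nrm Y (\<lambda>y. 0) = 0"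
    using hilbert_nrm_eq_0_iff[OF assms hilbert_zero[OF assms]] by simp
  then show ?thesis
    unfolding bounded_op_def using hilbert_zero[OF assms] by (auto intro!: exI[of _ 0])
qed

lemma bounded_op_sum_ops:
  assumes Y: "hilbert_space Y" and "finite F" "\<And>i. i \<in> F \<Longrightarrow> bounded_op X Y (T i)"
  shows "bounded_op X Y (\<lambda>f y. \<Sum>i\<in>F. T i f y)"
  using assms(2,3)
  by (induction rule: finite_induct) (auto intro: bounded_op_zero bounded_op_add Y)

lemma bounded_op_eq_dense:
  assumes X: "hilbert_space X" and Y: "hilbert_space Y"
    and S: "bounded_op X Y S" and T: "bounded_op X Y T"
    and D: "D \<subseteq> elems X" "\<And>f. f \<in> D \<Longrightarrow> AE y in base Y. S f y = T f y"
    and dense: "\<And>e. 0 < e \<Longrightarrow> \<exists>g\<in>D. nrm X (\<lambda>x. f x - g x) < e"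
    and f: "f \<in> elems X"
  shows "AE y in base Y. S f y = T f y"
proof -
  obtain B where B0: "0 \<le> B" and B: "\<And>f. f \<in> elems X \<Longrightarrow> nrm Y (S f) \<le> B * nrm X f"
    using bounded_opE[OF S] hilbert_nrm_nonneg[OF X] by blast
  obtain C where C0: "0 \<le> C" and C: "\<And>f. f \<in> elems X \<Longrightarrow> nrm Y (T f) \<le> C * nrm X f"
    using bounded_opE[OF T] hilbert_nrm_nonneg[OF X] by blast
  note SY = bounded_op_elems[OF S] and TY = bounded_op_elems[OF T]
  have bound: "nrm Y (\<lambda>y. S f y - T f y) \<le> (B + C) * e" if e: "0 < e" for e
  proof -
    obtain g where g: "g \<in> D" and ge: "nrm X (\<lambda>x. f x - g x) < e" using dense[OF e] by blast
    then have gX: "g \<in> elems X" using D by blast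
    let ?h = "\<lambda>x. f x - g x"
    have h: "?h \<in> elems X" by (rule hilbert_diff[OF X f gX])
    have "AE y in base Y. S ?h y = S f y - S g y" "AE y in base Y. T ?h y = T f y - T g y"
      using bounded_op_lincomb[OF S gX f, of "-1"] bounded_op_lincomb[OF T gX f, of "-1"] by simp_all
    with D(2)[OF g] have "AE y in base Y. S f y - T f y = S ?h y - T ?h y"
      by eventually_elim simp
    then have "nrm Y (\<lambda>y. S f y - T f y) = nrm Y (\<lambda>y. S ?h y - T ?h y)"
      by (intro hilbert_nrm_AE[OF Y] hilbert_diff[OF Y] SY TY h f)
    also have "\<dots> \<le> nrm Y (S ?h) + nrm Y (T ?h)"
      using hilbert_nrm_lincomb[OF Y TY[OF h] SY[OF h], of "-1"] by simp
    also have "\<dots> \<le> (B + C) * nrm X ?h"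
      using B[OF h] C[OF h] by (simp add: algebra_simps)
    also have "\<dots> \<le> (B + C) * e"
      using ge B0 C0 by (intro mult_left_mono) auto
    finally show ?thesis .
  qed
  have "nrm Y (\<lambda>y. S f y - T f y) \<le> 0 + e" if "0 < e" for e
  proof -
    \<comment> \<open>The added 1 avoids a zero denominator when both operators have bound
      0.\<close>
    have "(B + C) * (e / (B + C + 1)) \<le> e"
      using that B0 C0 by (simp add: field_simps)
    then show ?thesis using bound[of "e / (B + C + 1)"] that B0 C0 by simp
  qed
  then have "nrm Y (\<lambda>y. S f y - T f y) \<le> 0" by (rule field_le_epsilon)
  then have "nrm Y (\<lambda>y. S f y - T f y) = 0"
    using hilbert_nrm_nonneg[OF Y hilbert_diff[OF Y SY[OF f] TY[OF f]]] by simp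
  then show ?thesis
    using hilbert_nrm_eq_0_iff[OF Y hilbert_diff[OF Y SY[OF f] TY[OF f]]] by simp
qed

text \<open>The densely defined operator is given by its graph \<open>G\<close>, a relation that may
  assign several \<open>g\<close> to one \<open>f\<close>. Linearity of the graph together with the
  bound makes it single-valued up to null sets, so no choice of representation has to be made in
  advance.\<close>

lemma bounded_op_extension:
  assumes X: "hilbert_space X" and Y: "hilbert_space Y"
    and G: "\<And>f g. G f g \<Longrightarrow> f \<in> elems X" "\<And>f g. G f g \<Longrightarrow> g \<in> elems Y"
    and lin: "\<And>f g f' g' c. G f g \<Longrightarrow> G f' g' \<Longrightarrow> G (\<lambda>x. c * f x + f' x) (\<lambda>y. c * g y + g' y)"
    and bound: "\<And>f g. G f g \<Longrightarrow> nrm Y g \<le> C * nrm X f" and C0: "0 \<le> C"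
    and dense: "\<And>f e. f \<in> elems X \<Longrightarrow> 0 < e \<Longrightarrow> \<exists>h g. G h g \<and> nrm X (\<lambda>x. f x - h x) < e"
  shows "\<exists>T. bounded_op X Y T \<and> (\<forall>f g. G f g \<longrightarrow> (AE y in base Y. T f y = g y))"
proof -
  \<comment> \<open>The closure of the graph \<open>G\<close> in the product of the two spaces. The
    operator will be a selection from it.\<close>
  define P where "P f g \<longleftrightarrow> f \<in> elems X \<and> g \<in> elems Y \<and>
    (\<exists>h k. (\<forall>n::nat. G (h n) (k n)) \<and> (\<lambda>n. nrm X (\<lambda>x. f x - h n x)) \<longlonglongrightarrow> 0 \<and>
       (\<lambda>n. nrm Y (\<lambda>y. g y - k n y)) \<longlonglongrightarrow> 0)" for f g
  have ex: "\<exists>g. P f g" if f: "f \<in> elems X" for f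
  proof -
    have "\<forall>n. \<exists>p. G (fst p) (snd p) \<and> nrm X (\<lambda>x. f x - fst p x) < inverse (real (Suc n))"
      using dense[OF f] by simp
    from choice[OF this] obtain p where p: "\<And>n. G (fst (p n)) (snd (p n))"
      "\<And>n. nrm X (\<lambda>x. f x - fst (p n) x) < inverse (real (Suc n))" by blast
    define h k where "h n = fst (p n)" and "k n = snd (p n)" for n
    have hk: "\<And>n. G (h n) (k n)" and hn: "\<And>n. nrm X (\<lambda>x. f x - h n x) < inverse (real (Suc n))"
      using p by (auto simp: h_def k_def)
    note h = G(1)[OF hk] and k = G(2)[OF hk]
    have diff: "nrm Y (\<lambda>y. k m y - k n y) \<le> C * (inverse (real (Suc m)) + inverse (real (Suc n)))" for m n
    proof -
      have "G (\<lambda>x. h m x - h n x) (\<lambda>y. k m y - k n y)"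
        using lin[OF hk hk, of "-1" n m] by simp
      then have "nrm Y (\<lambda>y. k m y - k n y) \<le> C * nrm X (\<lambda>x. h m x - h n x)" by (rule bound)
      also have "nrm X (\<lambda>x. h m x - h n x) \<le> inverse (real (Suc m)) + inverse (real (Suc n))"
        using hilbert_nrm_triangle_diff[OF X h[of m] f h[of n]] hn[of m] hn[of n]
          hilbert_nrm_minus_commute[OF X h[of m] f] by linarith
      finally show ?thesis using C0 by (simp add: mult_left_mono)
    qed
    have cauchy: "\<exists>N. \<forall>m\<ge>N. \<forall>n\<ge>N. nrm Y (\<lambda>y. k m y - k n y) < e" if e: "0 < e" for e
    proof -
      \<comment> \<open>Chosen so that e exceeds C * (e' + e') by 2 * e': this leaves a strict
        inequality even for C = 0.\<close>
      define e' where "e' = e / (2 * (C + 1))"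
      have e'0: "0 < e'" and "e' * (2 * (C + 1)) = e"
        using e C0 by (auto simp: e'_def)
      then have e': "0 < e'" "e = C * (e' + e') + 2 * e'"
        by (auto simp: algebra_simps)
      obtain N where N: "inverse (real (Suc N)) < e'"
        using reals_Archimedean[OF e'(1)] by auto
      have "nrm Y (\<lambda>y. k m y - k n y) < e" if "m \<ge> N" "n \<ge> N" for m n
      proof -
        have "inverse (real (Suc m)) \<le> inverse (real (Suc N))" "inverse (real (Suc n)) \<le> inverse (real (Suc N))"
          using that by (auto intro!: le_imp_inverse_le)
        then have "C * (inverse (real (Suc m)) + inverse (real (Suc n))) \<le> C * (e' + e')"
          using N C0 by (intro mult_left_mono add_mono) linarith+
        then show ?thesis using diff[of m n] e' by linarith
      qed
      then show ?thesis by blast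
    qed
    obtain g where g: "g \<in> elems Y" and lim: "(\<lambda>n. nrm Y (\<lambda>y. k n y - g y)) \<longlonglongrightarrow> 0"
      using hilbert_complete[OF Y, of k] k cauchy by blast
    have "(\<lambda>n. nrm X (\<lambda>x. f x - h n x)) \<longlonglongrightarrow> 0"
      using hn hilbert_nrm_nonneg[OF X hilbert_diff[OF X f h]]
      by (intro Lim_null_comparison[OF always_eventually LIMSEQ_inverse_real_of_nat])
        (auto simp: less_imp_le)
    moreover have "(\<lambda>n. nrm Y (\<lambda>y. g y - k n y)) \<longlonglongrightarrow> 0"
      using lim hilbert_nrm_minus_commute[OF Y g k] by simp
    ultimately show ?thesis unfolding P_def using f g hk by blast
  qed
  have Pb: "nrm Y g \<le> C * nrm X f" if Pfg: "P f g" for f g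
  proof -
    obtain h k where *: "f \<in> elems X" "g \<in> elems Y" "\<And>n::nat. G (h n) (k n)"
      "(\<lambda>n. nrm X (\<lambda>x. f x - h n x)) \<longlonglongrightarrow> 0" "(\<lambda>n. nrm Y (\<lambda>y. g y - k n y)) \<longlonglongrightarrow> 0"
      using Pfg unfolding P_def by blast
    have "(\<lambda>n. nrm X (h n)) \<longlonglongrightarrow> nrm X f" "(\<lambda>n. nrm Y (k n)) \<longlonglongrightarrow> nrm Y g"
      by (auto intro!: hilbert_nrm_tendsto[OF X] hilbert_nrm_tendsto[OF Y] * G(1)[OF *(3)] G(2)[OF *(3)])
    then show ?thesis
      using bound[OF *(3)] by (intro LIMSEQ_le[OF _ tendsto_mult_left[of _ _ _ C]]) auto
  qed
  have Pl: "P (\<lambda>x. c * f x + f' x) (\<lambda>y. c * g y + g' y)" if Pfg: "P f g" "P f' g'" for c f f' g g'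
  proof -
    obtain h k where *: "f \<in> elems X" "g \<in> elems Y" "\<And>n::nat. G (h n) (k n)"
      "(\<lambda>n. nrm X (\<lambda>x. f x - h n x)) \<longlonglongrightarrow> 0" "(\<lambda>n. nrm Y (\<lambda>y. g y - k n y)) \<longlonglongrightarrow> 0"
      using Pfg(1) unfolding P_def by blast
    obtain h' k' where **: "f' \<in> elems X" "g' \<in> elems Y" "\<And>n::nat. G (h' n) (k' n)"
      "(\<lambda>n. nrm X (\<lambda>x. f' x - h' n x)) \<longlonglongrightarrow> 0" "(\<lambda>n. nrm Y (\<lambda>y. g' y - k' n y)) \<longlonglongrightarrow> 0"
      using Pfg(2) unfolding P_def by blast
    have lim: "(\<lambda>n. nrm Z (\<lambda>x. c * u x + u' x - (c * v n x + v' n x))) \<longlonglongrightarrow> 0"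
      if Z: "hilbert_space Z" and u: "u \<in> elems Z" "u' \<in> elems Z" and v: "\<And>n. v n \<in> elems Z" "\<And>n. v' n \<in> elems Z"
        and l: "(\<lambda>n. nrm Z (\<lambda>x. u x - v n x)) \<longlonglongrightarrow> 0" "(\<lambda>n. nrm Z (\<lambda>x. u' x - v' n x)) \<longlonglongrightarrow> 0"
      for Z :: "'z fspace" and u u' v v'
    proof (rule Lim_null_comparison)
      show "(\<lambda>n. \<bar>c\<bar> * nrm Z (\<lambda>x. u x - v n x) + nrm Z (\<lambda>x. u' x - v' n x)) \<longlonglongrightarrow> 0"
        using l by (auto intro!: tendsto_eq_intros)
      have "nrm Z (\<lambda>x. c * u x + u' x - (c * v n x + v' n x))
          \<le> \<bar>c\<bar> * nrm Z (\<lambda>x. u x - v n x) + nrm Z (\<lambda>x. u' x - v' n x)" for n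
        using hilbert_nrm_lincomb[OF Z hilbert_diff[OF Z u(1) v(1)] hilbert_diff[OF Z u(2) v(2)], of c n n]
        by (simp add: algebra_simps)
      moreover have "0 \<le> nrm Z (\<lambda>x. c * u x + u' x - (c * v n x + v' n x))" for n
        by (intro hilbert_nrm_nonneg[OF Z] hilbert_diff[OF Z] hilbert_lincomb[OF Z] u v)
      ultimately show "\<forall>\<^sub>F n in sequentially. norm (nrm Z (\<lambda>x. c * u x + u' x - (c * v n x + v' n x)))
          \<le> \<bar>c\<bar> * nrm Z (\<lambda>x. u x - v n x) + nrm Z (\<lambda>x. u' x - v' n x)"
        by simp
    qed
    show ?thesis unfolding P_def
    proof (intro conjI exI allI)
      show "G (\<lambda>x. c * h n x + h' n x) (\<lambda>y. c * k n y + k' n y)" for n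
        by (intro lin * **)
      show "(\<lambda>n. nrm X (\<lambda>x. c * f x + f' x - (c * h n x + h' n x))) \<longlonglongrightarrow> 0"
        by (intro lim[OF X] * ** G(1)[OF *(3)] G(1)[OF **(3)])
      show "(\<lambda>n. nrm Y (\<lambda>x. c * g x + g' x - (c * k n x + k' n x))) \<longlonglongrightarrow> 0"
        by (intro lim[OF Y] * ** G(2)[OF *(3)] G(2)[OF **(3)])
    qed (auto intro: hilbert_lincomb X Y * **)
  qed
  have PG: "P f g" if "G f g" for f g
    unfolding P_def
  proof (intro conjI exI allI)
    show "G f g" by fact
    have "nrm X (\<lambda>x. 0) = 0" "nrm Y (\<lambda>x. 0) = 0"
      using hilbert_nrm_eq_0_iff[OF X hilbert_zero[OF X]] hilbert_nrm_eq_0_iff[OF Y hilbert_zero[OF Y]] by auto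
    then show "(\<lambda>n. nrm X (\<lambda>x. f x - f x)) \<longlonglongrightarrow> 0" "(\<lambda>n. nrm Y (\<lambda>x. g x - g x)) \<longlonglongrightarrow> 0" by simp_all
  qed (use G that in auto)
  have uniq: "AE y in base Y. g y = g' y" if "P f g" "P f g'" for f g g'
  proof -
    \<comment> \<open>Two values at the same \<open>f\<close> differ by a value at 0, which the
      bound forces to have norm 0.\<close>
    have d: "P (\<lambda>x. 0) (\<lambda>y. g y - g' y)" using Pl[OF that(2,1), of "-1"] by simp
    have "nrm X (\<lambda>x. 0) = 0" using hilbert_nrm_eq_0_iff[OF X hilbert_zero[OF X]] by auto
    then have "nrm Y (\<lambda>y. g y - g' y) \<le> 0" using Pb[OF d] by simp
    moreover have "(\<lambda>y. g y - g' y) \<in> elems Y" using d by (simp add: P_def)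
    ultimately show ?thesis
      using hilbert_nrm_nonneg[OF Y] hilbert_nrm_eq_0_iff[OF Y] by fastforce
  qed
  define T where "T f = (SOME g. P f g)" for f
  have T: "P f (T f)" if "f \<in> elems X" for f
    unfolding T_def using ex[OF that] by (rule someI_ex)
  have "bounded_op X Y T"
    unfolding bounded_op_def
  proof (intro conjI ballI allI exI)
    show "T f \<in> elems Y" if "f \<in> elems X" for f using T[OF that] by (simp add: P_def)
    show "nrm Y (T f) \<le> C * nrm X f" if "f \<in> elems X" for f by (rule Pb[OF T[OF that]])
    show "AE y in base Y. T (\<lambda>x. c * f x + g x) y = c * T f y + T g y"
      if "f \<in> elems X" "g \<in> elems X" for f g c
      using that by (intro uniq[OF T Pl] hilbert_lincomb[OF X] T)
  qed
  then show ?thesis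
    using uniq[OF T PG] G by blast
qed

section \<open>Completeness of the space of square integrable functions\<close>

lemma base_L2 [simp]: "base (L2 M) = M"
  by (simp add: L2_def)

lemma ip_L2: "ip (L2 M) f g = (\<integral>x. f x * g x \<partial>M)"
  by (simp add: L2_def)

lemma elems_L2: "f \<in> elems (L2 M) \<longleftrightarrow> f \<in> borel_measurable M \<and> integrable M (\<lambda>x. (f x)\<^sup>2)"
  by (simp add: L2_def)

lemma integrable_mult_L2:
  assumes "f \<in> elems (L2 M)" "g \<in> elems (L2 M)"
  shows "integrable M (\<lambda>x. f x * g x)"
proof (rule Bochner_Integration.integrable_bound)
  show "integrable M (\<lambda>x. (f x)\<^sup>2 + (g x)\<^sup>2)" using assms by (simp add: elems_L2)
  show "(\<lambda>x. f x * g x) \<in> borel_measurable M" using assms by (auto simp: elems_L2)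
  have "\<bar>a * b\<bar> \<le> a\<^sup>2 + b\<^sup>2" for a b :: real
    using sum_squares_bound[of "\<bar>a\<bar>" "\<bar>b\<bar>"] abs_ge_zero[of "a * b"]
    unfolding abs_mult power2_abs by linarith
  then show "AE x in M. norm (f x * g x) \<le> norm ((f x)\<^sup>2 + (g x)\<^sup>2)"
    by simp
qed

lemma L2_lincomb:
  assumes "f \<in> elems (L2 M)" "g \<in> elems (L2 M)"
  shows "(\<lambda>x. c * f x + g x) \<in> elems (L2 M)"
proof -
  have "integrable M (\<lambda>x. c\<^sup>2 * (f x)\<^sup>2 + 2 * c * (f x * g x) + (g x)\<^sup>2)"
    using assms integrable_mult_L2[OF assms] by (simp add: elems_L2)
  moreover have "(\<lambda>x. c\<^sup>2 * (f x)\<^sup>2 + 2 * c * (f x * g x) + (g x)\<^sup>2) = (\<lambda>x. (c * f x + g x)\<^sup>2)"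
    by (simp add: fun_eq_iff power2_eq_square algebra_simps)
  ultimately show ?thesis using assms by (auto simp: elems_L2)
qed

lemma (in finite_measure) L2_imp_integrable: "f \<in> elems (L2 M) \<Longrightarrow> integrable M f"
  by (simp add: elems_L2 square_integrable_imp_integrable)

text \<open>Riesz--Fischer: a subsequence with summable increments converges almost everywhere,
  and Fatou's lemma identifies the limit as the $L^2$ limit of the whole sequence.\<close>

lemma (in finite_measure) L2_complete:
  assumes F: "\<And>n::nat. F n \<in> elems (L2 M)"
    and cauchy: "\<And>e. 0 < e \<Longrightarrow> \<exists>N. \<forall>m\<ge>N. \<forall>n\<ge>N. nrm (L2 M) (\<lambda>x. F m x - F n x) < e"
  shows "\<exists>f\<in>elems (L2 M). (\<lambda>n. nrm (L2 M) (\<lambda>x. F n x - f x)) \<longlonglongrightarrow> 0"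
proof -
  have [measurable]: "F n \<in> borel_measurable M" for n using F[of n] by (simp add: elems_L2)
  have Fd: "(\<lambda>x. F m x - F n x) \<in> elems (L2 M)" for m n
    using L2_lincomb[OF F F, of "-1" n m] by simp
  have nn: "(\<integral>\<^sup>+x. ennreal ((F m x - F n x)\<^sup>2) \<partial>M) = ennreal ((nrm (L2 M) (\<lambda>x. F m x - F n x))\<^sup>2)" for m n
  proof -
    have "(\<integral>\<^sup>+x. ennreal ((F m x - F n x)\<^sup>2) \<partial>M) = ennreal (\<integral>x. (F m x - F n x)\<^sup>2 \<partial>M)"
      using Fd[of m n] by (intro nn_integral_eq_integral) (auto simp: elems_L2)
    then show ?thesis by (simp add: nrm_def ip_L2 power2_eq_square)
  qed
  have "\<forall>k. \<exists>N. \<forall>m\<ge>N. \<forall>n\<ge>N. nrm (L2 M) (\<lambda>x. F m x - F n x) < (1/2)^k"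
    using cauchy by simp
  then obtain N where N: "\<And>k m n. N k \<le> m \<Longrightarrow> N k \<le> n \<Longrightarrow> nrm (L2 M) (\<lambda>x. F m x - F n x) < (1/2)^k"
    by metis
  \<comment> \<open>The thresholds \<open>N k\<close> come from choice and need not be monotone.
    Their partial sums are, and adding \<open>k\<close> makes the subsequence tend to
    infinity.\<close>
  define r where "r k = (\<Sum>i\<le>k. N i) + k" for k
  have rN: "N k \<le> r k" and rS: "r k \<le> r (Suc k)" and rk: "k \<le> r k" for k
    by (auto simp: r_def intro: trans_le_add1 member_le_sum)
  let ?D = "\<lambda>k x. F (r (Suc k)) x - F (r k) x"
  have "(\<integral>\<^sup>+x. ennreal \<bar>?D k x\<bar> \<partial>M) \<le> ennreal ((1 + measure M (space M)) * (1/2)^k)" for k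
  proof -
    have "nrm (L2 M) (?D k) \<le> (1/2)^k"
      using N[of k "r (Suc k)" "r k"] rN[of k] rS[of k] by simp
    then have le: "(\<integral>x. (?D k x)\<^sup>2 \<partial>M) \<le> ((1/2)^k)\<^sup>2"
      by (simp add: nrm_def ip_L2 power2_eq_square[symmetric] real_sqrt_le_iff' sqrt_le_D)
    have i: "integrable M (?D k)" "integrable M (\<lambda>x. (?D k x)\<^sup>2)"
      using L2_imp_integrable[OF Fd] Fd by (auto simp: elems_L2)
    have "(\<integral>\<^sup>+x. ennreal \<bar>?D k x\<bar> \<partial>M) = ennreal (\<integral>x. \<bar>?D k x\<bar> \<partial>M)"
      using i by (intro nn_integral_eq_integral) auto
    \<comment> \<open>Passage from L2 to L1 on a finite measure space: t \<le> s t^2 + 1/s with s =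
      2^k. The squared norm is at most 4^(-k), so both terms are of order 2^(-k).\<close>
    also have "(\<integral>x. \<bar>?D k x\<bar> \<partial>M) \<le> (\<integral>x. 2^k * (?D k x)\<^sup>2 + (1/2)^k \<partial>M)"
    proof (intro integral_mono)
      have *: "t \<le> s * t\<^sup>2 + 1 / s" if "s > 0" for s t :: real
      proof -
        have "s * t \<le> (s*t)\<^sup>2 + 1" using sum_squares_bound[of "s*t" 1] zero_le_power2[of "s*t"] zero_le_power2[of "s*t-1"]
          by (auto simp: power2_eq_square algebra_simps)
        then show ?thesis using that by (simp add: field_simps power2_eq_square)
      qed
      show "\<bar>?D k x\<bar> \<le> 2^k * (?D k x)\<^sup>2 + (1/2)^k" for x
        using *[of "2^k" "\<bar>?D k x\<bar>"] by (simp add: power_one_over)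
    qed (use i in auto)
    also have "\<dots> = 2^k * (\<integral>x. (?D k x)\<^sup>2 \<partial>M) + (1/2)^k * measure M (space M)"
      using i by simp
    also have "\<dots> \<le> 2^k * ((1/2)^k)\<^sup>2 + (1/2)^k * measure M (space M)"
      using le by (intro add_right_mono mult_left_mono) auto
    also have "\<dots> = (1 + measure M (space M)) * (1/2)^k"
      by (simp add: power2_eq_square power_one_over field_simps)
    finally show ?thesis by (simp add: ennreal_leI)
  qed
  then have "(\<Sum>k. \<integral>\<^sup>+x. ennreal \<bar>?D k x\<bar> \<partial>M) \<le> (\<Sum>k. ennreal ((1 + measure M (space M)) * (1/2)^k))"
    by (intro suminf_le) auto
  also have "\<dots> < \<infinity>"
    by (subst suminf_ennreal2) (auto intro!: summable_mult)
  finally have "(\<integral>\<^sup>+x. (\<Sum>k. ennreal \<bar>?D k x\<bar>) \<partial>M) < \<infinity>"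
    by (subst nn_integral_suminf) auto
  then have "AE x in M. (\<Sum>k. ennreal \<bar>?D k x\<bar>) \<noteq> \<infinity>"
    by (intro nn_integral_PInf_AE) auto
  then have lim: "AE x in M. (\<lambda>k. F (r k) x) \<longlonglongrightarrow> lim (\<lambda>k. F (r k) x)"
  proof eventually_elim
    case (elim x)
    then have "summable (\<lambda>k. \<bar>?D k x\<bar>)" by (intro summable_suminf_not_top) auto
    then have "summable (\<lambda>k. ?D k x)" by (rule summable_rabs_cancel)
    then have "(\<lambda>n. \<Sum>k<n. ?D k x) \<longlonglongrightarrow> (\<Sum>k. ?D k x)" by (rule summable_LIMSEQ)
    then have "(\<lambda>n. F (r n) x - F (r 0) x) \<longlonglongrightarrow> (\<Sum>k. ?D k x)"
      by (simp add: sum_lessThan_telescope[of "\<lambda>k. F (r k) x"])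
    then have "(\<lambda>n. F (r n) x - F (r 0) x + F (r 0) x) \<longlonglongrightarrow> (\<Sum>k. ?D k x) + F (r 0) x"
      by (intro tendsto_add tendsto_const)
    then show ?case by (auto simp: convergent_LIMSEQ_iff[symmetric] convergent_def)
  qed
  define f where "f x = lim (\<lambda>k. F (r k) x)" for x
  have f[measurable]: "f \<in> borel_measurable M" unfolding f_def by measurable
  have fatou: "(\<integral>\<^sup>+x. ennreal ((F m x - f x)\<^sup>2) \<partial>M) \<le> ennreal (((1/2)^k)\<^sup>2)" if m: "m \<ge> N k" for m k
  proof -
    have "(\<integral>\<^sup>+x. ennreal ((F m x - f x)\<^sup>2) \<partial>M) = (\<integral>\<^sup>+x. liminf (\<lambda>n. ennreal ((F m x - F (r n) x)\<^sup>2)) \<partial>M)"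
    proof (intro nn_integral_cong_AE)
      show "AE x in M. ennreal ((F m x - f x)\<^sup>2) = liminf (\<lambda>n. ennreal ((F m x - F (r n) x)\<^sup>2))"
        using lim
      proof eventually_elim
        case (elim x)
        then have "(\<lambda>n. ennreal ((F m x - F (r n) x)\<^sup>2)) \<longlonglongrightarrow> ennreal ((F m x - f x)\<^sup>2)"
          unfolding f_def by (intro tendsto_intros)
        then show ?case by (metis lim_imp_Liminf trivial_limit_sequentially)
      qed
    qed
    also have "\<dots> \<le> liminf (\<lambda>n. \<integral>\<^sup>+x. ennreal ((F m x - F (r n) x)\<^sup>2) \<partial>M)"
      by (intro nn_integral_liminf) auto
    also have "\<dots> \<le> liminf (\<lambda>n. ennreal (((1/2)^k)\<^sup>2))"
    proof (rule Liminf_mono)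
      show "\<forall>\<^sub>F n in sequentially. (\<integral>\<^sup>+x. ennreal ((F m x - F (r n) x)\<^sup>2) \<partial>M) \<le> ennreal (((1/2)^k)\<^sup>2)"
        using eventually_ge_at_top[of "N k"]
      proof eventually_elim
        case (elim n)
        have "nrm (L2 M) (\<lambda>x. F m x - F (r n) x) \<le> (1/2)^k"
          using N[OF m, of "r n"] elim rk[of n] by simp
        moreover have "0 \<le> nrm (L2 M) (\<lambda>x. F m x - F (r n) x)"
          by (simp add: nrm_def ip_L2)
        ultimately show ?case unfolding nn by (intro ennreal_leI power_mono)
      qed
    qed
    also have "\<dots> = ennreal (((1/2)^k)\<^sup>2)" by (simp add: Liminf_const)
    finally show ?thesis .
  qed
  \<comment> \<open>Square integrability is first known for the difference; that of \<open>f\<close>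
    follows by subtracting it from \<open>F m\<close>.\<close>
  have d: "(\<lambda>x. F m x - f x) \<in> elems (L2 M)" if "m \<ge> N 0" for m
  proof -
    have "(\<integral>\<^sup>+x. ennreal ((F m x - f x)\<^sup>2) \<partial>M) < \<infinity>"
      using fatou[OF that] by (simp add: order_le_less_trans)
    then show ?thesis by (auto simp: elems_L2 intro!: integrableI_nonneg)
  qed
  have "f \<in> elems (L2 M)"
    using L2_lincomb[OF d[of "N 0"] F[of "N 0"], of "-1"] by simp
  moreover have "(\<lambda>n. nrm (L2 M) (\<lambda>x. F n x - f x)) \<longlonglongrightarrow> 0"
  proof (rule LIMSEQ_I)
    fix e :: real assume "0 < e"
    then obtain k where k: "(1/2)^k < e" using real_arch_pow_inv[of e "1/2"] by auto
    \<comment> \<open>\<open>N k\<close> gives the size of the norm, \<open>N 0\<close> the square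
      integrability of the difference needed to pass between the two integrals.\<close>
    have "norm (nrm (L2 M) (\<lambda>x. F n x - f x) - 0) < e" if "n \<ge> N k + N 0" for n
    proof -
      have "(\<integral>x. (F n x - f x)\<^sup>2 \<partial>M) \<le> ((1/2)^k)\<^sup>2"
      proof -
        have "ennreal (\<integral>x. (F n x - f x)\<^sup>2 \<partial>M) = (\<integral>\<^sup>+x. ennreal ((F n x - f x)\<^sup>2) \<partial>M)"
          using d[of n] that by (intro nn_integral_eq_integral[symmetric]) (auto simp: elems_L2)
        then have "ennreal (\<integral>x. (F n x - f x)\<^sup>2 \<partial>M) \<le> ennreal (((1/2)^k)\<^sup>2)"
          using fatou[of k n] that by simp
        then show ?thesis by (subst (asm) ennreal_le_iff) auto
      qed
      then have "sqrt (\<integral>x. (F n x - f x)\<^sup>2 \<partial>M) \<le> (1/2)^k"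
        by (intro real_le_lsqrt) auto
      then show ?thesis using k by (simp add: nrm_def ip_L2 power2_eq_square)
    qed
    then show "\<exists>no. \<forall>n\<ge>no. norm (nrm (L2 M) (\<lambda>x. F n x - f x) - 0) < e" by blast
  qed
  ultimately show ?thesis by blast
qed

lemma (in finite_measure) hilbert_space_L2: "hilbert_space (L2 M)"
  unfolding hilbert_space_def
proof (intro conjI ballI allI impI)
  show "elems (L2 M) \<subseteq> borel_measurable (base (L2 M))" by (auto simp: elems_L2)
  show "(\<lambda>x. 0) \<in> elems (L2 M)" by (auto simp: elems_L2)
next
  fix f g assume f: "f \<in> elems (L2 M)" and g: "g \<in> borel_measurable (base (L2 M))"
    and eq: "AE x in base (L2 M). g x = f x"
  have "integrable M (\<lambda>x. (g x)\<^sup>2) \<longleftrightarrow> integrable M (\<lambda>x. (f x)\<^sup>2)"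
    using f g eq[unfolded base_L2] by (intro integrable_cong_AE) (auto simp: elems_L2 elim: eventually_mono)
  then show "g \<in> elems (L2 M)" using f g by (simp add: elems_L2)
next
  fix f g h c assume "f \<in> elems (L2 M)" "g \<in> elems (L2 M)" "h \<in> elems (L2 M)"
  then show "ip (L2 M) (\<lambda>x. c * f x + g x) h = c * ip (L2 M) f h + ip (L2 M) g h"
    using integrable_mult_L2[of f M h] integrable_mult_L2[of g M h]
    by (simp add: ip_L2 distrib_right mult.assoc)
next
  fix f assume f: "f \<in> elems (L2 M)"
  show "(ip (L2 M) f f = 0) = (AE x in base (L2 M). f x = 0)"
    using f integral_nonneg_eq_0_iff_AE[of M "\<lambda>x. f x * f x"] unfolding base_L2
    by (simp add: ip_L2 integrable_mult_L2)
qed (use L2_complete L2_lincomb in \<open>auto simp: ip_L2 mult.commute\<close>)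

section \<open>The Schur product theorem\<close>

text \<open>Symmetry is required explicitly, because a nonnegative real quadratic form determines
  only the symmetric part of its matrix.\<close>

definition psd :: "'i set \<Rightarrow> ('i \<Rightarrow> 'i \<Rightarrow> real) \<Rightarrow> bool" where
  "psd F A \<longleftrightarrow> (\<forall>i\<in>F. \<forall>j\<in>F. A i j = A j i) \<and>
     (\<forall>c. 0 \<le> (\<Sum>i\<in>F. \<Sum>j\<in>F. c i * c j * A i j))"

lemma psd_sym: "psd F A \<Longrightarrow> i \<in> F \<Longrightarrow> j \<in> F \<Longrightarrow> A i j = A j i"
  unfolding psd_def by blast

lemma psd_nonneg: "psd F A \<Longrightarrow> 0 \<le> (\<Sum>i\<in>F. \<Sum>j\<in>F. c i * c j * A i j)"
  unfolding psd_def by blast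

lemma psd_subset:
  assumes "psd F A" "G \<subseteq> F" "finite F"
  shows "psd G A"
  unfolding psd_def
proof (intro conjI allI)
  show "\<forall>i\<in>G. \<forall>j\<in>G. A i j = A j i" using assms unfolding psd_def by blast
  fix c :: "'a \<Rightarrow> real"
  let ?c = "\<lambda>i. if i \<in> G then c i else 0"
  have "(\<Sum>i\<in>F. \<Sum>j\<in>F. ?c i * ?c j * A i j) = (\<Sum>i\<in>G. \<Sum>j\<in>F. ?c i * ?c j * A i j)"
    using assms by (intro sum.mono_neutral_right) auto
  also have "\<dots> = (\<Sum>i\<in>G. \<Sum>j\<in>G. c i * c j * A i j)"
    using assms by (intro sum.cong refl sum.mono_neutral_cong_right) auto
  finally show "0 \<le> (\<Sum>i\<in>G. \<Sum>j\<in>G. c i * c j * A i j)"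
    using psd_nonneg[OF assms(1), of ?c] by simp
qed

lemma psd_add: "psd F A \<Longrightarrow> psd F B \<Longrightarrow> psd F (\<lambda>i j. A i j + B i j)"
  unfolding psd_def by (simp add: distrib_left sum.distrib)

lemma psd_scale:
  assumes "psd F A" "0 \<le> a"
  shows "psd F (\<lambda>i j. a * A i j)"
proof -
  have "(\<Sum>i\<in>F. \<Sum>j\<in>F. c i * c j * (a * A i j)) = a * (\<Sum>i\<in>F. \<Sum>j\<in>F. c i * c j * A i j)" for c
    by (simp add: sum_distrib_left mult_ac)
  then show ?thesis using assms unfolding psd_def by simp
qed

lemma psd_one: "psd F (\<lambda>i j. 1)"
proof -
  have "(\<Sum>i\<in>F. \<Sum>j\<in>F. c i * c j * 1) = (\<Sum>i\<in>F. c i)\<^sup>2" for c :: "'a \<Rightarrow> real"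
    by (simp add: power2_eq_square sum_product)
  then show ?thesis unfolding psd_def by simp
qed

text \<open>The form is evaluated at c - s e_x, with e_x the unit vector at \<open>x\<close>. The
  free parameter \<open>s\<close> later completes the square in that coordinate, or drives the form
  negative when its diagonal entry vanishes.\<close>

lemma quadratic_form_shift:
  fixes B :: "'i \<Rightarrow> 'i \<Rightarrow> real"
  assumes "finite G" "x \<in> G"
  shows "(\<Sum>i\<in>G. \<Sum>j\<in>G. (c i - s * of_bool (i = x)) * (c j - s * of_bool (j = x)) * B i j) =
    (\<Sum>i\<in>G. \<Sum>j\<in>G. c i * c j * B i j) - s * (\<Sum>j\<in>G. c j * B x j) - s * (\<Sum>i\<in>G. c i * B i x) + s\<^sup>2 * B x x"
proof -
  have d: "(\<Sum>j\<in>G. (c j - s * of_bool (j = x)) * f j) = (\<Sum>j\<in>G. c j * f j) - s * f x" for f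
  proof -
    have "(\<Sum>j\<in>G. (c j - s * of_bool (j = x)) * f j)
        = (\<Sum>j\<in>G. c j * f j) - (\<Sum>j\<in>G. if j = x then s * f j else 0)"
      unfolding sum_subtractf[symmetric] by (intro sum.cong refl) (simp add: algebra_simps)
    then show ?thesis using assms by simp
  qed
  have "(\<Sum>i\<in>G. \<Sum>j\<in>G. (c i - s * of_bool (i = x)) * (c j - s * of_bool (j = x)) * B i j)
      = (\<Sum>i\<in>G. (c i - s * of_bool (i = x)) * ((\<Sum>j\<in>G. c j * B i j) - s * B i x))"
    by (simp add: mult.assoc sum_distrib_left[symmetric] d)
  also have "\<dots> = (\<Sum>i\<in>G. c i * ((\<Sum>j\<in>G. c j * B i j) - s * B i x)) - s * ((\<Sum>j\<in>G. c j * B x j) - s * B x x)"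
    by (rule d)
  also have "(\<Sum>i\<in>G. c i * ((\<Sum>j\<in>G. c j * B i j) - s * B i x))
      = (\<Sum>i\<in>G. \<Sum>j\<in>G. c i * c j * B i j) - s * (\<Sum>i\<in>G. c i * B i x)"
    by (simp add: right_diff_distrib sum_subtractf sum_distrib_left mult_ac)
  finally show ?thesis by (simp add: algebra_simps power2_eq_square)
qed

text \<open>Gaussian elimination of one index at a time: subtracting the rank-one matrix built from
  row \<open>x\<close> of \<open>B\<close> leaves a positive semidefinite matrix with vanishing row \<open>x\<close>. If
  \<open>B x x = 0\<close> that row is already zero and the division convention makes the correction vanish.\<close>

lemma Schur_trace_nonneg:
  assumes "finite F" "psd F P" "psd F B"
  shows "0 \<le> (\<Sum>i\<in>F. \<Sum>j\<in>F. P i j * B i j)"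
  using assms
proof (induction F arbitrary: B rule: finite_induct)
  case (insert x F)
  let ?G = "insert x F"
  note fin = insert.hyps(1) and P = insert.prems(1) and B = insert.prems(2)
  have fG: "finite ?G" using fin by simp
  have sym: "B i j = B j i" if "i \<in> ?G" "j \<in> ?G" for i j using psd_sym[OF B that] .
  have Q: "0 \<le> (\<Sum>i\<in>?G. \<Sum>j\<in>?G. c i * c j * B i j) - s * (\<Sum>j\<in>?G. c j * B x j) - s * (\<Sum>i\<in>?G. c i * B i x) + s\<^sup>2 * B x x" for c s
    using psd_nonneg[OF B] by (subst quadratic_form_shift[OF fG insertI1, symmetric])
  have Bxx: "0 \<le> B x x" using Q[of "\<lambda>_. 0" 1] by simp
  have zero: "B x y = 0" if "B x x = 0" "y \<in> F" for y
  proof (rule ccontr)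
    assume n: "B x y \<noteq> 0"
    \<comment> \<open>At e_y - s e_x the form is affine in \<open>s\<close>, as
      \<open>B x x = 0\<close>; a nonzero slope would make it negative somewhere.\<close>
    let ?c = "\<lambda>i. of_bool (i = y)::real"
    have s1: "(\<Sum>j\<in>?G. ?c j * f j) = f y" for f
    proof -
      have "(\<Sum>j\<in>?G. ?c j * f j) = (\<Sum>j\<in>?G. if j = y then f j else 0)" by (intro sum.cong) auto
      then show ?thesis using that fin by simp
    qed
    have "(\<Sum>i\<in>?G. \<Sum>j\<in>?G. ?c i * ?c j * B i j) = B y y"
      unfolding mult.assoc sum_distrib_left[symmetric] s1 ..
    then have "0 \<le> B y y - 2 * s * B x y" for s
      using Q[of ?c s] that sym[of y x] unfolding s1 by simp
    from this[of "(B y y + 1) / (2 * B x y)"] n show False by simp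
  qed
  define B' where "B' i j = B i j - B i x * B j x / B x x" for i j
  have B'x: "B' x j = 0" "B' j x = 0" if "j \<in> ?G" for j
    using zero that sym[of j x] by (cases "B x x = 0"; auto simp: B'_def)+
  have psdB': "psd ?G B'"
    unfolding psd_def
  proof (intro conjI allI)
    show "\<forall>i\<in>?G. \<forall>j\<in>?G. B' i j = B' j i" using sym by (auto simp: B'_def mult.commute)
    fix c :: "'a \<Rightarrow> real"
    let ?t = "\<Sum>i\<in>?G. c i * B i x"
    have t: "(\<Sum>j\<in>?G. c j * B x j) = ?t" using sym by (intro sum.cong refl) auto
    have "(\<Sum>i\<in>?G. \<Sum>j\<in>?G. c i * c j * B' i j) = (\<Sum>i\<in>?G. \<Sum>j\<in>?G. c i * c j * B i j) - ?t\<^sup>2 / B x x"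
      unfolding B'_def right_diff_distrib sum_subtractf power2_eq_square sum_product
        sum_divide_distrib by (simp add: mult_ac)
    also have "\<dots> = (\<Sum>i\<in>?G. \<Sum>j\<in>?G. c i * c j * B i j) - (?t / B x x) * ?t - (?t / B x x) * ?t + (?t / B x x)\<^sup>2 * B x x"
      by (simp add: power2_eq_square)
    also have "\<dots> \<ge> 0" using Q[of c "?t / B x x"] unfolding t .
    finally show "0 \<le> (\<Sum>i\<in>?G. \<Sum>j\<in>?G. c i * c j * B' i j)" .
  qed
  have "0 \<le> (\<Sum>i\<in>F. \<Sum>j\<in>F. P i j * B' i j)"
    using fG by (intro insert.IH psd_subset[OF P] psd_subset[OF psdB']) auto
  also have "\<dots> = (\<Sum>i\<in>?G. \<Sum>j\<in>?G. P i j * B' i j)"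
    using insert.hyps B'x by (simp add: sum.distrib)
  \<comment> \<open>Pairing \<open>P\<close> with the removed rank-one matrix gives the quadratic
    form of \<open>P\<close> at column \<open>x\<close> of \<open>B\<close>, divided by
    \<open>B x x\<close>.\<close>
  also have "\<dots> \<le> (\<Sum>i\<in>?G. \<Sum>j\<in>?G. P i j * B' i j) + (\<Sum>i\<in>?G. \<Sum>j\<in>?G. B i x * B j x * P i j) / B x x"
    using psd_nonneg[OF P, of "\<lambda>i. B i x"] Bxx by (simp del: sum.insert)
  also have "\<dots> = (\<Sum>i\<in>?G. \<Sum>j\<in>?G. P i j * B i j)"
    unfolding sum_divide_distrib sum.distrib[symmetric] B'_def
    by (intro sum.cong refl) (simp add: algebra_simps)
  finally show ?case .
qed simp

text \<open>Scaling rows and columns of \<open>A\<close> by \<open>c\<close> preserves positive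
  semidefiniteness. The form of the entrywise product at \<open>c\<close> is the trace pairing of
  this scaled matrix with \<open>B\<close>.\<close>

lemma psd_mult:
  assumes "finite F" "psd F A" "psd F B"
  shows "psd F (\<lambda>i j. A i j * B i j)"
  unfolding psd_def
proof (intro conjI allI)
  show "\<forall>i\<in>F. \<forall>j\<in>F. A i j * B i j = A j i * B j i"
    using psd_sym[OF assms(2)] psd_sym[OF assms(3)] by simp
  fix c :: "'a \<Rightarrow> real"
  have "psd F (\<lambda>i j. c i * c j * A i j)"
    unfolding psd_def
  proof (intro conjI allI)
    show "\<forall>i\<in>F. \<forall>j\<in>F. c i * c j * A i j = c j * c i * A j i" using assms(2) unfolding psd_def by simp
    fix b :: "'a \<Rightarrow> real"
    have "0 \<le> (\<Sum>i\<in>F. \<Sum>j\<in>F. (b i * c i) * (b j * c j) * A i j)"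
      by (rule psd_nonneg[OF assms(2)])
    then show "0 \<le> (\<Sum>i\<in>F. \<Sum>j\<in>F. b i * b j * (c i * c j * A i j))" by (simp add: mult_ac)
  qed
  from Schur_trace_nonneg[OF assms(1) this assms(3)]
  show "0 \<le> (\<Sum>i\<in>F. \<Sum>j\<in>F. c i * c j * (A i j * B i j))" by (simp add: mult.assoc)
qed

text \<open>Telescoping: with K, G, G' the products over \<open>J\<close>, the new difference is
  (K_x G_x - G'_x) (K G) + G'_x (K G - G'), a sum of entrywise products of positive semidefinite
  matrices. The first summand needs the product of the \<open>G m\<close> to be positive
  semidefinite, hence the joint induction.\<close>

lemma psd_prod_mono:
  assumes F: "finite F" and "finite J" "\<And>m. m \<in> J \<Longrightarrow> psd F (G m)" "\<And>m. m \<in> J \<Longrightarrow> psd F (G' m)"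
    "\<And>m. m \<in> J \<Longrightarrow> 0 \<le> K m" "\<And>m. m \<in> J \<Longrightarrow> psd F (\<lambda>i j. K m * G m i j - G' m i j)"
  shows "psd F (\<lambda>i j. \<Prod>m\<in>J. G m i j) \<and>
    psd F (\<lambda>i j. (\<Prod>m\<in>J. K m) * (\<Prod>m\<in>J. G m i j) - (\<Prod>m\<in>J. G' m i j))"
  using assms(2-)
proof (induction J rule: finite_induct)
  case empty
  have "psd F (\<lambda>i j. 0 * 1)" by (intro psd_scale psd_one) simp
  then show ?case by (simp add: psd_one)
next
  case (insert x J)
  let ?K = "\<Prod>m\<in>J. K m" and ?G = "\<lambda>i j. \<Prod>m\<in>J. G m i j" and ?G' = "\<lambda>i j. \<Prod>m\<in>J. G' m i j"
  have IH: "psd F ?G" "psd F (\<lambda>i j. ?K * ?G i j - ?G' i j)" using insert by auto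
  have "0 \<le> ?K" using insert.prems by (intro prod_nonneg) auto
  then have "psd F (\<lambda>i j. (K x * G x i j - G' x i j) * (?K * ?G i j) + G' x i j * (?K * ?G i j - ?G' i j))"
    using insert.prems by (intro psd_add psd_mult psd_scale F IH) auto
  moreover have "(\<lambda>i j. (K x * G x i j - G' x i j) * (?K * ?G i j) + G' x i j * (?K * ?G i j - ?G' i j))
     = (\<lambda>i j. (\<Prod>m\<in>insert x J. K m) * (\<Prod>m\<in>insert x J. G m i j) - (\<Prod>m\<in>insert x J. G' m i j))"
    using insert.hyps by (simp add: fun_eq_iff algebra_simps)
  moreover have "psd F (\<lambda>i j. G x i j * ?G i j)" using insert.prems by (intro psd_mult F IH) auto
  ultimately show ?case using insert.hyps by simp
qed

lemma psd_Gram: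
  assumes "hilbert_space X" "finite F" "\<And>i. i \<in> F \<Longrightarrow> f i \<in> elems X"
  shows "psd F (\<lambda>i j. ip X (f i) (f j))"
  unfolding psd_def
proof (intro conjI allI)
  show "\<forall>i\<in>F. \<forall>j\<in>F. ip X (f i) (f j) = ip X (f j) (f i)"
    using assms hilbert_ip_commute by blast
  fix c :: "'b \<Rightarrow> real"
  show "0 \<le> (\<Sum>i\<in>F. \<Sum>j\<in>F. c i * c j * ip X (f i) (f j))"
    using hilbert_ip_nonneg[OF assms(1) hilbert_sum[OF assms(1,2), of f c]] assms
    by (simp add: hilbert_ip_sum)
qed

text \<open>The form at \<open>c\<close> is C^2 times the squared norm of the combination of the
  \<open>f i\<close>, minus the squared norm of its image. As \<open>T\<close> is linear only almost
  everywhere, the image is compared with the combination of the \<open>T (f i)\<close> through their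
  norms.\<close>

lemma psd_Gram_bounded_op:
  assumes X: "hilbert_space X" and Y: "hilbert_space Y" and T: "bounded_op X Y T"
    and C: "0 \<le> C" "\<And>f. f \<in> elems X \<Longrightarrow> nrm Y (T f) \<le> C * nrm X f"
    and F: "finite F" "\<And>i. i \<in> F \<Longrightarrow> f i \<in> elems X"
  shows "psd F (\<lambda>i j. C\<^sup>2 * ip X (f i) (f j) - ip Y (T (f i)) (T (f j)))"
  unfolding psd_def
proof (intro conjI allI)
  have Tf: "\<And>i. i \<in> F \<Longrightarrow> T (f i) \<in> elems Y" using F bounded_op_elems[OF T] by blast
  show "\<forall>i\<in>F. \<forall>j\<in>F. C\<^sup>2 * ip X (f i) (f j) - ip Y (T (f i)) (T (f j))
      = C\<^sup>2 * ip X (f j) (f i) - ip Y (T (f j)) (T (f i))"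
  proof (intro ballI)
    fix i j assume "i \<in> F" "j \<in> F"
    then show "C\<^sup>2 * ip X (f i) (f j) - ip Y (T (f i)) (T (f j))
      = C\<^sup>2 * ip X (f j) (f i) - ip Y (T (f j)) (T (f i))"
      using hilbert_ip_commute[OF X F(2) F(2), of i j] hilbert_ip_commute[OF Y Tf Tf, of i j] by simp
  qed
  fix c :: "'c \<Rightarrow> real"
  let ?f = "\<lambda>x. \<Sum>i\<in>F. c i * f i x" and ?g = "\<lambda>y. \<Sum>i\<in>F. c i * T (f i) y"
  have f: "?f \<in> elems X" and g: "?g \<in> elems Y" using F Tf by (auto intro: hilbert_sum X Y)
  have "nrm Y ?g = nrm Y (T ?f)"
    using bounded_op_sum[OF X T F(1), of f c] F(2)
    by (intro hilbert_nrm_AE[OF Y g bounded_op_elems[OF T f]]) auto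
  also have "\<dots> \<le> C * nrm X ?f" by (rule C(2)[OF f])
  finally have "(nrm Y ?g)\<^sup>2 \<le> (C * nrm X ?f)\<^sup>2"
    using hilbert_nrm_nonneg[OF Y g] by (rule power_mono)
  then have "ip Y ?g ?g \<le> C\<^sup>2 * ip X ?f ?f"
    by (simp add: power_mult_distrib hilbert_nrm_power2[OF X f] hilbert_nrm_power2[OF Y g])
  then show "0 \<le> (\<Sum>i\<in>F. \<Sum>j\<in>F. c i * c j * (C\<^sup>2 * ip X (f i) (f j) - ip Y (T (f i)) (T (f j))))"
    using hilbert_ip_sum[OF X F(1), where f=f and c=c] hilbert_ip_sum[OF Y F(1), where f="\<lambda>i. T (f i)" and c=c] F(2) Tf
    by (simp add: right_diff_distrib sum_subtractf sum_distrib_left mult_ac)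
qed

section \<open>Tensor products of bounded operators\<close>

lemma sum_lessThan_plus:
  fixes f :: "nat \<Rightarrow> 'a::comm_monoid_add"
  shows "(\<Sum>k<m + n. f k) = (\<Sum>k<m. f k) + (\<Sum>k<n. f (m + k))"
  by (induction n) (simp_all add: add.assoc)

section \<open>Bounded intervals and boxes as finite measure spaces\<close>

lemma space_ivl [simp]: "space (ivl a b) = {a<..<b}"
  by (simp add: ivl_def space_restrict_space)

lemma finite_measure_ivl: "finite_measure (ivl a b)"
proof (rule finite_measureI)
  have "emeasure (ivl a b) (space (ivl a b)) \<le> emeasure lborel {a<..<b}"
    by (simp add: ivl_def space_restrict_space emeasure_restrict_space)
  also have "\<dots> < \<infinity>" by (cases "a \<le> b") auto
  finally show "emeasure (ivl a b) (space (ivl a b)) \<noteq> \<infinity>" by simp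
qed

global_interpretation ivl: product_sigma_finite "\<lambda>m. ivl (lo m) (hi m)" for lo hi :: "nat \<Rightarrow> real"
  unfolding product_sigma_finite_def using finite_measure.axioms(1)[OF finite_measure_ivl] by blast

lemma finite_measure_box: "finite J \<Longrightarrow> finite_measure (box_measure J lo hi)"
proof (rule finite_measureI)
  assume J: "finite J"
  have "emeasure (box_measure J lo hi) (space (box_measure J lo hi))
      = (\<Prod>m\<in>J. emeasure (ivl (lo m) (hi m)) (space (ivl (lo m) (hi m))))"
    unfolding box_measure_def space_PiM using J by (intro ivl.emeasure_PiM) (auto simp del: space_ivl)
  also have "\<dots> \<noteq> \<infinity>"
    using finite_measure.emeasure_finite[OF finite_measure_ivl] by (simp add: ennreal_prod_eq_top)
  finally show "emeasure (box_measure J lo hi) (space (box_measure J lo hi)) \<noteq> \<infinity>" .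
qed

lemma hilbert_space_L2_ivl: "hilbert_space (L2 (ivl a b))"
  by (rule finite_measure.hilbert_space_L2[OF finite_measure_ivl])

lemma hilbert_space_L2_box: "finite J \<Longrightarrow> hilbert_space (L2 (box_measure J lo hi))"
  by (rule finite_measure.hilbert_space_L2[OF finite_measure_box])

lemma etensor_L2:
  assumes "\<And>m. m \<in> {1..d} \<Longrightarrow> v m \<in> elems (L2 (ivl (lo m) (hi m)))"
  shows "etensor d v \<in> elems (L2 (box_measure {1..d} lo hi))"
proof -
  \<comment> \<open>This supplies the joint measurability of the tensor; its square is treated
    separately.\<close>
  have "integrable (box_measure {1..d} lo hi) (etensor d v)"
    unfolding box_measure_def etensor_def using assms
    by (intro ivl.product_integrable_prod finite_measure.L2_imp_integrable[OF finite_measure_ivl]) auto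
  moreover have "integrable (box_measure {1..d} lo hi) (\<lambda>z. \<Prod>m\<in>{1..d}. (v m (z m))\<^sup>2)"
    unfolding box_measure_def using assms
    by (intro ivl.product_integrable_prod) (auto simp: elems_L2)
  ultimately show ?thesis by (auto simp: elems_L2 etensor_def prod_power_distrib)
qed

lemma ip_L2_etensor:
  assumes "\<And>m. m \<in> {1..d} \<Longrightarrow> v m \<in> elems (L2 (ivl (lo m) (hi m)))"
    and "\<And>m. m \<in> {1..d} \<Longrightarrow> w m \<in> elems (L2 (ivl (lo m) (hi m)))"
  shows "ip (L2 (box_measure {1..d} lo hi)) (etensor d v) (etensor d w)
    = (\<Prod>m\<in>{1..d}. ip (L2 (ivl (lo m) (hi m))) (v m) (w m))"
proof -
  have "(\<integral>z. (\<Prod>m\<in>{1..d}. v m (z m) * w m (z m)) \<partial>box_measure {1..d} lo hi)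
    = (\<Prod>m\<in>{1..d}. \<integral>t. v m t * w m t \<partial>ivl (lo m) (hi m))"
    unfolding box_measure_def using assms
    by (intro ivl.product_integral_prod integrable_mult_L2) auto
  then show ?thesis by (simp add: ip_L2 etensor_def prod.distrib)
qed

text \<open>Both squared norms are quadratic forms in \<open>c\<close> of entrywise products of Gram
  matrices. The resulting constant is independent of \<open>n\<close> and of the representation,
  which a term-by-term estimate would not achieve.\<close>

lemma nrm_tensor_op_le:
  fixes n :: nat
  assumes HT: "hilbert_tensor d Hs H"
    and Hs: "\<And>m. m \<in> {1..d} \<Longrightarrow> hilbert_space (Hs m)"
    and S: "\<And>m. m \<in> {1..d} \<Longrightarrow> bounded_op (Hs m) (L2 (ivl (lo m) (hi m))) (S m)"
    and C: "\<And>m. m \<in> {1..d} \<Longrightarrow> 0 \<le> C m"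
      "\<And>m f. m \<in> {1..d} \<Longrightarrow> f \<in> elems (Hs m) \<Longrightarrow> nrm (L2 (ivl (lo m) (hi m))) (S m f) \<le> C m * nrm (Hs m) f"
    and v: "\<And>k m. k < n \<Longrightarrow> m \<in> {1..d} \<Longrightarrow> v k m \<in> elems (Hs m)"
  shows "nrm (L2 (box_measure {1..d} lo hi)) (\<lambda>z. \<Sum>k<n. c k * etensor d (\<lambda>m. S m (v k m)) z)
    \<le> (\<Prod>m\<in>{1..d}. C m) * nrm H (\<lambda>z. \<Sum>k<n. c k * etensor d (v k) z)"
proof -
  let ?Y = "L2 (box_measure {1..d} lo hi)"
  let ?f = "\<lambda>z. \<Sum>k<n. c k * etensor d (v k) z" and ?g = "\<lambda>z. \<Sum>k<n. c k * etensor d (\<lambda>m. S m (v k m)) z"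
  let ?G = "\<lambda>m k l. ip (Hs m) (v k m) (v l m)"
    and ?G' = "\<lambda>m k l. ip (L2 (ivl (lo m) (hi m))) (S m (v k m)) (S m (v l m))"
  have Y: "hilbert_space ?Y" by (rule hilbert_space_L2_box) simp
  have H: "hilbert_space H" using HT by (simp add: hilbert_tensor_def)
  have eH: "etensor d w \<in> elems H" if "\<And>m. m \<in> {1..d} \<Longrightarrow> w m \<in> elems (Hs m)" for w
    using HT that by (simp add: hilbert_tensor_def)
  have ipH: "ip H (etensor d w) (etensor d w') = (\<Prod>m\<in>{1..d}. ip (Hs m) (w m) (w' m))"
    if "\<And>m. m \<in> {1..d} \<Longrightarrow> w m \<in> elems (Hs m)" "\<And>m. m \<in> {1..d} \<Longrightarrow> w' m \<in> elems (Hs m)" for w w'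
    using HT that by (simp add: hilbert_tensor_def)
  have Sv: "S m (v k m) \<in> elems (L2 (ivl (lo m) (hi m)))" if "k < n" "m \<in> {1..d}" for k m
    using bounded_op_elems[OF S[OF that(2)] v[OF that]] .
  have ipv: "ip H (etensor d (v k)) (etensor d (v l)) = (\<Prod>m\<in>{1..d}. ip (Hs m) (v k m) (v l m))"
    if "k < n" "l < n" for k l
    using v that by (intro ipH) auto
  have f: "?f \<in> elems H" using v by (intro hilbert_sum[OF H] eH) auto
  have eY: "etensor d (\<lambda>m. S m (v k m)) \<in> elems ?Y" if "k < n" for k
    using Sv that by (intro etensor_L2) auto
  have ipY: "ip ?Y (etensor d (\<lambda>m. S m (v k m))) (etensor d (\<lambda>m. S m (v l m))) = (\<Prod>m\<in>{1..d}. ?G' m k l)"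
    if "k < n" "l < n" for k l
    using Sv that by (intro ip_L2_etensor) auto
  have g: "?g \<in> elems ?Y" using Sv by (intro hilbert_sum[OF Y] etensor_L2) auto
  have "psd {..<n} (\<lambda>k l. (\<Prod>m\<in>{1..d}. (C m)\<^sup>2) * (\<Prod>m\<in>{1..d}. ?G m k l) - (\<Prod>m\<in>{1..d}. ?G' m k l))"
  proof (rule conjunct2[OF psd_prod_mono])
    fix m assume m: "m \<in> {1..d}"
    show "psd {..<n} (?G m)" using v m by (intro psd_Gram Hs) auto
    show "psd {..<n} (?G' m)" using Sv m by (intro psd_Gram hilbert_space_L2_ivl) auto
    show "psd {..<n} (\<lambda>k l. (C m)\<^sup>2 * ?G m k l - ?G' m k l)"
      using v m by (intro psd_Gram_bounded_op[OF Hs[OF m] hilbert_space_L2_ivl S[OF m] C(1)[OF m] C(2)[OF m]]) auto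
  qed auto
  from psd_nonneg[OF this, of c]
  have "(\<Sum>k<n. \<Sum>l<n. c k * c l * (\<Prod>m\<in>{1..d}. ?G' m k l))
      \<le> (\<Prod>m\<in>{1..d}. (C m)\<^sup>2) * (\<Sum>k<n. \<Sum>l<n. c k * c l * (\<Prod>m\<in>{1..d}. ?G m k l))"
    by (simp add: right_diff_distrib sum_subtractf sum_distrib_left mult_ac)
  also have "(\<Sum>k<n. \<Sum>l<n. c k * c l * (\<Prod>m\<in>{1..d}. ?G m k l)) = ip H ?f ?f"
    by (subst hilbert_ip_sum[OF H]) (auto simp: ipv intro!: sum.cong eH v)
  also have "(\<Sum>k<n. \<Sum>l<n. c k * c l * (\<Prod>m\<in>{1..d}. ?G' m k l)) = ip ?Y ?g ?g"
    using eY by (subst hilbert_ip_sum[OF Y]) (auto simp: ipY simp del: One_nat_def intro!: sum.cong)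
  finally have "(nrm ?Y ?g)\<^sup>2 \<le> ((\<Prod>m\<in>{1..d}. C m) * nrm H ?f)\<^sup>2"
    by (simp add: hilbert_nrm_power2[OF H f] hilbert_nrm_power2[OF Y g] power_mult_distrib prod_power_distrib
        del: One_nat_def)
  moreover have "0 \<le> (\<Prod>m\<in>{1..d}. C m) * nrm H ?f"
    using C hilbert_nrm_nonneg[OF H f] by (intro mult_nonneg_nonneg prod_nonneg) auto
  ultimately show ?thesis by (rule power2_le_imp_le)
qed

lemma hilbert_tensor_dense:
  assumes "hilbert_tensor d Hs H" "h \<in> elems H" "0 < e"
  shows "\<exists>n c v. (\<forall>k<(n::nat). \<forall>m\<in>{1..d}. v k m \<in> elems (Hs m)) \<and>
    nrm H (\<lambda>z. h z - (\<Sum>k<n. c k * etensor d (v k) z)) < e"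
  by (rule assms(1)[unfolded hilbert_tensor_def, THEN conjunct2, THEN conjunct2, THEN conjunct2,
      THEN conjunct2, THEN bspec, OF assms(2), THEN spec, THEN mp, OF assms(3)])

lemma tensor_op_exists:
  assumes HT: "hilbert_tensor d Hs H"
    and Hs: "\<And>m. m \<in> {1..d} \<Longrightarrow> hilbert_space (Hs m)"
    and S: "\<And>m. m \<in> {1..d} \<Longrightarrow> bounded_op (Hs m) (L2 (ivl (lo m) (hi m))) (S m)"
  shows "\<exists>T. is_tensor_op d lo hi Hs H S T"
proof -
  let ?Y = "L2 (box_measure {1..d} lo hi)"
  have Y: "hilbert_space ?Y" by (rule hilbert_space_L2_box) simp
  have H: "hilbert_space H" using HT by (simp add: hilbert_tensor_def)
  have "\<forall>m\<in>{1..d}. \<exists>C. 0 \<le> C \<and> (\<forall>f\<in>elems (Hs m). nrm (L2 (ivl (lo m) (hi m))) (S m f) \<le> C * nrm (Hs m) f)"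
    using bounded_opE[OF S hilbert_nrm_nonneg[OF Hs]] by metis
  then obtain C where C: "\<And>m. m \<in> {1..d} \<Longrightarrow> 0 \<le> C m"
    "\<And>m f. m \<in> {1..d} \<Longrightarrow> f \<in> elems (Hs m) \<Longrightarrow> nrm (L2 (ivl (lo m) (hi m))) (S m f) \<le> C m * nrm (Hs m) f"
    by metis
  \<comment> \<open>A relation, because the image is written in terms of the coefficients and
    factors of a representation, not of the function \<open>f\<close> alone.\<close>
  define G where "G f g \<longleftrightarrow> (\<exists>n c v. (\<forall>k<n. \<forall>m\<in>{1..d}. v k m \<in> elems (Hs m)) \<and>
      f = (\<lambda>z. \<Sum>k<(n::nat). c k * etensor d (v k) z) \<and>
      g = (\<lambda>z. \<Sum>k<n. c k * etensor d (\<lambda>m. S m (v k m)) z))" for f g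
  have "\<exists>T. bounded_op H ?Y T \<and> (\<forall>f g. G f g \<longrightarrow> (AE z in base ?Y. T f z = g z))"
  proof (rule bounded_op_extension[OF H Y, where C="\<Prod>m\<in>{1..d}. C m"])
    fix f g assume "G f g"
    then obtain n c v where v: "\<And>k m. k < n \<Longrightarrow> m \<in> {1..d} \<Longrightarrow> v k m \<in> elems (Hs m)"
      and f: "f = (\<lambda>z. \<Sum>k<(n::nat). c k * etensor d (v k) z)"
      and g: "g = (\<lambda>z. \<Sum>k<n. c k * etensor d (\<lambda>m. S m (v k m)) z)"
      unfolding G_def by blast
    show "f \<in> elems H" unfolding f
      using HT v by (intro hilbert_sum[OF H]) (auto simp: hilbert_tensor_def)
    show "g \<in> elems ?Y" unfolding g
      using v bounded_op_elems[OF S] by (intro hilbert_sum[OF Y] etensor_L2) auto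
    show "nrm ?Y g \<le> (\<Prod>m\<in>{1..d}. C m) * nrm H f"
      unfolding f g by (rule nrm_tensor_op_le[OF HT Hs S C v])
    fix f' g' a assume "G f' g'"
    then obtain n' c' v' where v': "\<And>k m. k < n' \<Longrightarrow> m \<in> {1..d} \<Longrightarrow> v' k m \<in> elems (Hs m)"
      and f': "f' = (\<lambda>z. \<Sum>k<(n'::nat). c' k * etensor d (v' k) z)"
      and g': "g' = (\<lambda>z. \<Sum>k<n'. c' k * etensor d (\<lambda>m. S m (v' k m)) z)"
      unfolding G_def by blast
    \<comment> \<open>The two sums are concatenated; the second one occupies the indices from
      \<open>n\<close> on.\<close>
    let ?c = "\<lambda>k. if k < n then a * c k else c' (k - n)" and ?v = "\<lambda>k. if k < n then v k else v' (k - n)"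
    show "G (\<lambda>x. a * f x + f' x) (\<lambda>y. a * g y + g' y)"
      unfolding G_def
    proof (intro exI conjI)
      show "\<forall>k<n+n'. \<forall>m\<in>{1..d}. ?v k m \<in> elems (Hs m)" using v v' by auto
      show "(\<lambda>x. a * f x + f' x) = (\<lambda>z. \<Sum>k<n+n'. ?c k * etensor d (?v k) z)"
        unfolding sum_lessThan_plus f f' by (simp add: sum_distrib_left mult.assoc)
      show "(\<lambda>y. a * g y + g' y) = (\<lambda>z. \<Sum>k<n+n'. ?c k * etensor d (\<lambda>m. S m (?v k m)) z)"
        unfolding sum_lessThan_plus g g' by (simp add: sum_distrib_left mult.assoc)
    qed
  next
    show "0 \<le> (\<Prod>m\<in>{1..d}. C m)" using C by (intro prod_nonneg) auto
  next
    fix f and e :: real assume "f \<in> elems H" "0 < e"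
    then obtain n c v where "\<forall>k<(n::nat). \<forall>m\<in>{1..d}. v k m \<in> elems (Hs m)"
        "nrm H (\<lambda>z. f z - (\<Sum>k<n. c k * etensor d (v k) z)) < e"
      using hilbert_tensor_dense[OF HT] by blast
    then show "\<exists>h g. G h g \<and> nrm H (\<lambda>x. f x - h x) < e" unfolding G_def by blast
  qed
  then obtain T where T: "bounded_op H ?Y T" "\<And>f g. G f g \<Longrightarrow> AE z in box_measure {1..d} lo hi. T f z = g z"
    unfolding base_L2 by blast
  have "G (etensor d v) (etensor d (\<lambda>m. S m (v m)))" if "\<forall>m\<in>{1..d}. v m \<in> elems (Hs m)" for v
    unfolding G_def using that
    by (intro exI[of _ "1::nat"] exI[of _ "\<lambda>_. 1::real"] exI[of _ "\<lambda>_. v"]) auto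
  then show ?thesis using T unfolding is_tensor_op_def by blast
qed

section \<open>Uniqueness of weak derivatives\<close>

text \<open>For \<open>k = 0\<close> this is the classical smooth function that is flat at 0. The
  powers of 1/t are included because differentiation produces them: the linear span of the family is
  closed under derivatives.\<close>

definition flat_exp :: "nat \<Rightarrow> real \<Rightarrow> real" where
  "flat_exp k t = (if t > 0 then inverse t ^ k / exp (inverse t) else 0)"

lemma flat_exp_has_derivative:
  "(flat_exp k has_real_derivative flat_exp (k + 2) t - real k * flat_exp (k + 1) t) (at t)"
proof -
  consider "t < 0" | "t = 0" | "t > 0" by linarith
  then show ?thesis
  proof cases
    case 1
    have "((\<lambda>t. 0::real) has_real_derivative 0) (at t)" by simp
    moreover have "\<forall>\<^sub>F y in nhds t. flat_exp k y = 0"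
      using eventually_nhds_in_open[of "{..<0}" t] 1 by (auto simp: flat_exp_def elim: eventually_mono)
    ultimately have "(flat_exp k has_real_derivative 0) (at t)"
      by (subst DERIV_cong_ev[OF refl _ refl]) auto
    then show ?thesis using 1 by (simp add: flat_exp_def)
  next
    case 2
    \<comment> \<open>The right difference quotient at 0 is \<open>flat_exp (k + 1)\<close>. With x
      = 1/t its limit is that of x^(k+1) / exp x at infinity.\<close>
    have lim: "(flat_exp (k + 1) \<longlongrightarrow> 0) (at_right 0)"
    proof -
      have "((\<lambda>t::real. inverse t ^ (k + 1) / exp (inverse t)) \<longlongrightarrow> 0) (at_right 0)"
        by (rule filterlim_compose[OF tendsto_power_div_exp_0 filterlim_inverse_at_top_right])
      moreover have "\<forall>\<^sub>F t in at_right 0. inverse t ^ (k + 1) / exp (inverse t) = flat_exp (k + 1) t"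
        using eventually_at_right_less[of "0::real"] by eventually_elim (simp add: flat_exp_def)
      ultimately show ?thesis by (rule Lim_transform_eventually)
    qed
    have "((\<lambda>y. flat_exp k y / y) \<longlongrightarrow> 0) (at_right 0)"
      using eventually_at_right_less[of "0::real"]
      by (intro Lim_transform_eventually[OF lim], eventually_elim) (simp add: flat_exp_def field_simps)
    moreover have "((\<lambda>y. flat_exp k y / y) \<longlongrightarrow> 0) (at_left 0)"
    proof -
      have "\<forall>\<^sub>F y in at_left (0::real). 0 = flat_exp k y / y"
        using eventually_at_left_real[of "-1" 0] by (auto simp: flat_exp_def elim: eventually_mono)
      then show ?thesis by (rule Lim_transform_eventually[OF tendsto_const])
    qed
    ultimately have "((\<lambda>y. (flat_exp k y - flat_exp k 0) / (y - 0)) \<longlongrightarrow> 0) (at 0)"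
      by (simp add: filterlim_split_at flat_exp_def)
    then show ?thesis using 2 by (simp add: has_field_derivative_iff flat_exp_def)
  next
    case 3
    have "((\<lambda>t. inverse t ^ k * exp (- inverse t)) has_real_derivative
        (real k * inverse t ^ (k - 1) * (- (inverse t ^ 2)) * exp (- inverse t)
          + inverse t ^ k * (exp (- inverse t) * inverse t ^ 2))) (at t)"
      using 3 by (auto intro!: derivative_eq_intros simp: power2_eq_square)
    \<comment> \<open>For \<open>k = 0\<close> the truncated exponent \<open>k - 1\<close> is
      harmless because of the factor \<open>real k\<close>.\<close>
    also have "real k * inverse t ^ (k - 1) * (- (inverse t ^ 2)) = - (real k * inverse t ^ (k + 1))"
      by (cases k) (simp_all add: power2_eq_square)
    finally have "((\<lambda>t. inverse t ^ k * exp (- inverse t)) has_real_derivative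
        flat_exp (k + 2) t - real k * flat_exp (k + 1) t) (at t)"
      using 3 by (simp add: flat_exp_def exp_minus divide_inverse power2_eq_square mult_ac)
    moreover have "\<forall>\<^sub>F y in nhds t. flat_exp k y = inverse y ^ k * exp (- inverse y)"
      using eventually_nhds_in_open[of "{0<..}" t] 3
      by (auto simp: flat_exp_def exp_minus divide_inverse elim: eventually_mono)
    ultimately show ?thesis by (subst DERIV_cong_ev[OF refl _ refl]) auto
  qed
qed

text \<open>Smoothness is packaged as membership in a class that is closed under differentiation, so
  that higher derivatives of products never have to be computed.\<close>

inductive_set smooth_gen :: "(real \<Rightarrow> real) set" where
  const: "(\<lambda>t. c) \<in> smooth_gen"
| flat: "(\<lambda>t. flat_exp k (a * t + b)) \<in> smooth_gen"
| add: "f \<in> smooth_gen \<Longrightarrow> g \<in> smooth_gen \<Longrightarrow> (\<lambda>t. f t + g t) \<in> smooth_gen"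
| mult: "f \<in> smooth_gen \<Longrightarrow> g \<in> smooth_gen \<Longrightarrow> (\<lambda>t. f t * g t) \<in> smooth_gen"

lemma smooth_gen_has_derivative:
  "f \<in> smooth_gen \<Longrightarrow> \<exists>f'\<in>smooth_gen. \<forall>t. (f has_real_derivative f' t) (at t)"
proof (induction rule: smooth_gen.induct)
  case (const c)
  show ?case by (rule bexI[OF _ smooth_gen.const[of 0]]) auto
next
  case (flat k a b)
  let ?g = "\<lambda>t. a * (flat_exp (k + 2) (a * t + b) + (- real k) * flat_exp (k + 1) (a * t + b))"
  have "((\<lambda>t. flat_exp k (a * t + b)) has_real_derivative ?g t) (at t)" for t
  proof -
    have "((\<lambda>t. a * t + b) has_real_derivative a) (at t)" by (auto intro!: derivative_eq_intros)
    from DERIV_chain2[OF flat_exp_has_derivative this] show ?thesis by (simp add: mult.commute)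
  qed
  moreover have "?g \<in> smooth_gen" by (intro smooth_gen.intros)
  ultimately show ?case by (intro bexI[of _ ?g] allI)
next
  case (add f g)
  then obtain f' g' where "f' \<in> smooth_gen" "g' \<in> smooth_gen"
    "\<And>t. (f has_real_derivative f' t) (at t)" "\<And>t. (g has_real_derivative g' t) (at t)" by blast
  then show ?case
    by (intro bexI[of _ "\<lambda>t. f' t + g' t"]) (auto intro!: derivative_eq_intros smooth_gen.intros)
next
  case (mult f g)
  then obtain f' g' where "f' \<in> smooth_gen" "g' \<in> smooth_gen"
    "\<And>t. (f has_real_derivative f' t) (at t)" "\<And>t. (g has_real_derivative g' t) (at t)" by blast
  with mult.hyps show ?case
    by (intro bexI[of _ "\<lambda>t. f' t * g t + g' t * f t"]) (auto intro!: derivative_eq_intros smooth_gen.intros)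
qed

declare One_nat_def [simp del]

section \<open>Products of smooth functions as test functions\<close>

lemma etensor_upd:
  assumes "m \<in> {1..d}"
  shows "etensor d f (z(m := t)) = f m t * (\<Prod>i\<in>{1..d}-{m}. f i (z i))"
  unfolding etensor_def using assms by (subst prod.remove[of _ m]) (auto intro!: prod.cong)

lemma partial_etensor:
  assumes m: "m \<in> {1..d}" and f': "\<And>t. (f m has_real_derivative f' t) (at t)"
  shows "partial m (etensor d f) = etensor d (f(m := f'))"
proof
  fix z
  have "((\<lambda>t. etensor d f (z(m := t))) has_real_derivative f' (z m) * (\<Prod>i\<in>{1..d}-{m}. f i (z i))) (at (z m))"
    unfolding etensor_upd[OF m] using f'[of "z m"] by (auto intro!: derivative_eq_intros)
  then have "partial m (etensor d f) z = f' (z m) * (\<Prod>i\<in>{1..d}-{m}. f i (z i))"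
    unfolding partial_def by (rule DERIV_imp_deriv)
  also have "\<dots> = etensor d (f(m := f')) z"
    unfolding etensor_def using m by (subst prod.remove[of _ m]) (auto intro!: prod.cong)
  finally show "partial m (etensor d f) z = etensor d (f(m := f')) z" .
qed

text \<open>Each partial derivative changes a single factor within the generated class, so mixed
  derivatives of any order and sequence remain elementary tensors.\<close>

lemma foldr_partial_etensor:
  assumes "set ms \<subseteq> {1..d}" "\<And>i. f i \<in> smooth_gen"
  shows "\<exists>f'. (\<forall>i. f' i \<in> smooth_gen) \<and> foldr partial ms (etensor d f) = etensor d f'"
  using assms(1)
proof (induction ms)
  case (Cons m ms)
  then obtain g where g: "\<And>i. g i \<in> smooth_gen" "foldr partial ms (etensor d f) = etensor d g" by auto
  obtain g' where "g' \<in> smooth_gen" "\<And>t. (g m has_real_derivative g' t) (at t)"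
    using smooth_gen_has_derivative[OF g(1)] by blast
  with Cons.prems have "partial m (etensor d g) = etensor d (g(m := g'))"
    by (intro partial_etensor) auto
  then show ?case using g \<open>g' \<in> smooth_gen\<close>
    by (intro exI[of _ "g(m := g')"]) (simp del: fun_upd_apply, simp)
qed (use assms(2) in auto)

text \<open>Extensional functions on \<open>J\<close> form a full product once every coordinate
  outside \<open>J\<close> is confined to \<open>{undefined}\<close>, which is compact. Tychonoff
  then applies over all indices.\<close>

lemma compact_PiE_interval: "compact (\<Pi>\<^sub>E m\<in>J. {c m..e m::real})"
proof -
  let ?S = "\<lambda>i. if i \<in> J then {c i..e i} else {undefined}"
  have "compactin (product_topology (\<lambda>i. euclidean) UNIV) (PiE UNIV ?S)"
    unfolding compactin_PiE by auto
  moreover have "PiE UNIV ?S = (\<Pi>\<^sub>E m\<in>J. {c m..e m})"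
    by (auto simp: PiE_iff extensional_def split: if_splits)
  ultimately show ?thesis by (simp add: euclidean_product_topology)
qed

lemma PiE_interval_subset:
  fixes lo hi c e :: "'i \<Rightarrow> real"
  assumes "\<And>i. i \<in> J \<Longrightarrow> lo i < c i" "\<And>i. i \<in> J \<Longrightarrow> e i < hi i"
  shows "(\<Pi>\<^sub>E m\<in>J. {c m..e m}) \<subseteq> (\<Pi>\<^sub>E m\<in>J. {lo m<..<hi m})"
proof (rule PiE_mono)
  fix m assume "m \<in> J"
  from assms[OF this] show "{c m..e m} \<subseteq> {lo m<..<hi m}" by auto
qed

lemma smooth_gen_continuous: "f \<in> smooth_gen \<Longrightarrow> continuous_on S f"
  using smooth_gen_has_derivative by (metis DERIV_continuous_on has_field_derivative_at_within)

lemma continuous_on_etensor: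
  assumes "\<And>i. continuous_on UNIV (f i)"
  shows "continuous_on S (etensor d f)"
  unfolding etensor_def
  by (intro continuous_on_prod continuous_on_compose2[OF assms]
      continuous_on_subset[OF continuous_on_product_coordinates]) auto

lemma test_fun_etensor:
  assumes f: "\<And>i. f i \<in> smooth_gen"
    and supp: "\<And>i t. i \<in> {1..d} \<Longrightarrow> t \<notin> {c i..e i} \<Longrightarrow> f i t = 0"
    and ce: "\<And>i. i \<in> {1..d} \<Longrightarrow> lo i < c i" "\<And>i. i \<in> {1..d} \<Longrightarrow> e i < hi i"
  shows "test_fun d lo hi (etensor d f)"
  unfolding test_fun_def
proof (intro conjI allI impI ballI)
  fix ms assume ms: "set ms \<subseteq> {1..d}"
  obtain g where g: "\<And>i. g i \<in> smooth_gen" "foldr partial ms (etensor d f) = etensor d g"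
    using foldr_partial_etensor[where f=f, OF ms f] by auto
  show "continuous_on (\<Pi>\<^sub>E m\<in>{1..d}. UNIV) (foldr partial ms (etensor d f))"
    unfolding g(2) by (intro continuous_on_etensor smooth_gen_continuous g)
  fix m and z assume m: "m \<in> {1..d}"
  obtain g' where "\<And>t. (g m has_real_derivative g' t) (at t)"
    using smooth_gen_has_derivative[OF g(1)] by blast
  then have "((\<lambda>t. g m t * b) has_real_derivative g' (z m) * b) (at (z m))" for b
    by (auto intro!: derivative_eq_intros)
  then show "(\<lambda>t. foldr partial ms (etensor d f) (z(m := t))) differentiable (at (z m))"
    unfolding g(2) etensor_upd[OF m] by (auto simp: real_differentiable_def)
next
  have "etensor d f z = 0" if z: "z \<in> (\<Pi>\<^sub>E m\<in>{1..d}. UNIV)" "z \<notin> (\<Pi>\<^sub>E m\<in>{1..d}. {c m..e m})" for z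
  proof -
    obtain i where "i \<in> {1..d}" "z i \<notin> {c i..e i}" using z by (auto simp: PiE_iff)
    then show ?thesis unfolding etensor_def by (intro prod_zero bexI[of _ i] supp) auto
  qed
  moreover have "(\<Pi>\<^sub>E m\<in>{1..d}. {c m..e m}) \<subseteq> (\<Pi>\<^sub>E m\<in>{1..d}. {lo m<..<hi m})"
    using ce by (rule PiE_interval_subset)
  ultimately show "\<exists>K. compact K \<and> K \<subseteq> (\<Pi>\<^sub>E m\<in>{1..d}. {lo m<..<hi m}) \<and>
      (\<forall>z\<in>(\<Pi>\<^sub>E m\<in>{1..d}. UNIV). z \<notin> K \<longrightarrow> etensor d f z = 0)"
    by (intro exI[of _ "\<Pi>\<^sub>E m\<in>{1..d}. {c m..e m}"] conjI compact_PiE_interval ballI impI)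
qed

text \<open>Explicitly exp(-1/(n (t - c))) exp(-1/(n (e - t))) on (c, e) for n > 0. Increasing
  \<open>n\<close> weakens the decay at the ends, so the limit is the indicator of the open
  interval. The arguments are spelled as affine functions to match the generator
  \<open>smooth_gen.flat\<close>.\<close>

definition bump :: "nat \<Rightarrow> real \<Rightarrow> real \<Rightarrow> real \<Rightarrow> real" where
  "bump n c e t = flat_exp 0 (real n * t + (- real n * c)) * flat_exp 0 (- real n * t + real n * e)"

lemma bump_smooth: "bump n c e \<in> smooth_gen"
  unfolding bump_def[abs_def] by (intro smooth_gen.intros)

lemma flat_exp_0_bounds: "0 \<le> flat_exp 0 t" "flat_exp 0 t \<le> 1"
  by (auto simp: flat_exp_def)

lemma bump_bounds: "0 \<le> bump n c e t" "bump n c e t \<le> 1"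
  unfolding bump_def using flat_exp_0_bounds by (auto intro: mult_nonneg_nonneg mult_le_one)

lemma bump_eq_0: "t \<notin> {c<..<e} \<Longrightarrow> bump n c e t = 0"
proof -
  assume "t \<notin> {c<..<e}"
  then have "t \<le> c \<or> e \<le> t" by auto
  then have "real n * t \<le> real n * c \<or> real n * e \<le> real n * t" by (auto intro: mult_left_mono)
  then show ?thesis by (auto simp: bump_def flat_exp_def)
qed

lemma bump_tendsto: "(\<lambda>n. bump n c e t) \<longlonglongrightarrow> indicator {c<..<e} t"
proof (cases "t \<in> {c<..<e}")
  case True
  have flat: "(\<lambda>n. flat_exp 0 (real n * s)) \<longlonglongrightarrow> 1" if "s > 0" for s
  proof -
    have "(\<lambda>n. inverse (real n) * inverse s) \<longlonglongrightarrow> 0 * inverse s"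
      by (intro tendsto_mult lim_inverse_n tendsto_const)
    then have "(\<lambda>n. 1 / exp (inverse (real n * s))) \<longlonglongrightarrow> 1 / exp 0"
      by (intro tendsto_intros) auto
    moreover have "\<forall>\<^sub>F n in sequentially. 1 / exp (inverse (real n * s)) = flat_exp 0 (real n * s)"
      using eventually_gt_at_top[of 0] by eventually_elim (use that in \<open>simp add: flat_exp_def\<close>)
    ultimately show ?thesis using Lim_transform_eventually by fastforce
  qed
  have "(\<lambda>n. flat_exp 0 (real n * (t - c)) * flat_exp 0 (real n * (e - t))) \<longlonglongrightarrow> 1 * 1"
    using True by (intro tendsto_mult flat) auto
  moreover have "bump n c e t = flat_exp 0 (real n * (t - c)) * flat_exp 0 (real n * (e - t))" for n
    by (simp add: bump_def algebra_simps)
  ultimately show ?thesis using True by simp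
qed (simp add: bump_eq_0)

section \<open>Measurability and integrability on the box\<close>

lemma space_box: "space (box_measure J lo hi) = (\<Pi>\<^sub>E m\<in>J. {lo m<..<hi m})"
  by (simp add: box_measure_def space_PiM)

lemma measurable_box_component:
  assumes "f \<in> borel_measurable borel" "m \<in> J"
  shows "(\<lambda>z. f (z m)) \<in> borel_measurable (box_measure J lo hi)"
proof -
  have "f \<in> borel_measurable (ivl (lo m) (hi m))"
    unfolding ivl_def by (rule measurable_restrict_space1) (simp add: assms)
  then show ?thesis
    unfolding box_measure_def
    by (rule measurable_compose[OF measurable_component_singleton[OF assms(2)]])
qed

lemma measurable_box_etensor:
  assumes "\<And>i. i \<in> {1..d} \<Longrightarrow> f i \<in> borel_measurable borel"
  shows "etensor d f \<in> borel_measurable (box_measure {1..d} lo hi)"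
  unfolding etensor_def[abs_def] by (intro borel_measurable_prod measurable_box_component assms)

text \<open>Links the topology of the function space, in which test functions and compact sets are
  described, with the product sigma-algebra. Coordinates outside \<open>J\<close> are constant on
  the space of the measure.\<close>

lemma measurable_box_borel: "(\<lambda>z. z) \<in> borel_measurable (box_measure J lo hi)"
proof (rule measurable_coordinatewise_then_product)
  fix i
  show "(\<lambda>z. z i) \<in> borel_measurable (box_measure J lo hi)"
  proof (cases "i \<in> J")
    case True
    then show ?thesis using measurable_box_component[of "\<lambda>t. t" i J] by simp
  next
    case False
    have "(\<lambda>z. undefined :: real) \<in> borel_measurable (box_measure J lo hi)" by simp
    then show ?thesis
      by (rule measurable_cong[THEN iffD1, rotated]) (use False in \<open>auto simp: space_box PiE_iff extensional_def\<close>)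
  qed
qed

text \<open>Continuity is given only on extensional functions. Precomposing with restriction to
  \<open>J\<close>, itself continuous, yields a Borel function on the whole space that agrees with
  the original on the box.\<close>

lemma measurable_box_continuous:
  fixes \<phi> :: "(nat \<Rightarrow> real) \<Rightarrow> real"
  assumes "continuous_on (\<Pi>\<^sub>E m\<in>J. UNIV) \<phi>"
  shows "\<phi> \<in> borel_measurable (box_measure J lo hi)"
proof -
  have "continuous_on UNIV (\<lambda>z::nat \<Rightarrow> real. restrict z J)"
  proof (rule continuous_on_coordinatewise_then_product)
    show "continuous_on UNIV (\<lambda>z::nat \<Rightarrow> real. restrict z J i)" for i
      by (cases "i \<in> J") auto
  qed
  then have "continuous_on UNIV (\<lambda>z. \<phi> (restrict z J))"
    by (rule continuous_on_compose2[OF assms]) auto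
  then have [measurable]: "(\<lambda>z. \<phi> (restrict z J)) \<in> borel_measurable borel"
    by (rule borel_measurable_continuous_onI)
  have "(\<lambda>z. \<phi> (restrict z J)) \<in> borel_measurable (box_measure J lo hi)"
    by (rule measurable_compose[OF measurable_box_borel]) measurable
  then show ?thesis
    by (rule measurable_cong[THEN iffD1, rotated]) (auto simp: space_box PiE_restrict)
qed

lemma test_fun_supportE:
  assumes "test_fun d lo hi \<phi>"
  obtains K where "compact K" "K \<subseteq> (\<Pi>\<^sub>E m\<in>{1..d}. {lo m<..<hi m})"
    "\<And>z. z \<in> (\<Pi>\<^sub>E m\<in>{1..d}. UNIV) \<Longrightarrow> z \<notin> K \<Longrightarrow> \<phi> z = 0"
proof -
  have "\<exists>K. compact K \<and> K \<subseteq> (\<Pi>\<^sub>E m\<in>{1..d}. {lo m<..<hi m}) \<and>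
      (\<forall>z\<in>(\<Pi>\<^sub>E m\<in>{1..d}. UNIV). z \<notin> K \<longrightarrow> \<phi> z = 0)"
    using assms unfolding test_fun_def by (rule conjunct2)
  then show thesis
    by (elim exE conjE) (rule that, assumption, assumption, drule(1) bspec, drule(1) mp, assumption)
qed

lemma test_fun_foldr_continuous:
  assumes "test_fun d lo hi \<phi>" "set ms \<subseteq> {1..d}"
  shows "continuous_on (\<Pi>\<^sub>E m\<in>{1..d}. UNIV) (foldr partial ms \<phi>)"
  using assms(1)[unfolded test_fun_def, THEN conjunct1, THEN spec, THEN mp, OF assms(2)] by (rule conjunct1)

lemma test_fun_continuous: "test_fun d lo hi \<phi> \<Longrightarrow> continuous_on (\<Pi>\<^sub>E m\<in>{1..d}. UNIV) \<phi>"
  using test_fun_foldr_continuous[of d lo hi \<phi> "[]"] by simp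

lemma test_fun_measurable:
  assumes "test_fun d lo hi \<phi>"
  shows "\<phi> \<in> borel_measurable (box_measure {1..d} lo hi)"
  by (rule measurable_box_continuous[OF test_fun_continuous[OF assms]])

text \<open>A test function is bounded on its compact support, so the product is dominated by a
  multiple of \<open>g\<close> cut off to that support.\<close>

lemma integrable_mult_test_fun:
  assumes \<phi>: "test_fun d lo hi \<phi>" and g: "g \<in> borel_measurable (box_measure {1..d} lo hi)"
    and int: "\<And>K. compact K \<Longrightarrow> K \<subseteq> (\<Pi>\<^sub>E m\<in>{1..d}. {lo m<..<hi m}) \<Longrightarrow> set_integrable (box_measure {1..d} lo hi) K g"
  shows "integrable (box_measure {1..d} lo hi) (\<lambda>z. g z * \<phi> z)"
proof -
  obtain K where K: "compact K" "K \<subseteq> (\<Pi>\<^sub>E m\<in>{1..d}. {lo m<..<hi m})"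
    "\<And>z. z \<in> (\<Pi>\<^sub>E m\<in>{1..d}. UNIV) \<Longrightarrow> z \<notin> K \<Longrightarrow> \<phi> z = 0"
    by (rule test_fun_supportE[OF \<phi>]) simp
  have "continuous_on K \<phi>"
    using K(2) by (intro continuous_on_subset[OF test_fun_continuous[OF \<phi>]]) (auto simp: PiE_iff subset_iff)
  from compact_imp_bounded[OF compact_continuous_image[OF this K(1)]]
  obtain B where B: "\<And>z. z \<in> K \<Longrightarrow> \<bar>\<phi> z\<bar> \<le> B" by (auto simp: bounded_iff)
  show ?thesis
  proof (rule Bochner_Integration.integrable_bound)
    show "integrable (box_measure {1..d} lo hi) (\<lambda>z. B * (indicator K z *\<^sub>R g z))"
      using int[OF K(1,2)] unfolding set_integrable_def by simp
    show "(\<lambda>z. g z * \<phi> z) \<in> borel_measurable (box_measure {1..d} lo hi)"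
      using g test_fun_measurable[OF \<phi>] by simp
    have "\<bar>g z * \<phi> z\<bar> \<le> \<bar>B * (indicator K z *\<^sub>R g z)\<bar>" if z: "z \<in> space (box_measure {1..d} lo hi)" for z
    proof (cases "z \<in> K")
      case True
      have "\<bar>\<phi> z\<bar> \<le> \<bar>B\<bar>" using B[OF True] by simp
      then show ?thesis using True by (simp add: abs_mult mult.commute mult_right_mono)
    next
      case False
      then show ?thesis using K(3)[of z] z by (auto simp: space_box PiE_iff)
    qed
    then show "AE z in box_measure {1..d} lo hi. norm (g z * \<phi> z) \<le> norm (B * (indicator K z *\<^sub>R g z))"
      by (auto intro: AE_I2)
  qed
qed

text \<open>Tensors of bumps converge to the indicator of the open box and are dominated by the
  indicator of the closed one, where \<open>g\<close> is integrable. The box must stay strictly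
  inside the domain but may be empty, so arbitrary intersections of boxes are covered.\<close>

lemma integral_open_box_eq_0:
  assumes g: "g \<in> borel_measurable (box_measure {1..d} lo hi)"
    and int: "\<And>K. compact K \<Longrightarrow> K \<subseteq> (\<Pi>\<^sub>E m\<in>{1..d}. {lo m<..<hi m}) \<Longrightarrow> set_integrable (box_measure {1..d} lo hi) K g"
    and zero: "\<And>\<phi>. test_fun d lo hi \<phi> \<Longrightarrow> (\<integral>z. g z * \<phi> z \<partial>box_measure {1..d} lo hi) = 0"
    and ce: "\<And>i. i \<in> {1..d} \<Longrightarrow> lo i < c i" "\<And>i. i \<in> {1..d} \<Longrightarrow> e i < hi i"
  shows "integrable (box_measure {1..d} lo hi) (\<lambda>z. g z * etensor d (\<lambda>i. indicator {c i<..<e i}) z)"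
    and "(\<integral>z. g z * etensor d (\<lambda>i. indicator {c i<..<e i}) z \<partial>box_measure {1..d} lo hi) = 0"
proof -
  let ?M = "box_measure {1..d} lo hi" and ?K = "\<Pi>\<^sub>E m\<in>{1..d}. {c m..e m}"
  have K: "?K \<subseteq> (\<Pi>\<^sub>E m\<in>{1..d}. {lo m<..<hi m})"
    using ce by (rule PiE_interval_subset)
  have w: "integrable ?M (\<lambda>z. \<bar>indicator ?K z *\<^sub>R g z\<bar>)"
    using int[OF compact_PiE_interval K] unfolding set_integrable_def by simp
  have bound: "\<bar>g z * etensor d f z\<bar> \<le> \<bar>indicator ?K z *\<^sub>R g z\<bar>"
    if z: "z \<in> space ?M" and f: "\<And>i t. 0 \<le> f i t" "\<And>i t. f i t \<le> 1" "\<And>i t. t \<notin> {c i<..<e i} \<Longrightarrow> f i t = 0" for z f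
  proof (cases "z \<in> ?K")
    case True
    have "\<bar>etensor d f z\<bar> \<le> 1"
      unfolding etensor_def using f by (auto intro!: prod_le_1 simp: abs_prod)
    then have "\<bar>g z\<bar> * \<bar>etensor d f z\<bar> \<le> \<bar>g z\<bar> * 1" by (intro mult_left_mono) auto
    then show ?thesis using True by (simp add: abs_mult)
  next
    case False
    then obtain i where "i \<in> {1..d}" "z i \<notin> {c i..e i}" using z by (auto simp: PiE_iff space_box)
    then have "etensor d f z = 0" unfolding etensor_def by (intro prod_zero bexI[of _ i] f) auto
    then show ?thesis by simp
  qed
  have meas: "(\<lambda>z. g z * etensor d (\<lambda>i. indicator {c i<..<e i}) z) \<in> borel_measurable ?M"
    "(\<lambda>z. g z * etensor d (\<lambda>i. bump n (c i) (e i)) z) \<in> borel_measurable ?M" for n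
    using g by (intro borel_measurable_times measurable_box_etensor;
        auto intro: borel_measurable_continuous_onI smooth_gen_continuous bump_smooth)+
  show "integrable ?M (\<lambda>z. g z * etensor d (\<lambda>i. indicator {c i<..<e i}) z)"
  proof (rule Bochner_Integration.integrable_bound[OF w meas(1)])
    show "AE z in ?M. norm (g z * etensor d (\<lambda>i. indicator {c i<..<e i}) z) \<le> norm \<bar>indicator ?K z *\<^sub>R g z\<bar>"
      unfolding real_norm_def abs_idempotent by (intro AE_I2 bound) (auto simp: indicator_def)
  qed
  have "(\<lambda>n. \<integral>z. g z * etensor d (\<lambda>i. bump n (c i) (e i)) z \<partial>?M) \<longlonglongrightarrow>
      (\<integral>z. g z * etensor d (\<lambda>i. indicator {c i<..<e i}) z \<partial>?M)"
  proof (rule integral_dominated_convergence[OF meas w])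
    show "AE z in ?M. (\<lambda>n. g z * etensor d (\<lambda>i. bump n (c i) (e i)) z) \<longlonglongrightarrow> g z * etensor d (\<lambda>i. indicator {c i<..<e i}) z"
      unfolding etensor_def by (intro AE_I2 tendsto_mult tendsto_const tendsto_prod bump_tendsto)
    show "AE z in ?M. norm (g z * etensor d (\<lambda>i. bump n (c i) (e i)) z) \<le> \<bar>indicator ?K z *\<^sub>R g z\<bar>" for n
      unfolding real_norm_def by (intro AE_I2 bound bump_bounds bump_eq_0)
  qed
  moreover have "(\<integral>z. g z * etensor d (\<lambda>i. bump n (c i) (e i)) z \<partial>?M) = 0" for n
    using ce by (intro zero test_fun_etensor[of _ d c e] bump_smooth bump_eq_0) auto
  ultimately show "(\<integral>z. g z * etensor d (\<lambda>i. indicator {c i<..<e i}) z \<partial>?M) = 0"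
    by (simp add: LIMSEQ_const_iff)
qed

lemma sets_ivl:
  "sets (ivl a b) = sigma_sets {a<..<b} ((\<inter>) {a<..<b} ` range (\<lambda>(x, y). {x<..<y}))"
proof -
  have b: "sets (borel :: real measure) = sigma_sets UNIV (range (\<lambda>(x, y). {x<..<y}))"
    by (subst borel_eq_box) (simp add: sets_measure_of split_def box_real)
  have "{a<..<b} \<in> sigma_sets UNIV (range (\<lambda>(x, y). {x<..<y}))"
    unfolding b[symmetric] by simp
  then show ?thesis
    unfolding ivl_def sets_restrict_space sets_lborel b by (rule sigma_sets_Int) simp
qed

text \<open>The fundamental lemma of the calculus of variations. As \<open>g\<close> may fail to be
  integrable near the boundary, it is cut off to an inner box; integrals of the cut-off function
  vanish on product boxes and hence, by a pi-lambda argument, on all measurable sets.\<close>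

lemma AE_box_eq_0_if_test_fun_integral_eq_0:
  assumes g: "g \<in> borel_measurable (box_measure {1..d} lo hi)"
    and int: "\<And>K. compact K \<Longrightarrow> K \<subseteq> (\<Pi>\<^sub>E m\<in>{1..d}. {lo m<..<hi m}) \<Longrightarrow> set_integrable (box_measure {1..d} lo hi) K g"
    and zero: "\<And>\<phi>. test_fun d lo hi \<phi> \<Longrightarrow> (\<integral>z. g z * \<phi> z \<partial>box_measure {1..d} lo hi) = 0"
  shows "AE z in box_measure {1..d} lo hi. g z = 0"
proof -
  let ?M = "box_measure {1..d} lo hi"
  let ?D = "\<lambda>m. {lo m<..<hi m}"
  \<comment> \<open>Traces of open intervals are stable under intersection and generate the
    sigma-algebra of the factor.\<close>
  define E where "E m = (\<inter>) (?D m) ` range (\<lambda>(x::real, y). {x<..<y})" for m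
  have E_iff: "X \<in> E m \<longleftrightarrow> (\<exists>x y. X = ?D m \<inter> {x<..<y})" for X m
    unfolding E_def image_image image_iff Bex_def
    by (simp only: UNIV_I simp_thms split_paired_Ex split_conv)
  define P where "P = {Pi\<^sub>E {1..d} F | F. \<forall>m\<in>{1..d}. F m \<in> E m}"
  have D_E: "?D m \<in> E m" for m
    unfolding E_iff by blast
  have E_Pow: "E m \<subseteq> Pow (?D m)" for m unfolding E_def by auto
  have E_box: "{z \<in> (\<Pi>\<^sub>E m\<in>{1..d}. ?D m). \<forall>m\<in>{1..d}. z m \<in> F m} = Pi\<^sub>E {1..d} F" if "F \<in> Pi {1..d} E" for F
  proof -
    have "F m \<subseteq> ?D m" if "m \<in> {1..d}" for m 
      using subsetD[OF E_Pow Pi_mem[OF \<open>F \<in> Pi {1..d} E\<close> that]] by simp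
    then show ?thesis unfolding set_eq_iff mem_Collect_eq PiE_iff by blast
  qed
  \<comment> \<open>The shape expected by \<open>sets_PiM_sigma\<close>, with the index set covered
    by the single block \<open>{1..d}\<close>.\<close>
  have P_eq: "P = {{z \<in> (\<Pi>\<^sub>E m\<in>{1..d}. ?D m). \<forall>m\<in>j. z m \<in> F m} | F j. j \<in> {{1..d}} \<and> F \<in> Pi j E}"
    (is "P = ?P")
  proof (intro equalityI subsetI)
    fix A assume "A \<in> P"
    then obtain F where F: "A = Pi\<^sub>E {1..d} F" "F \<in> Pi {1..d} E" unfolding P_def by blast
    show "A \<in> ?P" unfolding F(1) E_box[OF F(2), symmetric] using F(2) by blast
  next
    fix A assume "A \<in> ?P"
    then obtain F where F: "A = {z \<in> (\<Pi>\<^sub>E m\<in>{1..d}. ?D m). \<forall>m\<in>{1..d}. z m \<in> F m}" "F \<in> Pi {1..d} E" by blast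
    show "A \<in> P" unfolding F(1) E_box[OF F(2)] P_def using F(2) by blast
  qed
  have P_Pow: "P \<subseteq> Pow (space ?M)"
    unfolding P_eq space_box by auto
  have "sets ?M = sets (\<Pi>\<^sub>M m\<in>{1..d}. sigma (?D m) (E m))"
    unfolding box_measure_def
    by (intro sets_PiM_cong refl, subst sets_measure_of[OF E_Pow]) (simp add: sets_ivl E_def)
  also have "\<dots> = sets (sigma (\<Pi>\<^sub>E m\<in>{1..d}. ?D m) P)"
    unfolding P_eq
  proof (rule sets_PiM_sigma)
    show "\<exists>S\<subseteq>E m. countable S \<and> ?D m = \<Union>S" for m
      using D_E[of m] by (intro exI[of _ "{?D m}"]) auto
  qed (use E_Pow in auto)
  also have "\<dots> = sigma_sets (space ?M) P"
    using P_Pow unfolding space_box by (rule sets_measure_of)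
  finally have setsM: "sets ?M = sigma_sets (space ?M) P" .
  have Int_P: "Int_stable P"
  proof (rule Int_stableI)
    fix A B assume "A \<in> P" "B \<in> P"
    then obtain F F' where F: "A = Pi\<^sub>E {1..d} F" "\<forall>m\<in>{1..d}. F m \<in> E m"
      and F': "B = Pi\<^sub>E {1..d} F'" "\<forall>m\<in>{1..d}. F' m \<in> E m" unfolding P_def by blast
    have "X \<inter> Y \<in> E m" if XY: "X \<in> E m" "Y \<in> E m" for X Y m
    proof -
      obtain x y x' y' where "X = ?D m \<inter> {x<..<y}" "Y = ?D m \<inter> {x'<..<y'}"
        using XY unfolding E_iff by blast
      then have "X \<inter> Y = ?D m \<inter> {max x x'<..<min y y'}" by auto
      then show ?thesis unfolding E_iff by blast
    qed
    then show "A \<inter> B \<in> P"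
      unfolding F(1) F'(1) PiE_Int P_def using F(2) F'(2) by blast
  qed
  \<comment> \<open>The inner boxes have margin 1/(n+1) and exhaust the domain as \<open>n\<close>
    grows.\<close>
  define G where "G n z = g z * etensor d (\<lambda>i. indicator {lo i + inverse (real (Suc n))<..<hi i - inverse (real (Suc n))}) z" for n z
  have G: "AE z in ?M. G n z = 0" for n
  proof (rule density_unique_real)
    let ?\<delta> = "inverse (real (Suc n))"
    show iG: "integrable ?M (G n)"
      unfolding G_def by (rule integral_open_box_eq_0(1)[OF g int zero]) auto
    show "integrable ?M (\<lambda>z. 0)" by simp
    have basic: "(LINT z:A|?M. G n z) = 0" if A: "A \<in> P" for A
    proof -
      obtain F where F: "A = Pi\<^sub>E {1..d} F" "\<forall>m\<in>{1..d}. F m \<in> E m" using A unfolding P_def by blast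
      from F(2) have "\<forall>m\<in>{1..d}. \<exists>x y. F m = ?D m \<inter> {x<..<y}" unfolding E_iff .
      then obtain x y where xy: "\<And>m. m \<in> {1..d} \<Longrightarrow> F m = ?D m \<inter> {x m<..<y m}" by metis
      have "(LINT z:A|?M. G n z) = (\<integral>z. g z * etensor d (\<lambda>i. indicator {max (x i) (lo i + ?\<delta>)<..<min (y i) (hi i - ?\<delta>)}) z \<partial>?M)"
        unfolding set_lebesgue_integral_def
      proof (rule Bochner_Integration.integral_cong[OF refl])
        fix z assume z: "z \<in> space ?M"
        have "indicator A z = etensor d (\<lambda>i. indicator {x i<..<y i}) z"
        proof (cases "z \<in> A")
          case True
          then have "etensor d (\<lambda>i. indicator {x i<..<y i}) z = (1::real)"
            unfolding etensor_def F using xy by (intro prod.neutral) (auto simp: PiE_iff)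
          then show ?thesis using True by simp
        next
          case False
          then obtain i where "i \<in> {1..d}" "z i \<notin> {x i<..<y i}"
            using z xy unfolding F by (auto simp: PiE_iff space_box)
          then have "etensor d (\<lambda>i. indicator {x i<..<y i}) z = (0::real)"
            unfolding etensor_def by (intro prod_zero bexI[of _ i]) auto
          then show ?thesis using False by simp
        qed
        then have "indicator A z *\<^sub>R G n z = g z * (etensor d (\<lambda>i. indicator {x i<..<y i}) z
            * etensor d (\<lambda>i. indicator {lo i + ?\<delta><..<hi i - ?\<delta>}) z)"
          by (simp add: G_def)
        also have "etensor d (\<lambda>i. indicator {x i<..<y i}) z * etensor d (\<lambda>i. indicator {lo i + ?\<delta><..<hi i - ?\<delta>}) z
          = etensor d (\<lambda>i. indicator {max (x i) (lo i + ?\<delta>)<..<min (y i) (hi i - ?\<delta>)}) z"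
          unfolding etensor_def prod.distrib[symmetric]
          by (intro prod.cong refl) (auto simp: indicator_def)
        finally show "indicator A z *\<^sub>R G n z = g z *
          etensor d (\<lambda>i. indicator {max (x i) (lo i + ?\<delta>)<..<min (y i) (hi i - ?\<delta>)}) z" .
      qed
      \<comment> \<open>The maximum and minimum with the shrunken endpoints keep the box strictly
        inside the domain for all \<open>x\<close> and \<open>y\<close>.\<close>
      also have "\<dots> = 0"
        by (rule integral_open_box_eq_0(2)[OF g int zero]) (auto simp: less_max_iff_disj min_less_iff_disj)
      finally show ?thesis .
    qed
    \<comment> \<open>The complement step of the induction uses that the integral over the whole
      space vanishes.\<close>
    have space_P: "space ?M \<in> P" unfolding P_def space_box using D_E by blast
    fix A assume A: "A \<in> sets ?M"
    have iA: "set_integrable ?M A (G n)" if "A \<in> sets ?M" for A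
      using iG that unfolding set_integrable_def by (rule integrable_mult_indicator[rotated])
    from A have "(LINT z:A|?M. G n z) = 0"
      unfolding setsM
    proof (induction rule: sigma_sets_induct_disjoint[OF Int_P P_Pow, consumes 1, case_names basic empty compl union])
      case (compl A)
      then have "A \<in> sets ?M" unfolding setsM by simp
      moreover have "A \<union> (space ?M - A) = space ?M"
        using sets.sets_into_space[OF \<open>A \<in> sets ?M\<close>] by auto
      ultimately show ?case
        using compl.IH set_integral_Un[of A "space ?M - A" ?M "G n"] iA basic[OF space_P] by auto
    next
      case (union A)
      then have "\<And>i. A i \<in> sets ?M" unfolding setsM by auto
      moreover have "set_integrable ?M (\<Union>i. A i) (G n)"
        using calculation by (intro iA) auto
      ultimately have "(LINT z:(\<Union>i. A i)|?M. G n z) = (\<Sum>i. LINT z:A i|?M. G n z)"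
        using union.hyps(1) by (intro lebesgue_integral_countable_add) (auto simp: disjoint_family_on_def)
      then show ?case using union.IH by simp
    qed (use basic in \<open>auto simp: set_lebesgue_integral_def\<close>)
    then show "(LINT z:A|?M. G n z) = (LINT z:A|?M. 0)" by (simp add: set_lebesgue_integral_def)
  qed
  then have "AE z in ?M. \<forall>n. G n z = 0" by (simp add: AE_all_countable)
  then show ?thesis
  proof (rule AE_mp, intro AE_I2 impI)
    fix z assume z: "z \<in> space ?M" and G0: "\<forall>n. G n z = 0"
    have "\<forall>\<^sub>F n in sequentially. z i \<in> {lo i + inverse (real (Suc n))<..<hi i - inverse (real (Suc n))}"
      if i: "i \<in> {1..d}" for i
    proof -
      have "0 < min (z i - lo i) (hi i - z i)" using z i by (auto simp: space_box PiE_iff)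
      from order_tendstoD(2)[OF LIMSEQ_inverse_real_of_nat this]
      show ?thesis by eventually_elim auto
    qed
    then have "\<forall>\<^sub>F n in sequentially. \<forall>i\<in>{1..d}. z i \<in> {lo i + inverse (real (Suc n))<..<hi i - inverse (real (Suc n))}"
      by (intro eventually_ball_finite) auto
    then obtain n where "\<forall>i\<in>{1..d}. z i \<in> {lo i + inverse (real (Suc n))<..<hi i - inverse (real (Suc n))}"
      using eventually_happens'[OF sequentially_bot] by blast
    then have "etensor d (\<lambda>i. indicator {lo i + inverse (real (Suc n))<..<hi i - inverse (real (Suc n))}) z = (1::real)"
      unfolding etensor_def by (intro prod.neutral) auto
    then show "g z = 0" using G0[rule_format, of n] by (simp add: G_def)
  qed
qed

lemma has_weak_deriv_integral:
  assumes "has_weak_deriv d lo hi \<nu> f g" "test_fun d lo hi \<phi>"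
  shows "(\<integral>z. f z * mpartial d \<nu> \<phi> z \<partial>box_measure {1..d} lo hi) =
    (- 1) ^ (\<Sum>m\<in>{1..d}. \<nu> m) * (\<integral>z. g z * \<phi> z \<partial>box_measure {1..d} lo hi)"
  using assms unfolding has_weak_deriv_def Let_def by blast

lemma has_weak_deriv_unique:
  assumes g: "has_weak_deriv d lo hi \<nu> f g" and h: "has_weak_deriv d lo hi \<nu> f h"
  shows "AE z in box_measure {1..d} lo hi. g z = h z"
proof -
  let ?M = "box_measure {1..d} lo hi"
  have m: "g \<in> borel_measurable ?M" "h \<in> borel_measurable ?M"
    using g h by (auto simp: has_weak_deriv_def Let_def)
  have i: "set_integrable ?M K g" "set_integrable ?M K h"
    if "compact K" "K \<subseteq> (\<Pi>\<^sub>E m\<in>{1..d}. {lo m<..<hi m})" for K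
    using g h that unfolding has_weak_deriv_def Let_def by blast+
  have "AE z in ?M. g z - h z = 0"
  proof (rule AE_box_eq_0_if_test_fun_integral_eq_0)
    fix \<phi> assume \<phi>: "test_fun d lo hi \<phi>"
    have "(- 1) ^ (\<Sum>m\<in>{1..d}. \<nu> m) * (\<integral>z. g z * \<phi> z \<partial>?M) = (- 1) ^ (\<Sum>m\<in>{1..d}. \<nu> m) * (\<integral>z. h z * \<phi> z \<partial>?M)"
      using has_weak_deriv_integral[OF g \<phi>] has_weak_deriv_integral[OF h \<phi>] by simp
    then have "(\<integral>z. g z * \<phi> z \<partial>?M) = (\<integral>z. h z * \<phi> z \<partial>?M)" by simp
    then show "(\<integral>z. (g z - h z) * \<phi> z \<partial>?M) = 0"
      using integrable_mult_test_fun[OF \<phi> m(1) i(1)] integrable_mult_test_fun[OF \<phi> m(2) i(2)]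
      by (simp add: left_diff_distrib)
  qed (use m i in \<open>auto intro: set_integral_diff\<close>)
  then show ?thesis by simp
qed

section \<open>Weak derivatives of elementary tensors\<close>

text \<open>The complement of \<open>K\<close> is open, so the coordinate line through
  \<open>z\<close> stays outside \<open>K\<close> near \<open>z m\<close>. Supports therefore do not
  grow under differentiation.\<close>

lemma partial_eq_0_outside:
  assumes K: "compact K" and m: "m \<in> {1..d}" and z: "z \<in> (\<Pi>\<^sub>E m\<in>{1..d}. UNIV)" "z \<notin> K"
    and \<psi>: "\<And>z. z \<in> (\<Pi>\<^sub>E m\<in>{1..d}. UNIV) \<Longrightarrow> z \<notin> K \<Longrightarrow> \<psi> z = 0"
  shows "partial m \<psi> z = 0"
proof -
  have "continuous_on UNIV (\<lambda>t::real. z(m := t))"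
  proof (rule continuous_on_coordinatewise_then_product)
    show "continuous_on UNIV (\<lambda>t. (z(m := t)) i)" for i by (cases "i = m") auto
  qed
  then have "open ((\<lambda>t. z(m := t)) -` (- K))"
    using compact_imp_closed[OF K] by (intro open_vimage) auto
  moreover have "z m \<in> (\<lambda>t. z(m := t)) -` (- K)" using z by simp
  ultimately have "\<forall>\<^sub>F t in nhds (z m). t \<in> (\<lambda>t. z(m := t)) -` (- K)"
    by (rule eventually_nhds_in_open)
  then have "\<forall>\<^sub>F t in nhds (z m). \<psi> (z(m := t)) = 0"
    by eventually_elim (use z m in \<open>auto intro!: \<psi> simp: PiE_iff extensional_def\<close>)
  moreover have "((\<lambda>t. 0::real) has_real_derivative 0) (at (z m))" by simp
  ultimately have "((\<lambda>t. \<psi> (z(m := t))) has_real_derivative 0) (at (z m))"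
    by (subst DERIV_cong_ev[OF refl _ refl]) auto
  then show ?thesis unfolding partial_def by (rule DERIV_imp_deriv)
qed

lemma test_fun_differentiable:
  assumes "test_fun d lo hi \<phi>" "set ms \<subseteq> {1..d}" "m \<in> {1..d}" "z \<in> (\<Pi>\<^sub>E m\<in>{1..d}. UNIV)"
  shows "(\<lambda>t. foldr partial ms \<phi> (z(m := t))) differentiable (at (z m))"
  by (rule assms(1)[unfolded test_fun_def, THEN conjunct1, THEN spec, THEN mp, OF assms(2),
        THEN conjunct2, THEN bspec, OF assms(3), THEN bspec, OF assms(4)])

lemma test_fun_foldr_partial:
  assumes \<phi>: "test_fun d lo hi \<phi>" and ms: "set ms \<subseteq> {1..d}"
  shows "test_fun d lo hi (foldr partial ms \<phi>)"
  unfolding test_fun_def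
proof (intro conjI allI impI ballI)
  fix ls assume ls: "set ls \<subseteq> {1..d}"
  have eq: "foldr partial ls (foldr partial ms \<phi>) = foldr partial (ls @ ms) \<phi>" by simp
  have lms: "set (ls @ ms) \<subseteq> {1..d}" using ls ms by simp
  show "continuous_on (\<Pi>\<^sub>E m\<in>{1..d}. UNIV) (foldr partial ls (foldr partial ms \<phi>))"
    unfolding eq by (rule test_fun_foldr_continuous[OF \<phi> lms])
  fix m z assume "m \<in> {1..d}" "z \<in> {1..d} \<rightarrow>\<^sub>E (UNIV :: real set)"
  then show "(\<lambda>t. foldr partial ls (foldr partial ms \<phi>) (z(m := t))) differentiable (at (z m))"
    unfolding eq by (rule test_fun_differentiable[OF \<phi> lms])
next
  obtain K where K: "compact K" "K \<subseteq> (\<Pi>\<^sub>E m\<in>{1..d}. {lo m<..<hi m})"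
    and K0: "\<And>z. z \<in> (\<Pi>\<^sub>E m\<in>{1..d}. UNIV) \<Longrightarrow> z \<notin> K \<Longrightarrow> \<phi> z = 0"
    by (rule test_fun_supportE[OF \<phi>]) simp
  have "foldr partial ms \<phi> z = 0" if "z \<in> (\<Pi>\<^sub>E m\<in>{1..d}. UNIV)" "z \<notin> K" for z
    using ms that
  proof (induction ms arbitrary: z)
    case (Cons m ms)
    then show ?case by (auto intro: partial_eq_0_outside[OF K(1)])
  qed (simp add: K0)
  then show "\<exists>K. compact K \<and> K \<subseteq> (\<Pi>\<^sub>E m\<in>{1..d}. {lo m<..<hi m}) \<and>
      (\<forall>z\<in>(\<Pi>\<^sub>E m\<in>{1..d}. UNIV). z \<notin> K \<longrightarrow> foldr partial ms \<phi> z = 0)"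
    using K by (intro exI[of _ K] conjI ballI impI)
qed

lemma funpow_partial_eq_foldr: "(partial m ^^ k) \<phi> = foldr partial (replicate k m) \<phi>"
  by (induction k) simp_all

lemma test_fun_funpow_partial:
  assumes "test_fun d lo hi \<phi>" "m \<in> {1..d}"
  shows "test_fun d lo hi ((partial m ^^ k) \<phi>)"
  unfolding funpow_partial_eq_foldr using assms by (intro test_fun_foldr_partial) auto

lemma test_fun_foldr_funpow_partial:
  assumes "test_fun d lo hi \<phi>" "set ms \<subseteq> {1..d}"
  shows "test_fun d lo hi (foldr (\<lambda>m. partial m ^^ \<nu> m) ms \<phi>)"
  using assms by (induction ms) (auto intro: test_fun_funpow_partial)

section \<open>One-dimensional sections and integration by parts\<close>

lemma funpow_deriv_section: "(deriv ^^ k) (\<lambda>t. \<phi> (z(m := t))) = (\<lambda>t. (partial m ^^ k) \<phi> (z(m := t)))"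
proof (induction k)
  case (Suc k)
  have "partial m \<psi> (z(m := t)) = deriv (\<lambda>s. \<psi> (z(m := s))) t" for \<psi> t
    unfolding partial_def fun_upd_upd fun_upd_same ..
  with Suc show ?case by (simp del: fun_upd_apply)
qed simp

text \<open>The projection of the support to coordinate \<open>m\<close> is compact in the open
  interval and serves all sections at once. Higher derivatives of a section are sections of partial
  derivatives.\<close>

lemma test_fun1_section:
  assumes \<phi>: "test_fun d lo hi \<phi>" and m: "m \<in> {1..d}" and z: "z \<in> (\<Pi>\<^sub>E m\<in>{1..d}. UNIV)"
  shows "test_fun1 (lo m) (hi m) (\<lambda>t. \<phi> (z(m := t)))"
  unfolding test_fun1_def
proof (intro conjI allI)
  have ext: "z(m := t) \<in> (\<Pi>\<^sub>E m\<in>{1..d}. UNIV)" for t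
    using z m by (auto simp: PiE_iff extensional_def)
  show "(deriv ^^ n) (\<lambda>t. \<phi> (z(m := t))) differentiable (at t)" for n t
  proof -
    have "set (replicate n m) \<subseteq> {1..d}" using m by auto
    from test_fun_differentiable[OF \<phi> this m ext[of t]]
    show ?thesis unfolding funpow_deriv_section funpow_partial_eq_foldr by simp
  qed
  obtain K where K: "compact K" "K \<subseteq> (\<Pi>\<^sub>E m\<in>{1..d}. {lo m<..<hi m})"
    and K0: "\<And>z. z \<in> (\<Pi>\<^sub>E m\<in>{1..d}. UNIV) \<Longrightarrow> z \<notin> K \<Longrightarrow> \<phi> z = 0"
    by (rule test_fun_supportE[OF \<phi>]) simp
  have "compact ((\<lambda>z. z m) ` K)"
    by (intro compact_continuous_image K continuous_on_subset[OF continuous_on_product_coordinates]) auto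
  moreover have "(\<lambda>z. z m) ` K \<subseteq> {lo m<..<hi m}"
    using K(2) m by (auto simp: PiE_iff subset_iff)
  moreover have "\<phi> (z(m := t)) = 0" if "t \<notin> (\<lambda>z. z m) ` K" for t
    using that by (intro K0 ext) (auto simp: image_iff)
  ultimately show "\<exists>K. compact K \<and> K \<subseteq> {lo m<..<hi m} \<and> (\<forall>t. t \<notin> K \<longrightarrow> \<phi> (z(m := t)) = 0)"
    by blast
qed

lemma set_integrable_box_compact:
  fixes f :: "_ \<Rightarrow> real"
  assumes "integrable (box_measure J lo hi) f" "compact K" "K \<subseteq> (\<Pi>\<^sub>E m\<in>J. {lo m<..<hi m})"
  shows "set_integrable (box_measure J lo hi) K f"
proof -
  have "(\<lambda>z. z) -` K \<inter> space (box_measure J lo hi) \<in> sets (box_measure J lo hi)"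
    using compact_imp_closed[OF assms(2)] by (intro measurable_sets[OF measurable_box_borel]) auto
  also have "(\<lambda>z. z) -` K \<inter> space (box_measure J lo hi) = K"
    using assms(3) by (auto simp: space_box)
  finally show ?thesis
    using assms(1) unfolding set_integrable_def by (rule integrable_mult_indicator)
qed

lemma integrable_etensor:
  assumes "\<And>m. m \<in> {1..d} \<Longrightarrow> integrable (ivl (lo m) (hi m)) (w m)"
  shows "integrable (box_measure {1..d} lo hi) (etensor d w)"
  unfolding box_measure_def etensor_def[abs_def] using assms by (intro ivl.product_integrable_prod) auto

lemma integrable_etensor_mult_test_fun:
  assumes "\<And>m. m \<in> {1..d} \<Longrightarrow> integrable (ivl (lo m) (hi m)) (w m)" "test_fun d lo hi \<phi>"
  shows "integrable (box_measure {1..d} lo hi) (\<lambda>z. etensor d w z * \<phi> z)"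
  using integrable_etensor[OF assms(1)] assms(2)
  by (intro integrable_mult_test_fun set_integrable_box_compact) auto

text \<open>Fubini isolates coordinate \<open>m\<close>. In the inner integral the remaining factors
  are a constant and the test function becomes a section, so the definition of the one-dimensional
  weak derivative applies directly.\<close>

lemma etensor_integrate_by_parts:
  assumes \<phi>: "test_fun d lo hi \<phi>" and m: "m \<in> {1..d}"
    and w: "\<And>i. i \<in> {1..d} \<Longrightarrow> integrable (ivl (lo i) (hi i)) (w i)"
    and g: "integrable (ivl (lo m) (hi m)) g" and wg: "has_weak_deriv1 (lo m) (hi m) k (w m) g"
  shows "(\<integral>z. etensor d w z * (partial m ^^ k) \<phi> z \<partial>box_measure {1..d} lo hi)
    = (- 1) ^ k * (\<integral>z. etensor d (w(m := g)) z * \<phi> z \<partial>box_measure {1..d} lo hi)"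
proof -
  let ?J = "{1..d} - {m}"
  have J: "finite ?J" "m \<notin> ?J" "insert m ?J = {1..d}" using m by auto
  have fubini: "(\<integral>z. f z \<partial>box_measure {1..d} lo hi)
      = (\<integral>x. (\<integral>y. f (x(m := y)) \<partial>ivl (lo m) (hi m)) \<partial>box_measure ?J lo hi)"
    if "integrable (box_measure {1..d} lo hi) f" for f :: "(nat \<Rightarrow> real) \<Rightarrow> real"
    using ivl.product_integral_insert[OF J(1,2), of lo hi f] that unfolding J(3) box_measure_def by simp
  have wg_int: "integrable (ivl (lo i) (hi i)) ((w(m := g)) i)" if "i \<in> {1..d}" for i
    using w g that by auto
  have inner: "(\<integral>y. etensor d w (x(m := y)) * (partial m ^^ k) \<phi> (x(m := y)) \<partial>ivl (lo m) (hi m))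
      = (- 1) ^ k * (\<integral>y. etensor d (w(m := g)) (x(m := y)) * \<phi> (x(m := y)) \<partial>ivl (lo m) (hi m))"
    if x: "x \<in> space (box_measure ?J lo hi)" for x
  proof -
    define C where "C = (\<Prod>i\<in>?J. w i (x i))"
    have C': "(\<Prod>i\<in>?J. (w(m := g)) i (x i)) = C"
      unfolding C_def by (intro prod.cong) auto
    \<comment> \<open>The value 0 is a placeholder that makes the point extensional on
      \<open>{1..d}\<close>; the section overwrites it.\<close>
    have "x(m := 0) \<in> (\<Pi>\<^sub>E m\<in>{1..d}. UNIV)"
      using x m by (auto simp: space_box PiE_iff extensional_def)
    from test_fun1_section[OF \<phi> m this]
    have tf: "test_fun1 (lo m) (hi m) (\<lambda>t. \<phi> (x(m := t)))" by simp
    have "(\<integral>y. etensor d w (x(m := y)) * (partial m ^^ k) \<phi> (x(m := y)) \<partial>ivl (lo m) (hi m))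
        = C * (\<integral>y. w m y * (deriv ^^ k) (\<lambda>t. \<phi> (x(m := t))) y \<partial>ivl (lo m) (hi m))"
      unfolding etensor_upd[OF m] C_def[symmetric] funpow_deriv_section
      by (subst integral_mult_right_zero[symmetric]) (simp add: mult_ac)
    also have "(\<integral>y. w m y * (deriv ^^ k) (\<lambda>t. \<phi> (x(m := t))) y \<partial>ivl (lo m) (hi m))
        = (- 1) ^ k * (\<integral>y. g y * \<phi> (x(m := y)) \<partial>ivl (lo m) (hi m))"
      using wg tf unfolding has_weak_deriv1_def by blast
    also have "C * ((- 1) ^ k * (\<integral>y. g y * \<phi> (x(m := y)) \<partial>ivl (lo m) (hi m)))
        = (- 1) ^ k * (\<integral>y. etensor d (w(m := g)) (x(m := y)) * \<phi> (x(m := y)) \<partial>ivl (lo m) (hi m))"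
      unfolding etensor_upd[OF m] C' fun_upd_same mult.assoc[of _ C] mult.left_commute[of C]
      by (subst mult.left_commute, subst integral_mult_right_zero[symmetric]) (simp add: mult_ac)
    finally show ?thesis .
  qed
  have int: "integrable (box_measure {1..d} lo hi) (\<lambda>z. etensor d w z * (partial m ^^ k) \<phi> z)"
    "integrable (box_measure {1..d} lo hi) (\<lambda>z. etensor d (w(m := g)) z * \<phi> z)"
    by (intro integrable_etensor_mult_test_fun w wg_int test_fun_funpow_partial \<phi> m; assumption)+
  show ?thesis
    unfolding int[THEN fubini]
    by (subst integral_mult_right_zero[symmetric]) (rule Bochner_Integration.integral_cong[OF refl inner])
qed

text \<open>The head of the list is the outermost derivative and is removed first. The arbitrary
  family \<open>u\<close> lets the induction remember the factors that have already been
  differentiated.\<close>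

lemma etensor_integrate_by_parts_list:
  assumes \<phi>: "test_fun d lo hi \<phi>" and "distinct ms" "set ms \<subseteq> {1..d}"
    and v: "\<And>i. i \<in> {1..d} \<Longrightarrow> integrable (ivl (lo i) (hi i)) (v i)"
    and g: "\<And>i. i \<in> {1..d} \<Longrightarrow> integrable (ivl (lo i) (hi i)) (g i)"
    and vg: "\<And>i. i \<in> {1..d} \<Longrightarrow> has_weak_deriv1 (lo i) (hi i) (\<nu> i) (v i) (g i)"
    and "\<And>i. i \<in> {1..d} \<Longrightarrow> integrable (ivl (lo i) (hi i)) (u i)"
  shows "(\<integral>z. etensor d (\<lambda>i. if i \<in> set ms then v i else u i) z * foldr (\<lambda>m. partial m ^^ \<nu> m) ms \<phi> z \<partial>box_measure {1..d} lo hi)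
    = (- 1) ^ (\<Sum>m\<in>set ms. \<nu> m) * (\<integral>z. etensor d (\<lambda>i. if i \<in> set ms then g i else u i) z * \<phi> z \<partial>box_measure {1..d} lo hi)"
  using assms(2,3,7)
proof (induction ms arbitrary: u)
  case (Cons m ms)
  let ?w = "\<lambda>i. if i \<in> set (m # ms) then v i else u i"
  let ?\<psi> = "foldr (\<lambda>m. partial m ^^ \<nu> m) ms \<phi>"
  have m: "m \<in> {1..d}" using Cons.prems by simp
  have \<psi>: "test_fun d lo hi ?\<psi>" using Cons.prems by (intro test_fun_foldr_funpow_partial[OF \<phi>]) auto
  have w: "integrable (ivl (lo i) (hi i)) (?w i)" if "i \<in> {1..d}" for i
    using v[OF that] Cons.prems(3)[OF that] by simp
  have wm: "has_weak_deriv1 (lo m) (hi m) (\<nu> m) (?w m) (g m)" using vg[OF m] by simp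
  have "(\<integral>z. etensor d ?w z * foldr (\<lambda>m. partial m ^^ \<nu> m) (m # ms) \<phi> z \<partial>box_measure {1..d} lo hi)
    = (- 1) ^ \<nu> m * (\<integral>z. etensor d (?w(m := g m)) z * ?\<psi> z \<partial>box_measure {1..d} lo hi)"
    using etensor_integrate_by_parts[where w="?w", OF \<psi> m w g[OF m] wm] by simp
  \<comment> \<open>Distinctness of the list matters here: \<open>m\<close> does not recur in
    \<open>ms\<close>, so its new factor is read from \<open>u\<close>.\<close>
  also have "?w(m := g m) = (\<lambda>i. if i \<in> set ms then v i else (u(m := g m)) i)"
    using Cons.prems by (auto simp: fun_eq_iff)
  also have "(\<integral>z. etensor d (\<lambda>i. if i \<in> set ms then v i else (u(m := g m)) i) z * ?\<psi> z \<partial>box_measure {1..d} lo hi)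
    = (- 1) ^ (\<Sum>m\<in>set ms. \<nu> m) * (\<integral>z. etensor d (\<lambda>i. if i \<in> set ms then g i else (u(m := g m)) i) z * \<phi> z \<partial>box_measure {1..d} lo hi)"
    using Cons.prems g by (intro Cons.IH) auto
  also have "(\<lambda>i. if i \<in> set ms then g i else (u(m := g m)) i) = (\<lambda>i. if i \<in> set (m # ms) then g i else u i)"
    by (auto simp: fun_eq_iff)
  finally show ?case using Cons.prems by (simp add: power_add)
qed simp

lemma etensor_cong:
  assumes "\<And>m. m \<in> {1..d} \<Longrightarrow> v m = w m"
  shows "etensor d v = etensor d w"
  unfolding etensor_def using assms by (intro ext prod.cong) auto

lemma has_weak_deriv_etensor:
  assumes v: "\<And>i. i \<in> {1..d} \<Longrightarrow> integrable (ivl (lo i) (hi i)) (v i)"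
    and g: "\<And>i. i \<in> {1..d} \<Longrightarrow> integrable (ivl (lo i) (hi i)) (g i)"
    and vg: "\<And>i. i \<in> {1..d} \<Longrightarrow> has_weak_deriv1 (lo i) (hi i) (\<nu> i) (v i) (g i)"
  shows "has_weak_deriv d lo hi \<nu> (etensor d v) (etensor d g)"
  unfolding has_weak_deriv_def Let_def
proof (intro conjI allI impI; (elim conjE)?)
  note int = integrable_etensor[OF v] integrable_etensor[OF g]
  show "etensor d v \<in> borel_measurable (box_measure {1..d} lo hi)"
    "etensor d g \<in> borel_measurable (box_measure {1..d} lo hi)"
    using int by (auto intro: borel_measurable_integrable)
  show "set_integrable (box_measure {1..d} lo hi) K (etensor d v)"
    "set_integrable (box_measure {1..d} lo hi) K (etensor d g)"
    if "compact K" "K \<subseteq> (\<Pi>\<^sub>E m\<in>{1..d}. {lo m<..<hi m})" for K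
    using int that by (auto intro: set_integrable_box_compact)
  fix \<phi> assume \<phi>: "test_fun d lo hi \<phi>"
  have set: "set [1..<Suc d] = {1..d}" by auto
  \<comment> \<open>Once all coordinates are listed, the filler family, taken to be
    \<open>v\<close>, is never reached.\<close>
  have e: "etensor d (\<lambda>i. if i \<in> {1..d} then f i else v i) = etensor d f" for f
    by (rule etensor_cong) simp
  show "(\<integral>z. etensor d v z * mpartial d \<nu> \<phi> z \<partial>box_measure {1..d} lo hi)
    = (- 1) ^ (\<Sum>m\<in>{1..d}. \<nu> m) * (\<integral>z. etensor d g z * \<phi> z \<partial>box_measure {1..d} lo hi)"
    using etensor_integrate_by_parts_list[OF \<phi> distinct_upt, of 1 "Suc d" v g \<nu> v] v g vg
    unfolding set mpartial_def e by blast
qed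

section \<open>Separable differential operators\<close>

lemma bounded_op_mult_continuous:
  assumes T: "bounded_op X (L2 (ivl a b)) T" and f: "continuous_on {a..b} f"
  shows "bounded_op X (L2 (ivl a b)) (\<lambda>h t. f t * T h t)"
proof -
  have "bounded (f ` {a..b})" by (intro compact_imp_bounded compact_continuous_image f) simp
  then obtain B where B: "\<And>t. t \<in> {a..b} \<Longrightarrow> \<bar>f t\<bar> \<le> B" unfolding bounded_iff by force
  have "continuous_on {a<..<b} f" using f by (rule continuous_on_subset) auto
  then have "f \<in> borel_measurable (restrict_space borel {a<..<b})"
    by (rule borel_measurable_continuous_on_restrict)
  then have fm: "f \<in> borel_measurable (ivl a b)"
    unfolding ivl_def by (simp add: measurable_cong_sets sets_restrict_space cong: measurable_cong_sets)
  have sq: "(f t * y)\<^sup>2 \<le> B\<^sup>2 * y\<^sup>2" if "t \<in> space (ivl a b)" for t y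
  proof -
    have "\<bar>f t\<bar> \<le> \<bar>B\<bar>" using B[of t] that by auto
    then have "(f t)\<^sup>2 \<le> B\<^sup>2" by (simp add: abs_le_square_iff)
    then show ?thesis by (simp add: power_mult_distrib mult_right_mono)
  qed
  have *: "(\<lambda>t. f t * g t) \<in> elems (L2 (ivl a b)) \<and> nrm (L2 (ivl a b)) (\<lambda>t. f t * g t) \<le> \<bar>B\<bar> * nrm (L2 (ivl a b)) g"
    if g: "g \<in> elems (L2 (ivl a b))" for g
  proof
    have gm: "g \<in> borel_measurable (ivl a b)" and gi: "integrable (ivl a b) (\<lambda>t. B\<^sup>2 * (g t)\<^sup>2)"
      using g by (auto simp: elems_L2)
    have i: "integrable (ivl a b) (\<lambda>t. (f t * g t)\<^sup>2)"
    proof (rule Bochner_Integration.integrable_bound[OF gi])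
      show "(\<lambda>t. (f t * g t)\<^sup>2) \<in> borel_measurable (ivl a b)" using fm gm by measurable
      show "AE t in ivl a b. norm ((f t * g t)\<^sup>2) \<le> norm (B\<^sup>2 * (g t)\<^sup>2)"
        by (rule AE_I2) (use sq in simp)
    qed
    show "(\<lambda>t. f t * g t) \<in> elems (L2 (ivl a b))" using i fm gm by (auto simp: elems_L2)
    have "(\<integral>t. (f t * g t)\<^sup>2 \<partial>ivl a b) \<le> (\<integral>t. B\<^sup>2 * (g t)\<^sup>2 \<partial>ivl a b)"
      by (rule integral_mono[OF i gi]) (rule sq)
    then have "sqrt (\<integral>t. (f t * g t)\<^sup>2 \<partial>ivl a b) \<le> sqrt (B\<^sup>2 * (\<integral>t. (g t)\<^sup>2 \<partial>ivl a b))"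
      by simp
    then show "nrm (L2 (ivl a b)) (\<lambda>t. f t * g t) \<le> \<bar>B\<bar> * nrm (L2 (ivl a b)) g"
      by (simp add: nrm_def ip_L2 power2_eq_square real_sqrt_mult)
  qed
  obtain C where C: "\<And>h. h \<in> elems X \<Longrightarrow> nrm (L2 (ivl a b)) (T h) \<le> C * nrm X h"
    using T unfolding bounded_op_def by blast
  show ?thesis
    unfolding bounded_op_def
  proof (intro conjI ballI allI exI)
    show "(\<lambda>t. f t * T h t) \<in> elems (L2 (ivl a b))" if "h \<in> elems X" for h
      using *[OF bounded_op_elems[OF T that]] by blast
    show "nrm (L2 (ivl a b)) (\<lambda>t. f t * T h t) \<le> (\<bar>B\<bar> * C) * nrm X h" if "h \<in> elems X" for h
      using *[OF bounded_op_elems[OF T that]] mult_left_mono[OF C[OF that], of "\<bar>B\<bar>"]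
      by (simp add: mult.assoc)
    show "AE y in base (L2 (ivl a b)). f y * T (\<lambda>x. c * h x + k x) y = c * (f y * T h y) + f y * T k y"
      if "h \<in> elems X" "k \<in> elems X" for h k c
      using bounded_op_lincomb[OF T that, of c] by eventually_elim (simp add: algebra_simps)
  qed
qed

text \<open>Provides the sign condition of \<open>bounded_opE\<close> for \<open>U\<close>. The
  integrand is nonnegative only almost everywhere, since \<open>ip V\<close> is unspecified at
  sections outside \<open>V\<close>.\<close>

lemma nrm_bochner_L2_nonneg:
  assumes V: "hilbert_space V" and u: "u \<in> elems (bochner_L2 J K lo hi V)"
  shows "0 \<le> nrm (bochner_L2 J K lo hi V) u"
proof -
  have "AE \<xi> in box_measure K lo hi. (\<lambda>x. u (merge J K (x, \<xi>))) \<in> elems V"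
    using u by (simp add: bochner_L2_def Let_def)
  then have "AE \<xi> in completion (box_measure K lo hi).
      0 \<le> ip V (\<lambda>x. u (merge J K (x, \<xi>))) (\<lambda>x. u (merge J K (x, \<xi>)))"
    by (intro AE_completion) (auto elim!: eventually_mono intro: hilbert_ip_nonneg[OF V])
  then show ?thesis
    by (simp add: nrm_def bochner_L2_def Let_def integral_nonneg_AE)
qed

lemma bounded_op_cont_embedded:
  assumes T: "bounded_op U Y T" and HU: "cont_embedded H U"
    and nn: "\<And>u. u \<in> elems U \<Longrightarrow> 0 \<le> nrm U u"
  shows "bounded_op H Y T"
proof -
  obtain C where C0: "0 \<le> C" and C: "\<And>u. u \<in> elems U \<Longrightarrow> nrm Y (T u) \<le> C * nrm U u"
    using bounded_opE[OF T nn] by blast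
  obtain C' where sub: "elems H \<subseteq> elems U" and C': "\<And>h. h \<in> elems H \<Longrightarrow> nrm U h \<le> C' * nrm H h"
    using HU unfolding cont_embedded_def by blast
  have "nrm Y (T h) \<le> (C * C') * nrm H h" if "h \<in> elems H" for h
    using C[OF subsetD[OF sub that]] mult_left_mono[OF C'[OF that] C0] by (simp add: mult.assoc)
  then show ?thesis
    using bounded_op_elems[OF T] bounded_op_lincomb[OF T] sub unfolding bounded_op_def by blast
qed

text \<open>The exceptional null set may depend on the tensor. A member of the span involves
  finitely many of them, and density with boundedness does the rest.\<close>

lemma bounded_op_eq_if_eq_on_etensor:
  assumes HT: "hilbert_tensor d Hs H" and Y: "hilbert_space Y"
    and S: "bounded_op H Y S" and T: "bounded_op H Y T"
    and eq: "\<And>v. \<forall>m\<in>{1..d}. v m \<in> elems (Hs m) \<Longrightarrow> AE y in base Y. S (etensor d v) y = T (etensor d v) y"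
    and h: "h \<in> elems H"
  shows "AE y in base Y. S h y = T h y"
proof -
  have H: "hilbert_space H" using HT by (simp add: hilbert_tensor_def)
  have eH: "etensor d v \<in> elems H" if "\<forall>m\<in>{1..d}. v m \<in> elems (Hs m)" for v
    using HT that by (simp add: hilbert_tensor_def)
  define D where "D = {f. \<exists>n c v. (\<forall>k<n. \<forall>m\<in>{1..d}. v k m \<in> elems (Hs m)) \<and>
    f = (\<lambda>z. \<Sum>k<(n::nat). c k * etensor d (v k) z)}"
  show ?thesis
  proof (rule bounded_op_eq_dense[where D=D, OF H Y S T _ _ _ h])
    show "D \<subseteq> elems H" unfolding D_def using eH by (auto intro!: hilbert_sum[OF H])
    fix f assume "f \<in> D"
    then obtain n c v where v: "\<And>k. k < n \<Longrightarrow> \<forall>m\<in>{1..d}. v k m \<in> elems (Hs m)"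
      and f: "f = (\<lambda>z. \<Sum>k<(n::nat). c k * etensor d (v k) z)" unfolding D_def by blast
    have e: "etensor d (v k) \<in> elems H" if "k \<in> {..<n}" for k using v that by (intro eH) auto
    have "AE y in base Y. \<forall>k\<in>{..<n}. S (etensor d (v k)) y = T (etensor d (v k)) y"
      using v by (intro AE_finite_allI eq) auto
    moreover have "AE y in base Y. S f y = (\<Sum>k<n. c k * S (etensor d (v k)) y)"
      unfolding f by (rule bounded_op_sum[OF H S finite_lessThan e])
    moreover have "AE y in base Y. T f y = (\<Sum>k<n. c k * T (etensor d (v k)) y)"
      unfolding f by (rule bounded_op_sum[OF H T finite_lessThan e])
    ultimately show "AE y in base Y. S f y = T f y"
      by eventually_elim simp
  next
    fix \<epsilon> :: real assume "0 < \<epsilon>"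
    from hilbert_tensor_dense[OF HT h this]
    obtain n c v where v: "\<forall>k<(n::nat). \<forall>m\<in>{1..d}. v k m \<in> elems (Hs m)"
      "nrm H (\<lambda>z. h z - (\<Sum>k<n. c k * etensor d (v k) z)) < \<epsilon>" by blast
    then have "(\<lambda>z. \<Sum>k<n. c k * etensor d (v k) z) \<in> D" unfolding D_def by blast
    with v(2) show "\<exists>g\<in>D. nrm H (\<lambda>x. h x - g x) < \<epsilon>" by (rule bexI)
  qed
qed

text \<open>For order 0 no choice is made: \<open>h\<close> is its own derivative, and the assumed
  existence contributes its measurability and local integrability.\<close>

lemma has_weak_deriv1_wderiv1:
  assumes "\<exists>g. has_weak_deriv1 a b l h g"
  shows "has_weak_deriv1 a b l h (wderiv1 a b l h)"
proof (cases "l = 0")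
  case True
  then show ?thesis using assms by (auto simp: wderiv1_def has_weak_deriv1_def)
next
  case False
  then show ?thesis using someI_ex[OF assms] by (simp add: wderiv1_def)
qed

text \<open>\<open>bounded_diff_op\<close> speaks of chosen weak derivatives on the box. Uniqueness
  replaces each by the tensor of one-dimensional ones, after which the separated coefficients are
  absorbed factor by factor.\<close>

lemma diff_op_etensor:
  assumes A: "bounded_diff_op d lo hi U I a A" and fin: "finite I"
    and sep: "\<forall>\<nu>\<in>I. \<forall>z\<in>(\<Pi>\<^sub>E m\<in>{1..d}. {lo m<..<hi m}).
           a \<nu> z = (\<Sum>j=1..R \<nu>. \<Prod>m\<in>{1..d}. \<alpha> \<nu> j m (z m))"
    and Hs: "\<And>\<nu> m. \<nu> \<in> I \<Longrightarrow> m \<in> {1..d} \<Longrightarrow> wderiv1_bounded (lo m) (hi m) (\<nu> m) (Hs m)"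
    and Hs0: "\<And>m. m \<in> {1..d} \<Longrightarrow> elems (Hs m) \<subseteq> elems (L2 (ivl (lo m) (hi m)))"
    and v: "\<And>m. m \<in> {1..d} \<Longrightarrow> v m \<in> elems (Hs m)" and vU: "etensor d v \<in> elems U"
  shows "AE z in box_measure {1..d} lo hi. A (etensor d v) z =
    (\<Sum>\<nu>\<in>I. \<Sum>j=1..R \<nu>. etensor d (\<lambda>m. factor_op lo hi \<alpha> (\<nu>, j) m (v m)) z)"
proof -
  let ?M = "box_measure {1..d} lo hi"
  let ?g = "\<lambda>\<nu> m. wderiv1 (lo m) (hi m) (\<nu> m) (v m)"
  have ex: "\<exists>g. has_weak_deriv d lo hi \<nu> (etensor d v) g" if "\<nu> \<in> I" for \<nu>
    using A vU that unfolding bounded_diff_op_def by blast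
  have eq: "AE z in ?M. wderiv d lo hi \<nu> (etensor d v) z = etensor d (?g \<nu>) z" if \<nu>: "\<nu> \<in> I" for \<nu>
  proof (rule has_weak_deriv_unique)
    show "has_weak_deriv d lo hi \<nu> (etensor d v) (wderiv d lo hi \<nu> (etensor d v))"
      unfolding wderiv_def by (rule someI_ex[OF ex[OF \<nu>]])
    show "has_weak_deriv d lo hi \<nu> (etensor d v) (etensor d (?g \<nu>))"
    proof (rule has_weak_deriv_etensor)
      fix m assume m: "m \<in> {1..d}"
      note L2_int = finite_measure.L2_imp_integrable[OF finite_measure_ivl]
      show "integrable (ivl (lo m) (hi m)) (v m)" using Hs0[OF m] v[OF m] by (intro L2_int) auto
      show "integrable (ivl (lo m) (hi m)) (?g \<nu> m)"
        using Hs[OF \<nu> m] v[OF m] unfolding wderiv1_bounded_def bounded_op_def by (intro L2_int) blast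
      show "has_weak_deriv1 (lo m) (hi m) (\<nu> m) (v m) (?g \<nu> m)"
        using Hs[OF \<nu> m] v[OF m] unfolding wderiv1_bounded_def by (intro has_weak_deriv1_wderiv1) blast
    qed
  qed
  have "AE z in ?M. \<forall>\<nu>\<in>I. wderiv d lo hi \<nu> (etensor d v) z = etensor d (?g \<nu>) z"
    using fin eq by (rule AE_finite_allI)
  moreover have "AE z in ?M. A (etensor d v) z = (\<Sum>\<nu>\<in>I. a \<nu> z * wderiv d lo hi \<nu> (etensor d v) z)"
    using A vU unfolding bounded_diff_op_def by blast
  \<comment> \<open>The separated form of the coefficients is available only at points of the open
    box.\<close>
  moreover have "AE z in ?M. z \<in> space ?M" by (rule AE_space)
  ultimately show ?thesis
  proof eventually_elim
    case (elim z)
    have "a \<nu> z * etensor d (?g \<nu>) z = (\<Sum>j=1..R \<nu>. etensor d (\<lambda>m. factor_op lo hi \<alpha> (\<nu>, j) m (v m)) z)"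
      if "\<nu> \<in> I" for \<nu>
      using sep that elim(3) unfolding space_box
      by (simp add: etensor_def factor_op_def sum_distrib_right prod.distrib)
    then show ?case using elim(1,2) by simp
  qed
qed

theorem proposition2p2:
  fixes dx dxi d :: nat
    and lo hi :: "nat \<Rightarrow> real"
    and V U H :: "(nat \<Rightarrow> real) fspace"
    and tr A :: "((nat \<Rightarrow> real) \<Rightarrow> real) \<Rightarrow> ((nat \<Rightarrow> real) \<Rightarrow> real)"
    and Hs :: "nat \<Rightarrow> real fspace"
    and I :: "(nat \<Rightarrow> nat) set"
    and R :: "(nat \<Rightarrow> nat) \<Rightarrow> nat"
    and a :: "(nat \<Rightarrow> nat) \<Rightarrow> (nat \<Rightarrow> real) \<Rightarrow> real"
    and \<alpha> :: "(nat \<Rightarrow> nat) \<Rightarrow> nat \<Rightarrow> nat \<Rightarrow> real \<Rightarrow> real"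
  assumes "d = dx + dxi"
    and "\<forall>m\<in>{1..d}. lo m < hi m"
    and "hilbert_space V" and "base V = box_measure {1..dx} lo hi"
    and "bounded_trace {1..dx} lo hi V tr"
    and "U = bochner_L2 {1..dx} {dx+1..d} lo hi V"
    and "finite I" and "I \<noteq> {}" and "I \<subseteq> (\<Pi>\<^sub>E m\<in>{1..d}. UNIV)"
    and "bounded_diff_op d lo hi U I a A"
    and "\<forall>\<nu>\<in>I. 1 \<le> R \<nu>"
    and "\<forall>\<nu>\<in>I. \<forall>z\<in>(\<Pi>\<^sub>E m\<in>{1..d}. {lo m<..<hi m}).
           a \<nu> z = (\<Sum>j=1..R \<nu>. \<Prod>m\<in>{1..d}. \<alpha> \<nu> j m (z m))"
    and "\<forall>\<nu>\<in>I. \<forall>j\<in>{1..R \<nu>}. \<forall>m\<in>{1..d}. continuous_on {lo m..hi m} (\<alpha> \<nu> j m)"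
    and "\<forall>s\<in>{1..d}. hilbert_space (Hs s) \<and> base (Hs s) = ivl (lo s) (hi s)"
    and "hilbert_tensor d Hs H"
    and "cont_embedded H U" and "densely_embedded H U"
    and "\<forall>s\<in>{1..d}. \<forall>l\<le>max_order I s. wderiv1_bounded (lo s) (hi s) l (Hs s)"
  shows
    "(\<forall>\<nu>\<in>I. \<forall>j\<in>{1..R \<nu>}. \<forall>s\<in>{1..d}.
        bounded_op (Hs s) (L2 (ivl (lo s) (hi s))) (factor_op lo hi \<alpha> (\<nu>, j) s)) \<and>
     (\<exists>T. (\<forall>\<nu>\<in>I. \<forall>j\<in>{1..R \<nu>}.
             is_tensor_op d lo hi Hs H (factor_op lo hi \<alpha> (\<nu>, j)) (T \<nu> j)) \<and>
          (\<forall>h\<in>elems H. AE z in box_measure {1..d} lo hi.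
             A h z = (\<Sum>\<nu>\<in>I. \<Sum>j=1..R \<nu>. T \<nu> j h z))) \<and>
     (\<exists>e. bij_betw e {1..\<Sum>\<nu>\<in>I. R \<nu>} (SIGMA \<nu>:I. {1..R \<nu>}) \<and>
          separable_operator_property d lo hi U A Hs H (\<Sum>\<nu>\<in>I. R \<nu>)
            (\<lambda>\<beta>. factor_op lo hi \<alpha> (e \<beta>)) \<and>
          local_channel_property d lo hi Hs (\<Sum>\<nu>\<in>I. R \<nu>)
            (\<lambda>\<beta>. factor_op lo hi \<alpha> (e \<beta>))
            (orders I)
            (\<lambda>s l. wderiv1 (lo s) (hi s) l)
            (\<lambda>s l \<beta>. channel_coeff \<alpha> s l (e \<beta>))) \<and>
     (\<forall>s\<in>{1..d}. card (orders I s) \<le> max_order I s + 1)"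
proof -
  have H: "hilbert_space H" and eH: "\<And>v. \<forall>m\<in>{1..d}. v m \<in> elems (Hs m) \<Longrightarrow> etensor d v \<in> elems H"
    and ipH: "\<And>v w. \<forall>m\<in>{1..d}. v m \<in> elems (Hs m) \<and> w m \<in> elems (Hs m) \<Longrightarrow>
        ip H (etensor d v) (etensor d w) = (\<Prod>m\<in>{1..d}. ip (Hs m) (v m) (w m))"
    using assms(15) by (simp_all add: hilbert_tensor_def)
  let ?M = "box_measure {1..d} lo hi" and ?fo = "factor_op lo hi \<alpha>"
  let ?S = "SIGMA \<nu>:I. {1..R \<nu>}"
  have Y: "hilbert_space (L2 ?M)" by (rule hilbert_space_L2_box) simp
  have order: "\<nu> s \<le> max_order I s" if "\<nu> \<in> I" for \<nu> s
    unfolding max_order_def using assms(7) that by (intro Max_ge) auto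
  have Hs: "hilbert_space (Hs s)" if "s \<in> {1..d}" for s using assms(14) that by blast
  have wd: "wderiv1_bounded (lo s) (hi s) l (Hs s)" if "s \<in> {1..d}" "l \<le> max_order I s" for s l
    using assms(18) that by blast
  \<comment> \<open>The order 0 derivative is the identity, so its boundedness is exactly the
    embedding into L2.\<close>
  have emb: "cont_embedded (Hs s) (L2 (ivl (lo s) (hi s)))" if "s \<in> {1..d}" for s
  proof -
    have "wderiv1 (lo s) (hi s) 0 = (\<lambda>h. h)" by (simp add: wderiv1_def fun_eq_iff)
    then have "bounded_op (Hs s) (L2 (ivl (lo s) (hi s))) (\<lambda>h. h)"
      using wd[OF that, of 0] unfolding wderiv1_bounded_def by simp
    then show ?thesis using assms(14) that unfolding bounded_op_def cont_embedded_def by auto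
  qed
  have fo: "bounded_op (Hs s) (L2 (ivl (lo s) (hi s))) (?fo p s)" if "p \<in> ?S" "s \<in> {1..d}" for p s
  proof -
    obtain \<nu> j where p: "p = (\<nu>, j)" "\<nu> \<in> I" "j \<in> {1..R \<nu>}" using \<open>p \<in> ?S\<close> by auto
    have "bounded_op (Hs s) (L2 (ivl (lo s) (hi s))) (wderiv1 (lo s) (hi s) (\<nu> s))"
      using wd[OF that(2) order[OF p(2)]] unfolding wderiv1_bounded_def by blast
    moreover have "continuous_on {lo s..hi s} (\<alpha> \<nu> j s)" using assms(13) p that by blast
    ultimately show ?thesis
      unfolding p(1) factor_op_def prod.case by (rule bounded_op_mult_continuous)
  qed
  define T where "T p = (SOME T. is_tensor_op d lo hi Hs H (?fo p) T)" for p
  have T: "is_tensor_op d lo hi Hs H (?fo p) (T p)" if "p \<in> ?S" for p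
    unfolding T_def using Hs fo[OF that] by (intro someI_ex[OF tensor_op_exists[OF assms(15)]])
  have finS: "finite ?S" using assms(7) by simp
  have AH: "bounded_op H (L2 ?M) A"
  proof (rule bounded_op_cont_embedded[OF _ assms(16)])
    show "bounded_op U (L2 ?M) A" using assms(10) unfolding bounded_diff_op_def by blast
    show "0 \<le> nrm U u" if "u \<in> elems U" for u
      using that unfolding assms(6) by (rule nrm_bochner_L2_nonneg[OF assms(3)])
  qed
  have sumT: "bounded_op H (L2 ?M) (\<lambda>h z. \<Sum>p\<in>?S. T p h z)"
    using T unfolding is_tensor_op_def by (intro bounded_op_sum_ops[OF Y finS]) blast
  have sumS: "(\<Sum>p\<in>?S. f p) = (\<Sum>\<nu>\<in>I. \<Sum>j=1..R \<nu>. f (\<nu>, j))" for f :: "(nat \<Rightarrow> nat) \<times> nat \<Rightarrow> real"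
    using assms(7) by (simp add: sum.Sigma split_def)
  have rep: "AE z in ?M. A h z = (\<Sum>p\<in>?S. T p h z)" if h: "h \<in> elems H" for h
  proof -
    have "AE z in base (L2 ?M). A h z = (\<Sum>p\<in>?S. T p h z)"
    proof (rule bounded_op_eq_if_eq_on_etensor[OF assms(15) Y AH sumT _ h])
      fix v assume v: "\<forall>m\<in>{1..d}. v m \<in> elems (Hs m)"
      have "AE z in ?M. A (etensor d v) z =
          (\<Sum>\<nu>\<in>I. \<Sum>j=1..R \<nu>. etensor d (\<lambda>m. ?fo (\<nu>, j) m (v m)) z)"
      proof (rule diff_op_etensor[OF assms(10) assms(7) assms(12)])
        show "elems (Hs m) \<subseteq> elems (L2 (ivl (lo m) (hi m)))" if "m \<in> {1..d}" for m
          using emb[OF that] unfolding cont_embedded_def by blast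
        show "etensor d v \<in> elems U" using eH[OF v] assms(16) unfolding cont_embedded_def by blast
      qed (use wd order v in auto)
      moreover have "AE z in ?M. \<forall>p\<in>?S. T p (etensor d v) z = etensor d (\<lambda>m. ?fo p m (v m)) z"
        using T v unfolding is_tensor_op_def by (intro AE_finite_allI[OF finS]) blast
      ultimately have "AE z in ?M. A (etensor d v) z = (\<Sum>p\<in>?S. T p (etensor d v) z)"
        by eventually_elim (simp add: sumS)
      then show "AE z in base (L2 ?M). A (etensor d v) z = (\<Sum>p\<in>?S. T p (etensor d v) z)"
        unfolding base_L2 .
    qed
    then show ?thesis unfolding base_L2 .
  qed
  have "card ?S = (\<Sum>\<nu>\<in>I. R \<nu>)" using assms(7) by simp
  \<comment> \<open>Any enumeration of the pairs (\<nu>, j) serves as the identification with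
    \<beta>; it starts at 1 to match the index range of the properties.\<close>
  then obtain e where e: "bij_betw e {1..\<Sum>\<nu>\<in>I. R \<nu>} ?S"
    using ex_bij_betw_nat_finite_1[OF finS] by auto
  have eS: "e \<beta> \<in> ?S" if "\<beta> \<in> {1..\<Sum>\<nu>\<in>I. R \<nu>}" for \<beta> using bij_betwE[OF e] that by blast
  have sumR: "1 \<le> (\<Sum>\<nu>\<in>I. R \<nu>)"
  proof -
    obtain \<nu> where "\<nu> \<in> I" using assms(8) by blast
    then have "1 \<le> R \<nu>" "R \<nu> \<le> (\<Sum>\<nu>\<in>I. R \<nu>)" using assms(7,11) by (auto intro: member_le_sum)
    then show ?thesis by simp
  qed
  have sep: "separable_operator_property d lo hi U A Hs H (\<Sum>\<nu>\<in>I. R \<nu>) (\<lambda>\<beta>. ?fo (e \<beta>))"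
    unfolding separable_operator_property_def
  proof (intro conjI ballI allI impI exI)
    show "hilbert_space (Hs m)" "cont_embedded (Hs m) (L2 (ivl (lo m) (hi m)))" if "m \<in> {1..d}" for m
      using Hs emb that by auto
    show "nrm H (etensor d v) = (\<Prod>m\<in>{1..d}. nrm (Hs m) (v m))" if "\<forall>m\<in>{1..d}. v m \<in> elems (Hs m)" for v
    proof -
      have "sqrt (\<Prod>m\<in>J. f m) = (\<Prod>m\<in>J. sqrt (f m))" for f and J :: "nat set"
        by (induction J rule: infinite_finite_induct) (auto simp: real_sqrt_mult)
      then show ?thesis using ipH[of v v] that by (simp add: nrm_def)
    qed
    show "bounded_op (Hs m) (L2 (ivl (lo m) (hi m))) (?fo (e \<beta>) m)"
      if "\<beta> \<in> {1..\<Sum>\<nu>\<in>I. R \<nu>}" "m \<in> {1..d}" for \<beta> m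
      by (rule fo[OF eS[OF that(1)] that(2)])
    show "is_tensor_op d lo hi Hs H (?fo (e \<beta>)) (T (e \<beta>))" if "\<beta> \<in> {1..\<Sum>\<nu>\<in>I. R \<nu>}" for \<beta>
      by (rule T[OF eS[OF that]])
    show "AE z in ?M. A h z = (\<Sum>\<beta>=1..\<Sum>\<nu>\<in>I. R \<nu>. T (e \<beta>) h z)" if "h \<in> elems H" for h
      using rep[OF that] unfolding sum.reindex_bij_betw[OF e, symmetric] .
  qed (fact assms(15-17) sumR)+
  have loc: "local_channel_property d lo hi Hs (\<Sum>\<nu>\<in>I. R \<nu>) (\<lambda>\<beta>. ?fo (e \<beta>)) (orders I)
      (\<lambda>s l. wderiv1 (lo s) (hi s) l) (\<lambda>s l \<beta>. channel_coeff \<alpha> s l (e \<beta>))"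
    unfolding local_channel_property_def
  proof (intro ballI conjI)
    fix s assume s: "s \<in> {1..d}"
    show fin: "finite (orders I s)" using assms(7) by (simp add: orders_def)
    {
      fix l assume "l \<in> orders I s"
      then have w: "wderiv1_bounded (lo s) (hi s) l (Hs s)"
        using order by (intro wd[OF s]) (auto simp: orders_def)
      then show "bounded_op (Hs s) (L2 (ivl (lo s) (hi s))) (wderiv1 (lo s) (hi s) l)"
        unfolding wderiv1_bounded_def by blast
      \<comment> \<open>A channel is a one-term differential operator with coefficient 1.\<close>
      show "differential_op1 (lo s) (hi s) (Hs s) (wderiv1 (lo s) (hi s) l)"
        unfolding differential_op1_def
        using w by (intro exI[of _ "{l}"] exI[of _ "\<lambda>_ _. 1"]) (auto simp: wderiv1_bounded_def)
    }
    fix \<beta> assume "\<beta> \<in> {1..\<Sum>\<nu>\<in>I. R \<nu>}"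
    then obtain \<nu> j where \<nu>: "e \<beta> = (\<nu>, j)" "\<nu> \<in> I" "j \<in> {1..R \<nu>}" using eS[of \<beta>] by auto
    show "continuous_on {lo s..hi s} (channel_coeff \<alpha> s l (e \<beta>))" for l
      using assms(13) \<nu> s by (auto simp: channel_coeff_def intro!: continuous_intros)
    fix v
    have "?fo (e \<beta>) s v t = (\<Sum>l\<in>orders I s. channel_coeff \<alpha> s l (e \<beta>) t * wderiv1 (lo s) (hi s) l v t)" for t
    proof -
      \<comment> \<open>Distinct multi-indices may share an order, but \<open>orders I s\<close> is
        a set, so the Kronecker delta picks exactly one channel.\<close>
      have "(\<Sum>l\<in>orders I s. channel_coeff \<alpha> s l (e \<beta>) t * wderiv1 (lo s) (hi s) l v t)
          = (\<Sum>l\<in>orders I s. if l = \<nu> s then \<alpha> \<nu> j s t * wderiv1 (lo s) (hi s) l v t else 0)"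
        by (intro sum.cong) (auto simp: channel_coeff_def \<nu>)
      also have "\<dots> = ?fo (e \<beta>) s v t"
        using fin \<nu> by (auto simp: factor_op_def orders_def)
      finally show ?thesis ..
    qed
    then show "AE t in ivl (lo s) (hi s). ?fo (e \<beta>) s v t
        = (\<Sum>l\<in>orders I s. channel_coeff \<alpha> s l (e \<beta>) t * wderiv1 (lo s) (hi s) l v t)" by simp
  qed
  have card: "card (orders I s) \<le> max_order I s + 1" for s
  proof -
    \<comment> \<open>Order 0 is counted as well, which accounts for the \<open>+ 1\<close>.\<close>
    have "orders I s \<subseteq> {..max_order I s}" using order by (auto simp: orders_def)
    from card_mono[OF finite_atMost this] show ?thesis by simp
  qed
  show ?thesis
  proof (intro conjI ballI exI)
    show "bounded_op (Hs s) (L2 (ivl (lo s) (hi s))) (?fo (\<nu>, j) s)"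
      if "\<nu> \<in> I" "j \<in> {1..R \<nu>}" "s \<in> {1..d}" for \<nu> j s
      using that by (intro fo) auto
    show "is_tensor_op d lo hi Hs H (?fo (\<nu>, j)) (T (\<nu>, j))" if "\<nu> \<in> I" "j \<in> {1..R \<nu>}" for \<nu> j
      using that by (intro T) auto
    show "AE z in ?M. A h z = (\<Sum>\<nu>\<in>I. \<Sum>j=1..R \<nu>. T (\<nu>, j) h z)" if "h \<in> elems H" for h
      using rep[OF that] unfolding sumS .
  qed (rule e sep loc card)+
qed

end
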